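(* Let $U\subset\mathbb{C}$ be a simply connected domain and let $\Phi\in\Sigma(U)$ be a piecewise analytic function, $\Phi=\sum_{i=1}^{r}A_i\chi_i$ a.e. in $U$, with data $(M_i,A_i)_{i=1}^r$ as in the context. Let $p\in U$ satisfy: (i) $p\in\overline{M_i}$ for all $1\le i\le r$; (ii) $A_i(p)-A_k(p)\notin\mathbb{R}\,(A_j(p)-A_k(p))$ for every triple $(i,j,k)$ of distinct indices in $\{1,\dots,r\}$; (iii) $A_i(p)\neq A_k(p)$ for every pair of distinct indices $i,k$. Then there exists a neighborhood $\widetilde N(p)$ of $p$ such that $\Phi=2\,\partial\varphi/\partial z$ a.e. in $\widetilde N(p)$, where $\varphi(z)=\max_{1\le i\le r}H_i(z)$ and $H_i(z)=\Re\int_p^z A_i(w)\,dw$.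
   Context: A function $\Phi\in L^1_{loc}(U)$ is called piecewise analytic with data $(M_i,A_i)_{i=1}^r$ if $M_1,\dots,M_r$ are pairwise disjoint open subsets of $U$ such that $U\setminus\bigcup_i M_i$ has Lebesgue measure zero, $A_1,\dots,A_r$ are pairwise distinct analytic functions on $U$, $\chi_i$ is the characteristic function of $M_i$, and $\Phi=\sum_{i=1}^r A_i\chi_i$ a.e. Derivatives are taken in the sense of distributions, $\partial/\partial z=\frac12(\partial_x-i\partial_y)$, $\partial/\partial\bar z=\frac12(\partial_x+i\partial_y)$. $\Sigma(U)$ denotes the set of distributions $f$ on $U$ with $\partial f/\partial\bar z\ge 0$ (i.e. $\partial f/\partial \bar z$ is a positive measure). For $p\in U$, $H_i(z)=\Re\int_p^z A_i(w)\,dw$ is a well-defined harmonic function on $U$. *)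

theory Defs
  imports "HOL-Complex_Analysis.Complex_Analysis"
begin

fun partials :: "complex list \<Rightarrow> (complex \<Rightarrow> real) \<Rightarrow> (complex \<Rightarrow> real)" where
  "partials [] f = f"
| "partials (v # vs) f = (\<lambda>z. frechet_derivative (partials vs f) (at z) v)"

definition smooth_fun :: "(complex \<Rightarrow> real) \<Rightarrow> bool" where
  "smooth_fun f \<longleftrightarrow> (\<forall>vs. set vs \<subseteq> {1, \<i>} \<longrightarrow> partials vs f differentiable_on UNIV)"

definition tsupport :: "(complex \<Rightarrow> real) \<Rightarrow> complex set" where
  "tsupport f = closure {z. f z \<noteq> 0}"

definition test_fun :: "complex set \<Rightarrow> (complex \<Rightarrow> real) \<Rightarrow> bool" where
  "test_fun U \<psi> \<longleftrightarrow> smooth_fun \<psi> \<and> compact (tsupport \<psi>) \<and> tsupport \<psi> \<subseteq> U"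

definition dz :: "(complex \<Rightarrow> real) \<Rightarrow> complex \<Rightarrow> complex" where
  "dz \<psi> z = (complex_of_real (frechet_derivative \<psi> (at z) 1)
               - \<i> * complex_of_real (frechet_derivative \<psi> (at z) \<i>)) / 2"

definition dzbar :: "(complex \<Rightarrow> real) \<Rightarrow> complex \<Rightarrow> complex" where
  "dzbar \<psi> z = (complex_of_real (frechet_derivative \<psi> (at z) 1)
               + \<i> * complex_of_real (frechet_derivative \<psi> (at z) \<i>)) / 2"

definition loc_integrable :: "complex set \<Rightarrow> (complex \<Rightarrow> complex) \<Rightarrow> bool" where
  "loc_integrable U f \<longleftrightarrow> (\<forall>K. compact K \<and> K \<subseteq> U \<longrightarrow> set_integrable lborel K f)"

definition distr_dzbar :: "(complex \<Rightarrow> complex) \<Rightarrow> (complex \<Rightarrow> real) \<Rightarrow> complex" where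
  "distr_dzbar f \<psi> = - (\<integral>z. f z * dzbar \<psi> z \<partial>lborel)"

definition distr_dz :: "(complex \<Rightarrow> complex) \<Rightarrow> (complex \<Rightarrow> real) \<Rightarrow> complex" where
  "distr_dz f \<psi> = - (\<integral>z. f z * dz \<psi> z \<partial>lborel)"

text \<open>Sigma(U): locally integrable f whose distributional derivative df/dzbar is
  a positive distribution (= positive measure) on U.\<close>
definition Sigma_class :: "complex set \<Rightarrow> (complex \<Rightarrow> complex) \<Rightarrow> bool" where
  "Sigma_class U f \<longleftrightarrow> loc_integrable U f \<and>
     (\<forall>\<psi>. test_fun U \<psi> \<and> (\<forall>z. 0 \<le> \<psi> z) \<longrightarrow>
        Im (distr_dzbar f \<psi>) = 0 \<and> 0 \<le> Re (distr_dzbar f \<psi>))"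

definition piecewise_analytic ::
  "complex set \<Rightarrow> (complex \<Rightarrow> complex) \<Rightarrow> nat \<Rightarrow> (nat \<Rightarrow> complex set)
     \<Rightarrow> (nat \<Rightarrow> complex \<Rightarrow> complex) \<Rightarrow> bool" where
  "piecewise_analytic U \<Phi> r M A \<longleftrightarrow>
     loc_integrable U \<Phi> \<and>
     (\<forall>i\<in>{1..r}. open (M i) \<and> M i \<subseteq> U) \<and>
     (\<forall>i\<in>{1..r}. \<forall>j\<in>{1..r}. i \<noteq> j \<longrightarrow> M i \<inter> M j = {}) \<and>
     U - (\<Union>i\<in>{1..r}. M i) \<in> null_sets lborel \<and>
     (\<forall>i\<in>{1..r}. A i analytic_on U) \<and>
     (\<forall>i\<in>{1..r}. \<forall>j\<in>{1..r}. i \<noteq> j \<longrightarrow> A i \<noteq> A j) \<and>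
     (AE z in lborel. z \<in> U \<longrightarrow>
        \<Phi> z = (\<Sum>i\<in>{1..r}. if z \<in> M i then A i z else 0))"

text \<open>The path integral from p to z inside U (well defined when U is simply
  connected and the integrand holomorphic).\<close>
definition path_int :: "complex set \<Rightarrow> (complex \<Rightarrow> complex) \<Rightarrow> complex \<Rightarrow> complex \<Rightarrow> complex" where
  "path_int U A p z = (THE I. \<exists>g. valid_path g \<and> path_image g \<subseteq> U \<and>
       pathstart g = p \<and> pathfinish g = z \<and> (A has_contour_integral I) g)"

definition Hfun :: "complex set \<Rightarrow> (complex \<Rightarrow> complex) \<Rightarrow> complex \<Rightarrow> complex \<Rightarrow> real" where
  "Hfun U A p z = Re (path_int U A p z)"

end

theory Submission
  imports Defs
begin

text \<open>
  Since \<open>\<Phi>\<close> has \<open>\<partial>\<Phi>/\<partial>z\<^bsup>bar\<^esup> = \<mu> \<ge> 0\<close>, its mollifications satisfy the holomorphic chain rule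
  \<open>\<partial>g(z,\<Phi>)/\<partial>z\<^bsup>bar\<^esup> = g\<^sub>w(z,\<Phi>) \<mu>\<close>. Apply it to \<open>g = log ((A\<^sub>i - \<Phi>)/Y + \<delta>)\<close>, where \<open>Y\<close> is
  holomorphic and \<open>Re ((A\<^sub>i - A\<^sub>j)/Y) > 0\<close> for \<open>j \<noteq> i\<close>: the factor multiplying \<open>\<mu>\<close> in
  \<open>Y \<partial>g/\<partial>z\<^bsup>bar\<^esup>\<close> is \<open>-1/((A\<^sub>i - \<Phi>)/Y + \<delta>)\<close>, which has negative real part. Dividing by \<open>log (1/\<delta>)\<close> and
  letting \<open>\<delta> \<rightarrow> 0\<close> turns \<open>g\<close> into \<open>-\<chi>\<^sub>i\<close>, so \<open>Re (Y \<partial>\<chi>\<^sub>i/\<partial>z\<^bsup>bar\<^esup>) \<ge> 0\<close>. If \<open>Y = \<sigma>'\<close>, this says that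
  \<open>\<chi>\<^sub>i\<close> increases along the curves on which \<open>\<sigma>\<close> moves in the positive real direction.

  Let \<open>z\<close> be near \<open>p\<close> with \<open>H\<^sub>i(z) > H\<^sub>j(z)\<close> for all \<open>j \<noteq> i\<close>, and choose \<open>k \<noteq> i\<close> minimising
  \<open>Re ((A\<^sub>i(p) - A\<^sub>k(p))(z - p))\<close>. By non-collinearity the corresponding quantities for the other
  indices are bounded below by a multiple of \<open>|z - p|\<close>. Hence the curve from a point of \<open>M\<^sub>i\<close> near \<open>p\<close>
  to \<open>z\<close> that is a straight segment in the coordinate \<open>\<integral>(A\<^sub>i - A\<^sub>k)\<close> is admissible, and \<open>z\<close> lies in the
  closure of \<open>M\<^sub>i\<close>. So near \<open>p\<close>, up to the null set of ties, \<open>M\<^sub>i\<close> is the set where \<open>H\<^sub>i\<close> is the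
  strict maximum.
\<close>

section \<open>A smooth bump function\<close>

text \<open>The obstacle: one \<open>Y\<close> must send all differences A_i - A_j into the right
  half-plane over a whole ball, while H_i(z) > H_j(z) says only that, to first order, Re ((A_i(p) -
  A_j(p)) (z - p)) is not much below 0. Non-collinearity confines near-degeneracy to the single
  index k. Hence the choice Y = (A_i - A_k)/v, where v is the increment of the primitive of A_i -
  A_k from the starting point to z: the ratio (A_i - A_k)/Y is then the constant v, and Re v > 0
  follows from the exact inequality H_i(z) > H_k(z) once the starting point is close enough to p.
  For the other j the ratio is (A_i(p) - A_j(p)) (z - p) up to an error that their first-order gap
  absorbs. Mollification comes in because the chain rule is not directly available for the
  discontinuous \<Phi>. It respects the logarithm because averages stay in half-planes; the shift by
  \<delta> also covers the variation of A_i and Y over the mollification radius, so that radius goes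
  to 0 first, with \<delta> fixed.\<close>

definition expinv :: "nat \<Rightarrow> real \<Rightarrow> real" where
  "expinv k s = (if 0 < s then exp (- (1 / s)) / s ^ k else 0)"

lemma expinv_has_derivative_0:
  "(expinv k has_real_derivative 0) (at 0)"
proof -
  have r: "((\<lambda>h. expinv k h / h) \<longlongrightarrow> 0) (at_right 0)"
  proof -
    have "((\<lambda>h::real. (inverse h) ^ (k + 1) / exp (inverse h)) \<longlongrightarrow> 0) (at_right 0)"
      by (rule filterlim_compose[OF tendsto_power_div_exp_0 filterlim_inverse_at_top_right])
    moreover have "\<forall>\<^sub>F h in at_right (0::real). (inverse h) ^ (k + 1) / exp (inverse h) = expinv k h / h"
      by (rule eventually_at_right_less[THEN eventually_mono])
         (simp add: expinv_def field_simps exp_minus)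
    ultimately show ?thesis by (rule Lim_transform_eventually)
  qed
  have l: "((\<lambda>h. expinv k h / h) \<longlongrightarrow> 0) (at_left 0)"
    by (rule tendsto_eventually) (auto simp: eventually_at_filter expinv_def)
  have "((\<lambda>h. expinv k h / h) \<longlongrightarrow> 0) (at 0)"
    using l r by (simp add: filterlim_at_split)
  thus ?thesis by (simp add: DERIV_def expinv_def)
qed

text \<open>The powers of s in the denominator make the family closed under differentiation up to
  linear combinations; \<open>k = 0\<close> is the classical exp (-1/s), and exponential decay glues
  it to 0 at the origin for every \<open>k\<close>.\<close>

lemma expinv_has_derivative:
  "(expinv k has_real_derivative (expinv (k + 2) s - real k * expinv (k + 1) s)) (at s)"
proof -
  consider "s < 0" | "s = 0" | "s > 0" by linarith
  then show ?thesis
  proof cases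
    case 1
    have "((\<lambda>s. 0) has_real_derivative 0) (at s)" by simp
    then have "(expinv k has_real_derivative 0) (at s)"
      by (rule has_field_derivative_transform_within_open[where S="{..<0}"]) (use 1 in \<open>auto simp: expinv_def\<close>)
    then show ?thesis using 1 by (simp add: expinv_def)
  next
    case 2
    then show ?thesis using expinv_has_derivative_0[of k] by (simp add: expinv_def)
  next
    case 3
    have "((\<lambda>s. exp (- (1 / s)) / s ^ k) has_real_derivative (expinv (k + 2) s - real k * expinv (k + 1) s)) (at s)"
    proof -
      have "((\<lambda>s. exp (- (1 / s)) * inverse s ^ k) has_real_derivative
          exp (- (1 / s)) * (1 / s\<^sup>2) * inverse s ^ k
            + exp (- (1 / s)) * (real k * inverse s ^ (k - 1) * (- 1 / s\<^sup>2))) (at s)"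
        using 3 by (auto intro!: derivative_eq_intros simp: inverse_eq_divide power2_eq_square)
      moreover have "real k * inverse s ^ (k - 1) * (- 1 / s\<^sup>2) = - (real k * inverse s ^ (k + 1))"
        using 3 by (cases k) (auto simp: field_simps power2_eq_square)
      moreover have "exp (- (1 / s)) * (1 / s\<^sup>2) * inverse s ^ k = expinv (k + 2) s"
          "exp (- (1 / s)) * - (real k * inverse s ^ (k + 1)) = - (real k * expinv (k + 1) s)"
        using 3 by (simp_all add: expinv_def power_add power_inverse field_simps power2_eq_square)
      moreover have "(\<lambda>s. exp (- (1 / s)) * inverse s ^ k) = (\<lambda>s::real. exp (- (1 / s)) / s ^ k)"
        by (simp add: power_inverse field_simps)
      ultimately show ?thesis by (simp only: diff_conv_add_uminus)
    qed
    then show ?thesis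
      by (rule has_field_derivative_transform_within_open[where S="{0<..}"]) (use 3 in \<open>auto simp: expinv_def\<close>)
  qed
qed

definition bump :: "complex \<Rightarrow> real \<Rightarrow> complex \<Rightarrow> real" where
  "bump a e z = expinv 0 (e\<^sup>2 - (cmod (z - a))\<^sup>2)"

text \<open>The bump function and all its partial derivatives lie in this space, which is closed under
  differentiation.\<close>
inductive_set bump_algebra :: "complex \<Rightarrow> real \<Rightarrow> (complex \<Rightarrow> real) set" for a e where
  base: "(\<lambda>z. expinv k (e\<^sup>2 - (cmod (z - a))\<^sup>2)) \<in> bump_algebra a e"
| add: "f \<in> bump_algebra a e \<Longrightarrow> g \<in> bump_algebra a e \<Longrightarrow> (\<lambda>z. f z + g z) \<in> bump_algebra a e"
| scale: "f \<in> bump_algebra a e \<Longrightarrow> (\<lambda>z. c * f z) \<in> bump_algebra a e"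
| mult_Re: "f \<in> bump_algebra a e \<Longrightarrow> (\<lambda>z. Re (z - a) * f z) \<in> bump_algebra a e"
| mult_Im: "f \<in> bump_algebra a e \<Longrightarrow> (\<lambda>z. Im (z - a) * f z) \<in> bump_algebra a e"

lemma bump_algebra_derivative:
  assumes "f \<in> bump_algebra a e"
  shows "\<exists>f1\<in>bump_algebra a e. \<exists>f2\<in>bump_algebra a e.
           \<forall>z. (f has_derivative (\<lambda>h. f1 z * Re h + f2 z * Im h)) (at z)"
  using assms
proof induction
  case (base k)
  let ?q = "\<lambda>z. e\<^sup>2 - (cmod (z - a))\<^sup>2"
  let ?g = "\<lambda>z. expinv (k + 2) (?q z) + (- real k) * expinv (k + 1) (?q z)"
  have g: "?g \<in> bump_algebra a e"
    by (intro bump_algebra.intros)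
  have q: "(?q has_derivative (\<lambda>h. - 2 * Re (z - a) * Re h - 2 * Im (z - a) * Im h)) (at z)" for z
    unfolding cmod_power2 by (auto intro!: derivative_eq_intros simp: algebra_simps)
  have "((\<lambda>z. expinv k (?q z)) has_derivative
          (\<lambda>h. (- 2 * (Re (z - a) * ?g z)) * Re h + (- 2 * (Im (z - a) * ?g z)) * Im h)) (at z)" for z
    using has_derivative_compose[OF q[of z] expinv_has_derivative[unfolded has_field_derivative_def]]
    by (rule has_derivative_eq_rhs) (auto simp: algebra_simps)
  moreover have "(\<lambda>z. - 2 * (Re (z - a) * ?g z)) \<in> bump_algebra a e"
      "(\<lambda>z. - 2 * (Im (z - a) * ?g z)) \<in> bump_algebra a e"
    using bump_algebra.scale[OF bump_algebra.mult_Re[OF g], of "- 2"]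
      bump_algebra.scale[OF bump_algebra.mult_Im[OF g], of "- 2"] by this
  ultimately show ?case by (intro bexI allI)
next
  case (add f g)
  then obtain f1 f2 g1 g2 where *: "f1 \<in> bump_algebra a e" "f2 \<in> bump_algebra a e"
      "g1 \<in> bump_algebra a e" "g2 \<in> bump_algebra a e"
      "\<And>z. (f has_derivative (\<lambda>h. f1 z * Re h + f2 z * Im h)) (at z)"
      "\<And>z. (g has_derivative (\<lambda>h. g1 z * Re h + g2 z * Im h)) (at z)" by blast
  have "((\<lambda>z. f z + g z) has_derivative (\<lambda>h. (f1 z + g1 z) * Re h + (f2 z + g2 z) * Im h)) (at z)" for z
    using has_derivative_add[OF *(5)[of z] *(6)[of z]] by (simp add: algebra_simps)
  then show ?case using bump_algebra.add[OF *(1,3)] bump_algebra.add[OF *(2,4)] by (intro bexI allI)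
next
  case (scale f c)
  then obtain f1 f2 where *: "f1 \<in> bump_algebra a e" "f2 \<in> bump_algebra a e"
      "\<And>z. (f has_derivative (\<lambda>h. f1 z * Re h + f2 z * Im h)) (at z)" by blast
  have "((\<lambda>z. c * f z) has_derivative (\<lambda>h. (c * f1 z) * Re h + (c * f2 z) * Im h)) (at z)" for z
    using has_derivative_mult_right[OF *(3)[of z], of c] by (simp add: algebra_simps)
  then show ?case using bump_algebra.scale[OF *(1), of c] bump_algebra.scale[OF *(2), of c] by (intro bexI allI)
next
  case (mult_Re f)
  then obtain f1 f2 where *: "f1 \<in> bump_algebra a e" "f2 \<in> bump_algebra a e"
      "\<And>z. (f has_derivative (\<lambda>h. f1 z * Re h + f2 z * Im h)) (at z)" by blast
  have "((\<lambda>z. Re (z - a) * f z) has_derivative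
          (\<lambda>h. (Re (z - a) * f1 z + f z) * Re h + (Re (z - a) * f2 z) * Im h)) (at z)" for z
    by (auto intro!: derivative_eq_intros *(3) simp: algebra_simps)
  then show ?case
    using bump_algebra.add[OF bump_algebra.mult_Re[OF *(1)] mult_Re(1)] bump_algebra.mult_Re[OF *(2)]
    by (intro bexI allI)
next
  case (mult_Im f)
  then obtain f1 f2 where *: "f1 \<in> bump_algebra a e" "f2 \<in> bump_algebra a e"
      "\<And>z. (f has_derivative (\<lambda>h. f1 z * Re h + f2 z * Im h)) (at z)" by blast
  have "((\<lambda>z. Im (z - a) * f z) has_derivative
          (\<lambda>h. (Im (z - a) * f1 z) * Re h + (Im (z - a) * f2 z + f z) * Im h)) (at z)" for z
    by (auto intro!: derivative_eq_intros *(3) simp: algebra_simps)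
  then show ?case
    using bump_algebra.add[OF bump_algebra.mult_Im[OF *(2)] mult_Im(1)] bump_algebra.mult_Im[OF *(1)]
    by (intro bexI allI)
qed

lemma bump_algebra_partials:
  assumes "f \<in> bump_algebra a e" and "set vs \<subseteq> {1, \<i>}"
  shows "partials vs f \<in> bump_algebra a e"
  using assms(2)
proof (induction vs)
  case Nil
  then show ?case using assms(1) by simp
next
  case (Cons v vs)
  then have "partials vs f \<in> bump_algebra a e" by simp
  from bump_algebra_derivative[OF this] obtain f1 f2
    where *: "f1 \<in> bump_algebra a e" "f2 \<in> bump_algebra a e"
      "\<And>z. (partials vs f has_derivative (\<lambda>h. f1 z * Re h + f2 z * Im h)) (at z)" by blast
  have "partials (v # vs) f = (\<lambda>z. f1 z * Re v + f2 z * Im v)"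
    using frechet_derivative_at[OF *(3)] by (simp add: fun_eq_iff)
  moreover have "v = 1 \<or> v = \<i>" using Cons.prems by simp
  ultimately show ?case using * by auto
qed

lemma smooth_fun_bump: "smooth_fun (bump a e)"
proof -
  have "bump a e \<in> bump_algebra a e"
    unfolding bump_def[abs_def] by (rule bump_algebra.base)
  show ?thesis
    unfolding smooth_fun_def
  proof (intro allI impI)
    fix vs :: "complex list" assume "set vs \<subseteq> {1, \<i>}"
    with \<open>bump a e \<in> _\<close> have "partials vs (bump a e) \<in> bump_algebra a e"
      by (rule bump_algebra_partials)
    from bump_algebra_derivative[OF this] show "partials vs (bump a e) differentiable_on UNIV"
      by (auto simp: differentiable_on_def differentiable_def)
  qed
qed

text \<open>Every member vanishes off the closed ball of radius |e| about \<open>a\<close>, by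
  induction over the generators, and is continuous on that compact ball. The absolute value is there
  because no sign of \<open>e\<close> is assumed.\<close>

lemma bump_algebra_bounded:
  assumes "f \<in> bump_algebra a e"
  shows "\<exists>B\<ge>0. \<forall>z. \<bar>f z\<bar> \<le> B"
proof -
  have z: "f z = 0" if "z \<notin> cball a \<bar>e\<bar>" for z
    using assms
  proof induction
    case (base k)
    have "\<bar>e\<bar> \<le> cmod (z - a)" using that by (simp add: dist_norm norm_minus_commute)
    then have "e\<^sup>2 \<le> (cmod (z - a))\<^sup>2" by (metis abs_ge_zero power2_abs power_mono)
    then show ?case by (simp add: expinv_def)
  qed auto
  obtain f1 f2 where "\<And>z. (f has_derivative (\<lambda>h. f1 z * Re h + f2 z * Im h)) (at z)"
    using bump_algebra_derivative[OF assms] by blast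
  then have "continuous_on (cball a \<bar>e\<bar>) f"
    using has_derivative_continuous continuous_at_imp_continuous_on by blast
  then have "bounded (f ` cball a \<bar>e\<bar>)"
    using compact_imp_bounded compact_continuous_image compact_cball by blast
  then obtain B where B: "\<And>z. z \<in> cball a \<bar>e\<bar> \<Longrightarrow> \<bar>f z\<bar> \<le> B"
    unfolding bounded_iff by (metis imageI real_norm_def)
  have "\<bar>f w\<bar> \<le> max 0 B" for w
    by (cases "w \<in> cball a \<bar>e\<bar>") (use B[of w] z[of w] in \<open>auto simp: max_def\<close>)
  then show ?thesis by (intro exI[of _ "max 0 B"]) auto
qed

text \<open>This is what differentiation under the integral sign will use: a remainder quadratic in
  h, uniformly in z. It holds because the first partials lie in the same algebra, so their own
  partials are bounded and they are Lipschitz.\<close>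

lemma bump_derivative:
  "\<exists>b1 b2. (\<forall>z. (bump 0 e has_derivative (\<lambda>h. b1 z * Re h + b2 z * Im h)) (at z)) \<and>
     (\<exists>K\<ge>0. \<forall>z h. \<bar>bump 0 e (z + h) - bump 0 e z - (b1 z * Re h + b2 z * Im h)\<bar> \<le> K * (cmod h)\<^sup>2) \<and>
     continuous_on UNIV b1 \<and> continuous_on UNIV b2 \<and> (\<exists>K. \<forall>z. \<bar>b1 z\<bar> \<le> K \<and> \<bar>b2 z\<bar> \<le> K)"
proof -
  have Lip: "\<exists>L\<ge>0. \<forall>x y. \<bar>f y - f x\<bar> \<le> L * cmod (y - x)" if f: "f \<in> bump_algebra 0 e" for f
  proof -
    obtain f1 f2 where *: "f1 \<in> bump_algebra 0 e" "f2 \<in> bump_algebra 0 e"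
        "\<And>z. (f has_derivative (\<lambda>h. f1 z * Re h + f2 z * Im h)) (at z)"
      using bump_algebra_derivative[OF f] by blast
    obtain B1 B2 where B: "0 \<le> B1" "\<And>z. \<bar>f1 z\<bar> \<le> B1" "0 \<le> B2" "\<And>z. \<bar>f2 z\<bar> \<le> B2"
      using bump_algebra_bounded[OF *(1)] bump_algebra_bounded[OF *(2)] by blast
    have "\<bar>f1 z * Re h + f2 z * Im h\<bar> \<le> (B1 + B2) * cmod h" for z h
    proof -
      have "\<bar>f1 z * Re h + f2 z * Im h\<bar> \<le> \<bar>f1 z\<bar> * \<bar>Re h\<bar> + \<bar>f2 z\<bar> * \<bar>Im h\<bar>"
        by (metis abs_mult abs_triangle_ineq)
      also have "\<dots> \<le> B1 * cmod h + B2 * cmod h"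
        by (intro add_mono mult_mono B abs_Re_le_cmod abs_Im_le_cmod) auto
      finally show ?thesis by (simp add: algebra_simps)
    qed
    then have "onorm (\<lambda>h. f1 z * Re h + f2 z * Im h) \<le> B1 + B2" for z
      by (intro onorm_le) simp
    then have "norm (f y - f x) \<le> (B1 + B2) * norm (y - x)" for x y
      by (intro differentiable_bound[of UNIV f "\<lambda>z h. f1 z * Re h + f2 z * Im h"])
         (auto intro: has_derivative_at_withinI *(3))
    then show ?thesis using B by (intro exI[of _ "B1 + B2"]) auto
  qed
  have "bump 0 e \<in> bump_algebra 0 e"
    unfolding bump_def[abs_def] by (rule bump_algebra.base)
  from bump_algebra_derivative[OF this] obtain b1 b2
    where *: "b1 \<in> bump_algebra 0 e" "b2 \<in> bump_algebra 0 e"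
      "\<And>z. (bump 0 e has_derivative (\<lambda>h. b1 z * Re h + b2 z * Im h)) (at z)" by blast
  obtain L1 L2 where L: "0 \<le> L1" "\<And>x y. \<bar>b1 y - b1 x\<bar> \<le> L1 * cmod (y - x)"
      "0 \<le> L2" "\<And>x y. \<bar>b2 y - b2 x\<bar> \<le> L2 * cmod (y - x)"
    using Lip[OF *(1)] Lip[OF *(2)] by blast
  have est: "\<bar>bump 0 e (z + h) - bump 0 e z - (b1 z * Re h + b2 z * Im h)\<bar> \<le> (L1 + L2) * (cmod h)\<^sup>2" for z h
  proof -
    have "norm (bump 0 e (z + h) - bump 0 e z - (b1 z * Re (z + h - z) + b2 z * Im (z + h - z)))
        \<le> norm (z + h - z) * ((L1 + L2) * cmod h)"
    proof (rule differentiable_bound_linearization[where S="cball z (cmod h)" and f'="\<lambda>z h. b1 z * Re h + b2 z * Im h"])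
      show "(bump 0 e has_derivative (\<lambda>h. b1 x * Re h + b2 x * Im h)) (at x within cball z (cmod h))" for x
        using *(3) by (rule has_derivative_at_withinI)
      fix x assume "x \<in> cball z (cmod h)"
      then have xh: "cmod (x - z) \<le> cmod h" by (simp add: dist_norm norm_minus_commute)
      have "\<bar>(b1 x - b1 z) * Re k + (b2 x - b2 z) * Im k\<bar> \<le> (L1 + L2) * cmod h * cmod k" for k
      proof -
        have "\<bar>b1 x - b1 z\<bar> \<le> L1 * cmod h" "\<bar>b2 x - b2 z\<bar> \<le> L2 * cmod h"
          using L(2)[of x z] L(4)[of x z] mult_left_mono[OF xh L(1)]
            mult_left_mono[OF xh L(3)] by linarith+
        then have "\<bar>b1 x - b1 z\<bar> * \<bar>Re k\<bar> + \<bar>b2 x - b2 z\<bar> * \<bar>Im k\<bar>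
            \<le> L1 * cmod h * cmod k + L2 * cmod h * cmod k"
          using L by (intro add_mono mult_mono abs_Re_le_cmod abs_Im_le_cmod) auto
        moreover have "\<bar>(b1 x - b1 z) * Re k + (b2 x - b2 z) * Im k\<bar>
            \<le> \<bar>b1 x - b1 z\<bar> * \<bar>Re k\<bar> + \<bar>b2 x - b2 z\<bar> * \<bar>Im k\<bar>"
          by (metis abs_mult abs_triangle_ineq)
        ultimately show ?thesis
          unfolding distrib_right by linarith
      qed
      then show "onorm ((\<lambda>k. b1 x * Re k + b2 x * Im k) - (\<lambda>k. b1 z * Re k + b2 z * Im k)) \<le> (L1 + L2) * cmod h"
        by (intro onorm_le) (simp add: algebra_simps)
    qed (auto simp: dist_norm mult_left_le_one_le)
    then show ?thesis by (simp add: power2_eq_square algebra_simps)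
  qed
  have cont: "continuous_on UNIV f" if f: "f \<in> bump_algebra 0 e" for f
    using bump_algebra_derivative[OF f] has_derivative_continuous continuous_at_imp_continuous_on by blast
  have bd: "\<exists>K. \<forall>z. \<bar>b1 z\<bar> \<le> K \<and> \<bar>b2 z\<bar> \<le> K"
  proof -
    obtain K1 K2 where "\<And>z. \<bar>b1 z\<bar> \<le> K1" "\<And>z. \<bar>b2 z\<bar> \<le> K2"
      using bump_algebra_bounded[OF *(1)] bump_algebra_bounded[OF *(2)] by blast
    then have "\<forall>z. \<bar>b1 z\<bar> \<le> max K1 K2 \<and> \<bar>b2 z\<bar> \<le> max K1 K2" by (meson le_max_iff_disj)
    then show ?thesis ..
  qed
  have "0 \<le> L1 + L2" using L by simp
  then have "\<exists>K\<ge>0. \<forall>z h. \<bar>bump 0 e (z + h) - bump 0 e z - (b1 z * Re h + b2 z * Im h)\<bar> \<le> K * (cmod h)\<^sup>2"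
    using est by (intro exI[of _ "L1 + L2"]) auto
  then show ?thesis using *(3) cont[OF *(1)] cont[OF *(2)] bd
    by (intro exI[of _ b1] exI[of _ b2]) simp
qed

lemma bump_pos_iff:
  assumes "0 < e" shows "bump a e z \<noteq> 0 \<longleftrightarrow> z \<in> ball a e"
proof -
  have "(cmod (z - a))\<^sup>2 < e\<^sup>2 \<longleftrightarrow> cmod (z - a) < e"
    using assms by (auto intro: power2_less_imp_less power_strict_mono)
  then show ?thesis by (simp add: bump_def expinv_def dist_norm norm_minus_commute)
qed

lemma bump_nonneg: "0 \<le> bump a e z"
  by (simp add: bump_def expinv_def)

lemma test_fun_bump:
  assumes "0 < e" "cball a e \<subseteq> U"
  shows "test_fun U (bump a e)"
proof -
  have "tsupport (bump a e) = cball a e"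
    unfolding tsupport_def bump_pos_iff[OF assms(1)] Collect_mem_eq
    using assms(1) by simp
  then show ?thesis using assms smooth_fun_bump by (simp add: test_fun_def)
qed

section \<open>Integration by parts and mollification\<close>

lemma integrable_bounded_support:
  fixes f :: "complex \<Rightarrow> 'b::{banach, second_countable_topology}"
  assumes "f \<in> borel_measurable borel" "compact K" "\<And>z. z \<in> K \<Longrightarrow> norm (f z) \<le> C" "\<And>z. z \<notin> K \<Longrightarrow> f z = 0"
  shows "integrable lborel f"
proof (rule Bochner_Integration.integrable_bound)
  show "integrable lborel (\<lambda>z. indicator K z *\<^sub>R C)"
    using assms(2) emeasure_bounded_finite[OF compact_imp_bounded[OF assms(2)]]
    by (intro integrable_scaleR_left integrable_real_indicator) (auto simp: borel_compact)
  show "f \<in> borel_measurable lborel" using assms(1) by simp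
  show "AE x in lborel. norm (f x) \<le> norm (indicator K x *\<^sub>R C)"
    using assms(3,4) by (intro AE_I2) (auto simp: indicator_def intro: order_trans[OF _ abs_ge_self])
qed

text \<open>Continuing \<open>f\<close> by 0 off \<open>K\<close> gives a function differentiable
  everywhere, since \<open>f\<close> already vanishes on \<open>W - K\<close>. By translation
  invariance every difference quotient has integral 0, and dominated convergence passes to the
  derivative. The indicator in the conclusion reflects that nothing is known of \<open>f\<close>
  outside \<open>W\<close>.\<close>

lemma integral_directional_derivative_eq_0:
  fixes f :: "complex \<Rightarrow> complex"
  assumes W: "open W" "compact K" "K \<subseteq> W"
    and der: "\<And>z. z \<in> K \<Longrightarrow> (f has_derivative f' z) (at z)"
    and supp: "\<And>z. z \<in> W - K \<Longrightarrow> f z = 0"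
    and cont: "\<And>v. continuous_on K (\<lambda>z. f' z v)"
  shows "integrable lborel (\<lambda>z. indicator K z *\<^sub>R f' z v)"
    and "(\<integral>z. indicator K z *\<^sub>R f' z v \<partial>lborel) = 0"
proof -
  define g where "g z = (if z \<in> K then f z else 0)" for z
  define g' where "g' z h = (if z \<in> K then f' z h else 0)" for z h
  have g: "(g has_derivative g' z) (at z)" for z
  proof (cases "z \<in> K")
    case True
    then have "z \<in> W" using W by auto
    have "(g has_derivative f' z) (at z)"
      by (rule has_derivative_transform_within_open[OF der[OF True] W(1) \<open>z \<in> W\<close>])
         (use supp in \<open>auto simp: g_def\<close>)
    then show ?thesis using True by (simp add: g'_def[abs_def])
  next
    case False
    have "open (- K)" using W(2) by (simp add: compact_imp_closed open_Compl)
    have "(g has_derivative (\<lambda>h. 0)) (at z)"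
      by (rule has_derivative_transform_within_open[OF has_derivative_const[of 0] \<open>open (- K)\<close>])
         (use False in \<open>auto simp: g_def\<close>)
    then show ?thesis using False by (simp add: g'_def[abs_def])
  qed
  have bnd: "\<exists>B\<ge>0. \<forall>z. norm (g' z v) \<le> B" for v
  proof -
    have "compact ((\<lambda>z. f' z v) ` K)"
      using W cont[of v] by (intro compact_continuous_image) (auto intro: continuous_on_subset)
    then obtain B where "0 < B" "\<And>z. z \<in> K \<Longrightarrow> norm (f' z v) \<le> B"
      using compact_imp_bounded bounded_pos by (metis imageI)
    then show ?thesis by (intro exI[of _ B]) (auto simp: g'_def)
  qed
  have meas: "(\<lambda>z. g' z v) \<in> borel_measurable borel" for v
  proof -
    have "(\<lambda>z. indicator K z *\<^sub>R f' z v) \<in> borel_measurable borel"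
      using W cont[of v] by (intro borel_measurable_continuous_on_indicator)
        (auto simp: borel_compact intro: continuous_on_subset)
    also have "(\<lambda>z. indicator K z *\<^sub>R f' z v) = (\<lambda>z. g' z v)" by (auto simp: g'_def)
    finally show ?thesis .
  qed
  have eq: "(\<lambda>z. indicator K z *\<^sub>R f' z v) = (\<lambda>z. g' z v)" by (auto simp: g'_def)
  obtain B where B: "0 \<le> B" "\<And>z. norm (g' z v) \<le> B" using bnd by blast
  show "integrable lborel (\<lambda>z. indicator K z *\<^sub>R f' z v)"
    unfolding eq by (rule integrable_bounded_support[OF meas W(2), where C=B])
      (use B(2) in simp, simp add: g'_def)
  obtain r where r: "0 < r" "K \<subseteq> cball 0 r"
    using compact_imp_bounded[OF W(2)] bounded_subset_ballD ball_subset_cball by (metis subset_trans)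
  \<comment> \<open>The difference quotients below shift points by at most \<open>norm v\<close>, so
    this ball contains all their supports; a multiple of its indicator is the dominating
    function.\<close>
  let ?C = "cball (0::complex) (r + norm v)"
  define q where "q n z = real (Suc n) *\<^sub>R (g (z + (1 / real (Suc n)) *\<^sub>R v) - g z)" for n z
  have gcont: "continuous_on UNIV g"
    using g has_derivative_continuous continuous_at_imp_continuous_on by blast
  have gmeas: "g \<in> borel_measurable borel"
    using gcont by (rule borel_measurable_continuous_onI)
  have gint: "integrable lborel g"
  proof -
    have "compact (g ` K)" using gcont W(2) by (intro compact_continuous_image) (auto intro: continuous_on_subset)
    then obtain D where "\<And>z. z \<in> K \<Longrightarrow> norm (g z) \<le> D"
      using compact_imp_bounded bounded_iff by (metis imageI)
    then show ?thesis by (intro integrable_bounded_support[OF gmeas W(2), where C=D]) (auto simp: g_def)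
  qed
  have shift: "integrable lborel (\<lambda>z. g (z + c))" "(\<integral>z. g (z + c) \<partial>lborel) = (\<integral>z. g z \<partial>lborel)" for c
  proof -
    have d: "distr lborel borel ((+) c) = (lborel :: complex measure)" by (rule lborel_distr_plus)
    have "integrable (distr lborel borel ((+) c)) g" using gint by (simp add: d)
    then have "integrable lborel (\<lambda>z. g (c + z))"
      by (subst (asm) integrable_distr_eq) (auto intro: gmeas)
    then show "integrable lborel (\<lambda>z. g (z + c))" by (simp add: add.commute)
    have "(\<integral>z. g z \<partial>distr lborel borel ((+) c)) = (\<integral>z. g (c + z) \<partial>lborel)"
      by (rule integral_distr) (auto intro: gmeas)
    then show "(\<integral>z. g (z + c) \<partial>lborel) = (\<integral>z. g z \<partial>lborel)"
      by (simp add: d add.commute)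
  qed
  have q0: "(\<integral>z. q n z \<partial>lborel) = 0" for n
    unfolding q_def using shift gint by simp
  have qlim: "(\<lambda>n. q n z) \<longlonglongrightarrow> g' z v" for z
  proof -
    have "((\<lambda>t. (g (z + t *\<^sub>R v) - g z) /\<^sub>R t) \<longlongrightarrow> g' z v) (at 0)"
    proof -
      have "((\<lambda>t. g (z + t *\<^sub>R v)) has_derivative (\<lambda>t. g' z (t *\<^sub>R v))) (at 0)"
        by (rule has_derivative_compose[where f="\<lambda>t. z + t *\<^sub>R v" and g=g])
           (use g[of z] in \<open>auto intro!: derivative_eq_intros\<close>)
      moreover have "g' z (t *\<^sub>R v) = t *\<^sub>R g' z v" for t
        by (metis g has_derivative_linear linear_scale)
      ultimately have "((\<lambda>t. g (z + t *\<^sub>R v)) has_derivative (\<lambda>t. t *\<^sub>R g' z v)) (at 0)" by simp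
      then have "((\<lambda>t. norm (g (z + t *\<^sub>R v) - g z - t *\<^sub>R g' z v) / norm t) \<longlongrightarrow> 0) (at 0)"
        by (simp add: has_derivative_at)
      moreover have "\<forall>\<^sub>F t in at 0. norm (g (z + t *\<^sub>R v) - g z - t *\<^sub>R g' z v) / norm t
          = norm ((g (z + t *\<^sub>R v) - g z) /\<^sub>R t - g' z v)"
        unfolding eventually_at_filter
      proof (intro always_eventually allI impI)
        fix t :: real assume "t \<noteq> 0"
        then have "(g (z + t *\<^sub>R v) - g z) /\<^sub>R t - g' z v = (g (z + t *\<^sub>R v) - g z - t *\<^sub>R g' z v) /\<^sub>R t"
          by (simp add: algebra_simps)
        then show "norm (g (z + t *\<^sub>R v) - g z - t *\<^sub>R g' z v) / norm t
          = norm ((g (z + t *\<^sub>R v) - g z) /\<^sub>R t - g' z v)"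
          by (simp add: divide_inverse mult.commute)
      qed
      ultimately have "((\<lambda>t. norm ((g (z + t *\<^sub>R v) - g z) /\<^sub>R t - g' z v)) \<longlongrightarrow> 0) (at 0)"
        by (rule Lim_transform_eventually)
      then show ?thesis by (rule LIM_zero_cancel[OF tendsto_norm_zero_cancel])
    qed
    then have "(\<lambda>n. (g (z + (1 / real (Suc n)) *\<^sub>R v) - g z) /\<^sub>R (1 / real (Suc n))) \<longlonglongrightarrow> g' z v"
      by (rule filterlim_compose)
        (use LIMSEQ_inverse_real_of_nat in \<open>simp add: filterlim_at inverse_eq_divide\<close>)
    then show ?thesis by (simp add: q_def)
  qed
  obtain B1 B2 where B12: "0 \<le> B1" "0 \<le> B2" "\<And>z. norm (g' z 1) \<le> B1" "\<And>z. norm (g' z \<i>) \<le> B2"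
    using bnd[of 1] bnd[of \<i>] by blast
  have onorm: "onorm (g' z) \<le> B1 + B2" for z
  proof (rule onorm_le)
    fix h
    have "h = Re h *\<^sub>R 1 + Im h *\<^sub>R \<i>" by (simp add: complex_eq_iff)
    then have "g' z h = g' z (Re h *\<^sub>R 1 + Im h *\<^sub>R \<i>)" by simp
    also have "\<dots> = Re h *\<^sub>R g' z 1 + Im h *\<^sub>R g' z \<i>"
      by (metis g has_derivative_linear linear_add linear_scale)
    finally have "norm (g' z h) \<le> \<bar>Re h\<bar> * norm (g' z 1) + \<bar>Im h\<bar> * norm (g' z \<i>)"
      by (metis norm_scaleR norm_triangle_ineq)
    also have "\<dots> \<le> cmod h * B1 + cmod h * B2"
      by (intro add_mono mult_mono B12 abs_Re_le_cmod abs_Im_le_cmod) auto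
    finally show "norm (g' z h) \<le> (B1 + B2) * norm h" by (simp add: algebra_simps)
  qed
  have Lip: "norm (g x - g y) \<le> (B1 + B2) * norm (x - y)" for x y
    by (rule differentiable_bound[of UNIV g g']) (auto intro: has_derivative_at_withinI g onorm)
  have qb: "norm (q n z) \<le> (B1 + B2) * norm v" for n z
  proof -
    have "norm (q n z) \<le> real (Suc n) * ((B1 + B2) * norm (z + (1 / real (Suc n)) *\<^sub>R v - z))"
      unfolding q_def norm_scaleR by (intro mult_mono Lip) auto
    also have "\<dots> = (B1 + B2) * norm v" by (simp add: field_simps)
    finally show ?thesis .
  qed
  have qs: "q n z = 0" if "z \<notin> ?C" for n z
  proof -
    have big: "r + norm v < norm z" using that by simp
    have "z \<notin> K" using r(2) big by (smt (verit) mem_cball_0 norm_ge_zero subsetD)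
    moreover have "z + (1 / real (Suc n)) *\<^sub>R v \<notin> K"
    proof
      assume "z + (1 / real (Suc n)) *\<^sub>R v \<in> K"
      then have "norm (z + (1 / real (Suc n)) *\<^sub>R v) \<le> r" using r(2) by auto
      moreover have "norm ((1 / real (Suc n)) *\<^sub>R v) \<le> norm v"
        by (simp add: divide_le_eq mult_le_cancel_left1)
      ultimately show False using big norm_triangle_ineq4[of "z + (1 / real (Suc n)) *\<^sub>R v" "(1 / real (Suc n)) *\<^sub>R v"]
        by simp
    qed
    ultimately show ?thesis by (simp add: q_def g_def)
  qed
  have "(\<lambda>n. \<integral>z. q n z \<partial>lborel) \<longlonglongrightarrow> (\<integral>z. g' z v \<partial>lborel)"
  proof (rule integral_dominated_convergence[where w="\<lambda>z. indicator ?C z *\<^sub>R ((B1 + B2) * norm v)"])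
    show "integrable lborel (\<lambda>z. indicator ?C z *\<^sub>R ((B1 + B2) * norm v))"
      by (intro integrable_scaleR_left integrable_real_indicator) (use emeasure_bounded_finite[OF bounded_cball] in auto)
    show "q n \<in> borel_measurable lborel" for n
      unfolding q_def[abs_def] using gmeas by measurable
    show "AE z in lborel. norm (q n z) \<le> indicator ?C z *\<^sub>R ((B1 + B2) * norm v)" for n
      using qb qs by (intro AE_I2) (auto simp: indicator_def)
  qed (use qlim meas in auto)
  then show "(\<integral>z. indicator K z *\<^sub>R f' z v \<partial>lborel) = 0"
    unfolding eq q0 by (simp add: LIMSEQ_const_iff)
qed

text \<open>If \<open>T\<close> is the real derivative of \<open>f\<close> at a point, \<open>wbar T\<close> is \<open>\<partial>f/\<partial>z\<^bsup>bar\<^esup>\<close> there.\<close>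
definition wbar :: "(complex \<Rightarrow> complex) \<Rightarrow> complex" where
  "wbar T = (T 1 + \<i> * T \<i>) / 2"

lemma bump_reflect: "(\<lambda>w. bump 0 e (z - w)) = bump z e"
  by (simp add: bump_def[abs_def] norm_minus_commute)

lemma bump_integral_pos:
  assumes "0 < e"
  shows "integrable lborel (bump a e)" "0 < (\<integral>z. bump a e z \<partial>lborel)"
proof -
  have "bump a e \<in> bump_algebra a e"
    unfolding bump_def[abs_def] by (rule bump_algebra.base)
  then obtain B where B: "\<And>z. \<bar>bump a e z\<bar> \<le> B" using bump_algebra_bounded by blast
  have cont: "continuous_on UNIV (bump a e)"
    using bump_algebra_derivative[OF \<open>bump a e \<in> _\<close>]
    by (auto intro: has_derivative_continuous continuous_at_imp_continuous_on)
  show int: "integrable lborel (bump a e)"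
    by (rule integrable_bounded_support[OF _ compact_cball[of a e], where C=B])
       (use assms B bump_pos_iff[of e a] cont in \<open>auto intro: borel_measurable_continuous_onI simp: less_eq_real_def\<close>)
  have "(\<integral>z. bump a e z \<partial>lborel) \<noteq> 0"
  proof
    assume "(\<integral>z. bump a e z \<partial>lborel) = 0"
    then have "AE z in lborel. bump a e z = 0"
      using int bump_nonneg by (subst (asm) integral_nonneg_eq_0_iff_AE) auto
    then have "AE z in lborel. z \<notin> ball a e"
      by (rule AE_mp) (use bump_pos_iff[OF assms] in auto)
    then have "ball a e \<in> null_sets lborel" by (simp add: AE_iff_null_sets)
    then have "negligible (ball a e)" by (simp add: negligible_iff_null_sets null_sets_completionI)
    then show False using assms open_not_negligible by (metis centre_in_ball empty_iff open_ball)
  qed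
  moreover have "0 \<le> (\<integral>z. bump a e z \<partial>lborel)" using bump_nonneg by (intro integral_nonneg_AE) auto
  ultimately show "0 < (\<integral>z. bump a e z \<partial>lborel)" by simp
qed

section \<open>Mollification: derivative, convexity, convergence\<close>

definition mollify :: "real \<Rightarrow> (complex \<Rightarrow> complex) \<Rightarrow> complex \<Rightarrow> complex" where
  "mollify e f z = (\<integral>w. f w * of_real (bump 0 e (z - w)) \<partial>lborel) / of_real (\<integral>w. bump 0 e w \<partial>lborel)"

text \<open>The \<open>wbar\<close> identity is the link to \<open>Sigma_class\<close>:
  differentiating the kernel at z - w in z instead of w changes the sign, which the minus in
  \<open>distr_dzbar\<close> undoes. So positivity of a distribution on bumps becomes pointwise
  positivity for the mollified function. Continuity of \<open>D\<close> is recorded for the later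
  integration by parts.\<close>

lemma mollify_derivative:
  assumes e: "0 < e" and f: "integrable lborel f"
  shows "\<exists>D. (\<forall>z. (mollify e f has_derivative D z) (at z)) \<and> (\<forall>v. continuous_on UNIV (\<lambda>z. D z v)) \<and>
     (\<forall>z. wbar (D z) = distr_dzbar f (bump z e) / of_real (\<integral>w. bump 0 e w \<partial>lborel))"
proof -
  let ?c = "complex_of_real (\<integral>w. bump 0 e w \<partial>lborel)"
  have c: "?c \<noteq> 0" using bump_integral_pos(2)[OF e, of 0] by simp
  obtain b1 b2 K L where der: "\<And>z. (bump 0 e has_derivative (\<lambda>h. b1 z * Re h + b2 z * Im h)) (at z)"
    and K: "0 \<le> K" "\<And>z h. \<bar>bump 0 e (z + h) - bump 0 e z - (b1 z * Re h + b2 z * Im h)\<bar> \<le> K * (cmod h)\<^sup>2"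
    and cont: "continuous_on UNIV b1" "continuous_on UNIV b2"
    and L: "\<And>z. \<bar>b1 z\<bar> \<le> L" "\<And>z. \<bar>b2 z\<bar> \<le> L"
    using bump_derivative[of e] by blast
  have fm [measurable]: "f \<in> borel_measurable borel" using f by auto
  have cont0: "continuous_on UNIV (bump 0 e)"
    using der by (auto intro: has_derivative_continuous continuous_at_imp_continuous_on)
  have m [measurable]: "b1 \<in> borel_measurable borel" "b2 \<in> borel_measurable borel" "bump 0 e \<in> borel_measurable borel"
    using cont cont0 by (auto intro: borel_measurable_continuous_onI)
  have int: "integrable lborel (\<lambda>w. f w * of_real (b (z - w)))"
    if "b \<in> borel_measurable borel" "\<And>z. \<bar>b z\<bar> \<le> L'" for b :: "complex \<Rightarrow> real" and L' z
  proof (rule Bochner_Integration.integrable_bound[OF integrable_mult_right[OF integrable_norm[OF f], of L']])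
    show "(\<lambda>w. f w * of_real (b (z - w))) \<in> borel_measurable lborel" using that(1) by measurable
    have "0 \<le> L'" using that(2)[of 0] by linarith
    then show "AE w in lborel. norm (f w * of_real (b (z - w))) \<le> norm (L' * norm (f w))"
      using that(2) by (intro AE_I2) (simp add: norm_mult abs_mult mult.commute[of _ "cmod _"] mult_left_mono)
  qed
  have bmem: "bump 0 e \<in> bump_algebra 0 e"
    unfolding bump_def[abs_def] by (rule bump_algebra.base)
  then obtain B where B: "\<And>z. \<bar>bump 0 e z\<bar> \<le> B" using bump_algebra_bounded by blast
  note i1 = int[OF m(1) L(1)] and i2 = int[OF m(2) L(2)] and i0 = int[OF m(3) B]
  define I1 where "I1 z = (\<integral>w. f w * of_real (b1 (z - w)) \<partial>lborel)" for z
  define I2 where "I2 z = (\<integral>w. f w * of_real (b2 (z - w)) \<partial>lborel)" for z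
  define I0 where "I0 z = (\<integral>w. f w * of_real (bump 0 e (z - w)) \<partial>lborel)" for z
  define N where "N = (\<integral>w. norm (f w) \<partial>lborel)"
  define D where "D z h = (of_real (Re h) * I1 z + of_real (Im h) * I2 z) / ?c" for z h
  have est: "norm (I0 (z + h) - I0 z - (of_real (Re h) * I1 z + of_real (Im h) * I2 z)) \<le> K * N * (norm h)\<^sup>2" for z h
  proof -
    have 1: "I0 (z + h) - I0 z - (of_real (Re h) * I1 z + of_real (Im h) * I2 z)
        = (\<integral>w. f w * of_real (bump 0 e (z + h - w)) - f w * of_real (bump 0 e (z - w))
             - (of_real (Re h) * (f w * of_real (b1 (z - w))) + of_real (Im h) * (f w * of_real (b2 (z - w)))) \<partial>lborel)"
      unfolding I0_def I1_def I2_def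
      by (simp add: i0 i1 i2)
    have 2: "norm (\<integral>w. f w * of_real (bump 0 e (z + h - w)) - f w * of_real (bump 0 e (z - w))
             - (of_real (Re h) * (f w * of_real (b1 (z - w))) + of_real (Im h) * (f w * of_real (b2 (z - w)))) \<partial>lborel)
        \<le> (\<integral>w. K * (norm h)\<^sup>2 * norm (f w) \<partial>lborel)"
    proof (rule Bochner_Integration.integral_norm_bound_integral)
      have s1: "integrable lborel (\<lambda>w. of_real (Re h) * (f w * of_real (b1 (z - w))) + of_real (Im h) * (f w * of_real (b2 (z - w))))"
        by (rule Bochner_Integration.integrable_add[OF integrable_mult_right[OF i1] integrable_mult_right[OF i2]])
      have s2: "integrable lborel (\<lambda>w. f w * of_real (bump 0 e (z + h - w)) - f w * of_real (bump 0 e (z - w)))"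
        by (rule Bochner_Integration.integrable_diff[OF i0 i0])
      show "integrable lborel (\<lambda>w. f w * of_real (bump 0 e (z + h - w)) - f w * of_real (bump 0 e (z - w))
             - (of_real (Re h) * (f w * of_real (b1 (z - w))) + of_real (Im h) * (f w * of_real (b2 (z - w)))))"
        by (rule Bochner_Integration.integrable_diff[OF s2 s1])
      show "integrable lborel (\<lambda>w. K * (norm h)\<^sup>2 * norm (f w))" using f by simp
      fix w
      have "f w * of_real (bump 0 e (z + h - w)) - f w * of_real (bump 0 e (z - w))
             - (of_real (Re h) * (f w * of_real (b1 (z - w))) + of_real (Im h) * (f w * of_real (b2 (z - w))))
          = f w * of_real (bump 0 e (z - w + h) - bump 0 e (z - w) - (b1 (z - w) * Re h + b2 (z - w) * Im h))"
        by (simp add: algebra_simps)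
      also have "norm \<dots> \<le> norm (f w) * (K * (cmod h)\<^sup>2)"
        unfolding norm_mult norm_of_real by (intro mult_left_mono K) auto
      finally show "norm (f w * of_real (bump 0 e (z + h - w)) - f w * of_real (bump 0 e (z - w))
             - (of_real (Re h) * (f w * of_real (b1 (z - w))) + of_real (Im h) * (f w * of_real (b2 (z - w)))))
          \<le> K * (norm h)\<^sup>2 * norm (f w)" by (simp add: algebra_simps)
    qed
    have 3: "(\<integral>w. K * (norm h)\<^sup>2 * norm (f w) \<partial>lborel) = K * N * (norm h)\<^sup>2" by (simp add: N_def)
    show ?thesis using 2 unfolding 1 3 .
  qed
  have I0: "(I0 has_derivative (\<lambda>h. of_real (Re h) * I1 z + of_real (Im h) * I2 z)) (at z)" for z
    unfolding has_derivative_at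
  proof
    show "bounded_linear (\<lambda>h. of_real (Re h) * I1 z + of_real (Im h) * I2 z)"
      by (intro bounded_linear_add bounded_linear_mult_const bounded_linear_of_real
          bounded_linear_compose[OF bounded_linear_of_real bounded_linear_Re]
          bounded_linear_compose[OF bounded_linear_of_real bounded_linear_Im])
    have lim: "((\<lambda>h::complex. K * N * norm h) \<longlongrightarrow> 0) (at 0)"
      by (auto intro!: tendsto_eq_intros)
    show "((\<lambda>h. norm (I0 (z + h) - I0 z - (of_real (Re h) * I1 z + of_real (Im h) * I2 z)) / norm h) \<longlongrightarrow> 0) (at 0)"
    proof (rule Lim_null_comparison[OF _ lim])
      show "\<forall>\<^sub>F h in at 0. norm (norm (I0 (z + h) - I0 z - (of_real (Re h) * I1 z + of_real (Im h) * I2 z)) / norm h) \<le> K * N * norm h"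
        unfolding eventually_at_filter
        using est by (intro always_eventually allI impI) (simp add: divide_le_eq power2_eq_square mult.assoc)
    qed
  qed
  have D: "(mollify e f has_derivative D z) (at z)" for z
  proof -
    have "((\<lambda>z. I0 z / ?c) has_derivative D z) (at z)"
      unfolding D_def[abs_def] using c by (auto intro!: derivative_eq_intros I0)
    then show ?thesis by (simp add: mollify_def[abs_def] I0_def)
  qed
  have contI: "continuous_on UNIV (\<lambda>z. \<integral>w. f w * of_real (b (z - w)) \<partial>lborel)"
    if b: "b \<in> borel_measurable borel" "\<And>z. \<bar>b z\<bar> \<le> L" "continuous_on UNIV b" for b :: "complex \<Rightarrow> real"
  proof (rule continuous_on_sequentiallyI)
    fix u :: "nat \<Rightarrow> complex" and z assume u: "u \<longlonglongrightarrow> z"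
    have "0 \<le> L" using b(2)[of 0] by linarith
    show "(\<lambda>n. \<integral>w. f w * of_real (b (u n - w)) \<partial>lborel) \<longlonglongrightarrow> (\<integral>w. f w * of_real (b (z - w)) \<partial>lborel)"
    proof (rule integral_dominated_convergence[where w="\<lambda>w. L * norm (f w)"])
      show "AE w in lborel. (\<lambda>n. f w * of_real (b (u n - w))) \<longlonglongrightarrow> f w * of_real (b (z - w))"
      proof (intro AE_I2 tendsto_intros)
        fix w
        have "isCont b (z - w)" using b(3) by (simp add: continuous_on_eq_continuous_at)
        then show "(\<lambda>n. b (u n - w)) \<longlonglongrightarrow> b (z - w)"
          by (rule isCont_tendsto_compose) (intro tendsto_intros u)
      qed
      show "AE w in lborel. norm (f w * of_real (b (u n - w))) \<le> L * norm (f w)" for n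
        using b(2) by (intro AE_I2) (simp add: norm_mult mult.commute[of _ "cmod _"] mult_left_mono)
    qed (use f b(1) in auto)
  qed
  have "continuous_on UNIV I1" "continuous_on UNIV I2"
    unfolding I1_def[abs_def] I2_def[abs_def] using m L cont by (auto intro!: contI)
  then have Dc: "continuous_on UNIV (\<lambda>z. D z v)" for v
    unfolding D_def using c by (intro continuous_intros) auto
  have W: "wbar (D z) = distr_dzbar f (bump z e) / ?c" for z
  proof -
    have "(bump z e has_derivative (\<lambda>h. - (b1 (z - w) * Re h + b2 (z - w) * Im h))) (at w)" for w
    proof -
      have "((\<lambda>w. bump 0 e (z - w)) has_derivative (\<lambda>h. b1 (z - w) * Re (- h) + b2 (z - w) * Im (- h))) (at w)"
        by (rule has_derivative_compose[OF _ der]) (auto intro!: derivative_eq_intros)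
      moreover have "(\<lambda>w. bump 0 e (z - w)) = bump z e"
        by (rule bump_reflect)
      ultimately show ?thesis by simp
    qed
    then have "frechet_derivative (bump z e) (at w) = (\<lambda>h. - (b1 (z - w) * Re h + b2 (z - w) * Im h))" for w
      by (metis frechet_derivative_at)
    then have "distr_dzbar f (bump z e) = - (\<integral>w. - (f w * of_real (b1 (z - w)) + \<i> * (f w * of_real (b2 (z - w)))) / 2 \<partial>lborel)"
      by (simp add: distr_dzbar_def dzbar_def algebra_simps)
    also have "\<dots> = (I1 z + \<i> * I2 z) / 2"
      using i1 i2 by (simp add: I1_def I2_def) (simp add: field_simps)
    finally show ?thesis by (simp add: wbar_def D_def add_divide_distrib mult.commute)
  qed
  show ?thesis using D Dc W by blast
qed

text \<open>The mollified value is an average of \<open>f\<close> over \<open>ball z e\<close> with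
  nonnegative weights of total mass 1, so it cannot leave a closed half-plane containing the values.
  This is what later keeps the argument of the logarithm away from the branch cut.\<close>

lemma mollify_halfplane:
  assumes e: "0 < e" and f: "integrable lborel f"
    and le: "AE w in lborel. w \<in> ball z e \<longrightarrow> Re (u * f w) \<le> t"
  shows "Re (u * mollify e f z) \<le> t"
proof -
  let ?c = "\<integral>w. bump 0 e w \<partial>lborel"
  have c: "0 < ?c" using bump_integral_pos(2)[OF e, of 0] .
  have bmem: "bump 0 e \<in> bump_algebra 0 e"
    unfolding bump_def[abs_def] by (rule bump_algebra.base)
  then obtain B where B: "\<And>z. \<bar>bump 0 e z\<bar> \<le> B" using bump_algebra_bounded by blast
  have [measurable]: "bump 0 e \<in> borel_measurable borel"
    using bump_integral_pos(1)[OF e] by auto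
  have fm [measurable]: "f \<in> borel_measurable borel" using f by auto
  have "0 \<le> B" using B[of 0] by linarith
  have int: "integrable lborel (\<lambda>w. f w * of_real (bump 0 e (z - w)))"
    by (rule Bochner_Integration.integrable_bound[OF integrable_mult_right[OF integrable_norm[OF f], of B]])
       (use B \<open>0 \<le> B\<close> in \<open>auto simp: norm_mult abs_mult mult.commute[of _ "cmod _"] intro!: mult_left_mono AE_I2\<close>)
  have ci: "integrable lborel (\<lambda>w. bump 0 e (z - w))" "(\<integral>w. bump 0 e (z - w) \<partial>lborel) = ?c"
  proof -
    have *: "(\<lambda>w. bump 0 e (z - w)) = bump z e" by (rule bump_reflect)
    show "integrable lborel (\<lambda>w. bump 0 e (z - w))" unfolding * by (rule bump_integral_pos(1)[OF e])
    have "?c = (\<integral>w. bump 0 e w \<partial>distr lborel borel ((+) (- z)))" by (simp add: lborel_distr_plus)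
    also have "\<dots> = (\<integral>w. bump 0 e (- z + w) \<partial>lborel)" by (rule integral_distr) auto
    also have "(\<lambda>w. bump 0 e (- z + w)) = bump z e" by (simp add: bump_def[abs_def])
    finally show "(\<integral>w. bump 0 e (z - w) \<partial>lborel) = ?c" unfolding * by simp
  qed
  have "Re (u * (\<integral>w. f w * of_real (bump 0 e (z - w)) \<partial>lborel)) = (\<integral>w. Re (u * (f w * of_real (bump 0 e (z - w)))) \<partial>lborel)"
    using int by (subst integral_Re) (simp_all only: integrable_mult_right integral_mult_right_zero)
  also have "\<dots> \<le> (\<integral>w. t * bump 0 e (z - w) \<partial>lborel)"
  proof (rule integral_mono_AE)
    show "integrable lborel (\<lambda>w. Re (u * (f w * of_real (bump 0 e (z - w)))))"
      using int by (intro integrable_Re integrable_mult_right)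
    show "integrable lborel (\<lambda>w. t * bump 0 e (z - w))" using ci by simp
    show "AE w in lborel. Re (u * (f w * of_real (bump 0 e (z - w)))) \<le> t * bump 0 e (z - w)"
      using le
    proof eventually_elim
      case (elim w)
      have "Re (u * (f w * of_real (bump 0 e (z - w)))) = Re (u * f w) * bump 0 e (z - w)"
        by (simp add: algebra_simps)
      moreover have "Re (u * f w) * bump 0 e (z - w) \<le> t * bump 0 e (z - w)"
      proof (cases "w \<in> ball z e")
        case True
        then show ?thesis using elim by (intro mult_right_mono bump_nonneg) auto
      next
        case False
        then have "bump 0 e (z - w) = 0" using bump_pos_iff[OF e, of z w] bump_reflect[of e z] by (simp add: fun_eq_iff)
        then show ?thesis by simp
      qed
      ultimately show ?case by simp
    qed
  qed
  also have "\<dots> = t * ?c" using ci by simp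
  finally have "Re (u * (\<integral>w. f w * of_real (bump 0 e (z - w)) \<partial>lborel)) / ?c \<le> t"
    using c by (simp add: divide_le_eq)
  then show ?thesis by (simp add: mollify_def flip: Re_divide_of_real)
qed

text \<open>A disc is an intersection of half-planes, and the one whose normal points from
  \<open>k\<close> to the mollified value already gives the bound.\<close>

lemma mollify_dist_le:
  assumes e: "0 < e" and f: "integrable lborel f"
    and le: "AE w in lborel. w \<in> ball z e \<longrightarrow> norm (f w - k) \<le> t" and t: "0 \<le> t"
  shows "norm (mollify e f z - k) \<le> t"
proof (cases "mollify e f z = k")
  case False
  define d where "d = mollify e f z - k"
  define u where "u = cnj d / of_real (norm d)"
  have d: "d \<noteq> 0" using False by (simp add: d_def)
  have nu: "norm u = 1" using d by (simp add: u_def norm_divide)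
  have "AE w in lborel. w \<in> ball z e \<longrightarrow> Re (u * f w) \<le> t + Re (u * k)"
    using le
  proof eventually_elim
    case (elim w)
    show ?case
    proof
      assume "w \<in> ball z e"
      have "Re (u * (f w - k)) \<le> norm (u * (f w - k))" by (rule complex_Re_le_cmod)
      also have "\<dots> \<le> t" using elim \<open>w \<in> ball z e\<close> nu by (simp add: norm_mult)
      finally show "Re (u * f w) \<le> t + Re (u * k)" by (simp add: algebra_simps)
    qed
  qed
  from mollify_halfplane[OF e f this] have "Re (u * d) \<le> t" by (simp add: d_def algebra_simps)
  moreover have "u * d = of_real (norm d)"
    using d by (simp add: u_def complex_norm_square[symmetric] power2_eq_square mult.commute[of "cnj d"])
  ultimately have "norm d \<le> t" by simp
  then show ?thesis by (simp add: d_def)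
qed (use t in simp)

lemma mollify_tendsto:
  assumes f: "integrable lborel f" and cont: "isCont f z"
  shows "(\<lambda>n. mollify (1 / real (Suc n)) f z) \<longlonglongrightarrow> f z"
proof (rule LIMSEQ_I)
  fix r :: real assume "0 < r"
  then obtain d where d: "0 < d" "\<And>w. norm (w - z) < d \<Longrightarrow> norm (f w - f z) < r / 2"
    using cont[unfolded isCont_def LIM_eq, rule_format, of "r / 2"]
    by (metis diff_self half_gt_zero norm_zero)
  obtain N where N: "1 / real (Suc N) < d" using d(1) by (metis nat_approx_posE)
  have "norm (mollify (1 / real (Suc n)) f z - f z) < r" if "n \<ge> N" for n
  proof -
    have "1 / real (Suc n) \<le> 1 / real (Suc N)" using that by (intro divide_left_mono) auto
    then have "norm (f w - f z) \<le> r / 2" if "w \<in> ball z (1 / real (Suc n))" for w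
      using that d(2)[of w] N by (simp add: dist_norm norm_minus_commute)
    then have "norm (mollify (1 / real (Suc n)) f z - f z) \<le> r / 2"
      using \<open>0 < r\<close> by (intro mollify_dist_le[OF _ f]) (auto intro!: AE_I2)
    then show ?thesis using \<open>0 < r\<close> by simp
  qed
  then show "\<exists>no. \<forall>n\<ge>no. norm (mollify (1 / real (Suc n)) f z - f z) < r" by blast
qed

section \<open>The logarithmic test inequality\<close>

lemma norm_Ln_le:
  assumes "0 < l" "l \<le> norm w" "norm w \<le> m"
  shows "norm (Ln w) \<le> \<bar>ln l\<bar> + \<bar>ln m\<bar> + pi"
proof -
  have w: "w \<noteq> 0" using assms by auto
  have "ln l \<le> ln (norm w)" "ln (norm w) \<le> ln m" using assms w by auto
  then have 1: "\<bar>Re (Ln w)\<bar> \<le> \<bar>ln l\<bar> + \<bar>ln m\<bar>" using w by (simp add: Re_Ln)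
  have "\<bar>Im (Ln w)\<bar> \<le> pi" using w mpi_less_Im_Ln[of w] Im_Ln_le_pi[of w] by linarith
  then show ?thesis using cmod_le[of "Ln w"] 1 by linarith
qed

lemma Re_inverse_nonneg: "0 \<le> Re z \<Longrightarrow> 0 \<le> Re (1 / z)"
  by (simp add: Re_divide divide_nonneg_nonneg)

text \<open>Here \<open>p\<close> and \<open>d\<close> are the derivatives of the cutoff and of the
  mollified function, while \<open>a * v\<close> and \<open>y * v\<close> are complex linear
  increments of holomorphic functions, which \<open>wbar\<close> annihilates. The expression is the
  derivative of cutoff times \<open>Y\<close> times logarithm, with the \<open>Y\<close> in the
  denominator of the quotient already cancelled.\<close>

lemma wbar_product_rule:
  "wbar (\<lambda>v. p v * Y * L + P * (y * v) * L + P * (((a * v - d v) - q * (y * v)) / w))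
    = Y * wbar p * L - P * wbar d * (1 / w)"
proof -
  define u where "u = 1 / w"
  have "\<i> * \<i> = (-1 :: complex)" by simp
  then have "(p 1 * Y * L + P * y * L + P * ((a - d 1 - q * y) * u))
      + \<i> * (p \<i> * Y * L + P * (y * \<i>) * L + P * ((a * \<i> - d \<i> - q * (y * \<i>)) * u))
    = Y * (p 1 + \<i> * p \<i>) * L - P * (d 1 + \<i> * d \<i>) * u"
    by algebra
  then show ?thesis by (simp add: wbar_def u_def flip: diff_divide_distrib)
qed

text \<open>This is the weak form, on the ball, of the statement that \<open>Y\<close> times the
  zbar-derivative of the indicator of \<open>E\<close> has nonnegative real part: the holomorphic
  \<open>Y\<close> commutes with that derivative, and moving the derivative onto
  \<open>\<psi>\<close> reverses the sign. Only C^1 regularity is asked of \<open>\<psi>\<close>,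
  since the cutoff used later is piecewise polynomial in a holomorphic coordinate. Positivity is
  asked on bumps only, as they are the mollification kernels.\<close>

lemma log_test_inequality:
  fixes f a Y :: "complex \<Rightarrow> complex" and \<psi> :: "complex \<Rightarrow> real"
  assumes s: "0 < s" "s < R"
    and f: "integrable lborel f" "\<And>z. norm (f z) \<le> B"
    and pos: "\<And>z e. 0 < e \<Longrightarrow> cball z e \<subseteq> ball p R \<Longrightarrow>
        Im (distr_dzbar f (bump z e)) = 0 \<and> 0 \<le> Re (distr_dzbar f (bump z e))"
    and cf: "AE z in lborel. z \<in> ball p R \<longrightarrow> isCont f z"
    and hol: "a holomorphic_on ball p R" "Y holomorphic_on ball p R" "\<And>z. z \<in> ball p R \<Longrightarrow> Y z \<noteq> 0"
    and c: "0 < c"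
    and E: "E \<in> sets borel"
       "AE z in lborel. z \<in> ball p R \<longrightarrow> (if z \<in> E then f z = a z else c \<le> Re ((a z - f z) / Y z))"
    and \<psi>: "\<And>z. 0 \<le> \<psi> z" "\<And>z. z \<in> cball p s \<Longrightarrow> (\<psi> has_derivative \<psi>' z) (at z)"
       "\<And>z. z \<in> ball p R - cball p s \<Longrightarrow> \<psi> z = 0" "\<And>v. continuous_on (cball p s) (\<lambda>z. \<psi>' z v)"
  shows "Re (\<integral>z. indicator (E \<inter> cball p s) z *\<^sub>R (Y z * wbar (\<lambda>h. of_real (\<psi>' z h))) \<partial>lborel) \<le> 0"
proof -
  let ?W = "ball p R" and ?K = "cball p s" and ?K1 = "cball p ((s + R) / 2)"
  have KK1: "?K \<subseteq> ?K1" using s by (intro subset_cball) simp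
  have K1W: "?K1 \<subseteq> ?W" using s by (auto simp: subset_iff)
  have KW: "?K \<subseteq> ?W" using KK1 K1W by blast
  have ca: "continuous_on ?W a" "continuous_on ?W Y"
    using hol by (auto intro: holomorphic_on_imp_continuous_on)
  have B0: "0 \<le> B" using f(2)[of 0] norm_ge_zero order_trans by blast
  have [measurable]: "f \<in> borel_measurable borel" using f(1) by auto
  define G where "G z = indicator ?K z *\<^sub>R (Y z * wbar (\<lambda>h. of_real (\<psi>' z h)))" for z
  \<comment> \<open>Truncation to \<open>?K\<close> makes these functions Borel and bounded on the
    whole plane; off \<open>?K\<close> the factor \<open>G\<close> is 0 anyway.\<close>
  define aK where "aK z = indicator ?K z *\<^sub>R a z" for z
  define iY where "iY z = indicator ?K z *\<^sub>R (1 / Y z)" for z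
  define Q where "Q g z = (aK z - g z) * iY z" for g :: "complex \<Rightarrow> complex" and z
  have cG: "continuous_on ?K (\<lambda>z. Y z * wbar (\<lambda>h. of_real (\<psi>' z h)))"
    unfolding wbar_def using continuous_on_subset[OF ca(2) KW] \<psi>(4)
    by (intro continuous_intros) auto
  have ciY: "continuous_on ?K (\<lambda>z. 1 / Y z)"
    using continuous_on_subset[OF ca(2) KW] hol(3) KW by (intro continuous_intros) auto
  have bnd: "\<exists>M\<ge>0. \<forall>z. norm (indicator ?K z *\<^sub>R g z) \<le> M" if "continuous_on ?K g" for g :: "complex \<Rightarrow> complex"
  proof -
    have "compact (g ` ?K)" using that by (intro compact_continuous_image) auto
    then obtain M where M: "0 < M" "\<And>z. z \<in> ?K \<Longrightarrow> norm (g z) \<le> M"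
      using compact_imp_bounded bounded_pos by (metis imageI)
    then show ?thesis by (intro exI[of _ M]) (auto simp: indicator_def)
  qed
  obtain MG Ma MY where M: "0 \<le> MG" "\<And>z. norm (G z) \<le> MG" "0 \<le> Ma" "\<And>z. norm (aK z) \<le> Ma"
      "0 \<le> MY" "\<And>z. norm (iY z) \<le> MY"
    using bnd[OF cG] bnd[OF continuous_on_subset[OF ca(1) KW]] bnd[OF ciY]
    unfolding G_def aK_def iY_def by blast
  have Gm [measurable]: "G \<in> borel_measurable borel"
    unfolding G_def[abs_def] using cG by (intro borel_measurable_continuous_on_indicator) auto
  have aKm [measurable]: "aK \<in> borel_measurable borel"
    unfolding aK_def[abs_def] using continuous_on_subset[OF ca(1) KW]
    by (intro borel_measurable_continuous_on_indicator) auto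
  have iYm [measurable]: "iY \<in> borel_measurable borel"
    unfolding iY_def[abs_def] using ciY by (intro borel_measurable_continuous_on_indicator) auto
  have G0: "G z = 0" if "z \<notin> ?K" for z using that by (simp add: G_def)
  define mf where "mf n = mollify (1 / real (Suc n)) f" for n
  have mfB: "norm (mf n z) \<le> B" for n z
  proof -
    have "norm (mf n z - 0) \<le> B"
      unfolding mf_def using f(2) B0 by (intro mollify_dist_le[OF _ f(1)]) auto
    then show ?thesis by simp
  qed
  have QB: "norm (Q g z) \<le> (Ma + B) * MY" if "norm (g z) \<le> B" for g z
  proof -
    have "norm (aK z - g z) \<le> Ma + B" using M(4)[of z] that norm_triangle_ineq4[of "aK z" "g z"] by linarith
    then show ?thesis unfolding Q_def norm_mult using M B0 by (intro mult_mono) auto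
  qed
  define MQ where "MQ = (Ma + B) * MY"
  have MQ0: "0 \<le> MQ" using M B0 by (simp add: MQ_def)
  have domint: "integrable lborel (\<lambda>z. indicator ?K z *\<^sub>R (T::real))" for T
    by (intro integrable_scaleR_left integrable_real_indicator)
      (use emeasure_bounded_finite[OF bounded_cball] in auto)
  have limit: "0 \<le> Re (\<integral>z. G z * Ln (Q f z + of_real d) \<partial>lborel)" if d: "0 < d" for d
  proof -
    \<comment> \<open>\<open>?K1\<close> lies halfway between \<open>?K\<close> and the ball and
      leaves room for mollification. The radius is made so small that a/Y moves by less than d/4,
      and that the change of 1/Y times f, with |f| <= B, is at most d/4; B + 1 avoids dividing by 0.
      Then Re Q >= -d/2 on \<open>?K\<close>, so Q + d keeps real part at least d/2.\<close>
    have "uniformly_continuous_on ?K1 (\<lambda>z. a z / Y z)" "uniformly_continuous_on ?K1 (\<lambda>z. 1 / Y z)"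
      using continuous_on_subset[OF ca(1) K1W] continuous_on_subset[OF ca(2) K1W] hol(3) K1W
      by (intro compact_uniformly_continuous continuous_intros; auto)+
    moreover have "0 < d / 4" "0 < d / (4 * (B + 1))" using d B0 by auto
    ultimately obtain d1 d2 where d12: "0 < d1" "0 < d2"
        "\<And>z w. z \<in> ?K1 \<Longrightarrow> w \<in> ?K1 \<Longrightarrow> dist w z < d1 \<Longrightarrow> dist (a w / Y w) (a z / Y z) < d / 4"
        "\<And>z w. z \<in> ?K1 \<Longrightarrow> w \<in> ?K1 \<Longrightarrow> dist w z < d2 \<Longrightarrow> dist (1 / Y w) (1 / Y z) < d / (4 * (B + 1))"
      unfolding uniformly_continuous_on_def by metis
    obtain N where N: "1 / real (Suc N) < min (min d1 d2) ((R - s) / 2)"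
      using nat_approx_posE[of "min (min d1 d2) ((R - s) / 2)"] d12(1,2) s by (metis diff_gt_0_iff_gt half_gt_zero min_less_iff_conj)
    have small: "1 / real (Suc n) < d1" "1 / real (Suc n) < d2" "1 / real (Suc n) < (R - s) / 2" if "N \<le> n" for n
    proof -
      have "1 / real (Suc n) \<le> 1 / real (Suc N)" using that by (intro divide_left_mono) auto
      then show "1 / real (Suc n) < d1" "1 / real (Suc n) < d2" "1 / real (Suc n) < (R - s) / 2" using N by auto
    qed
    have ReQ: "- (d / 2) \<le> Re (Q (mf n) z)" if n: "N \<le> n" and z: "z \<in> ?K" for n z
    proof -
      have "AE w in lborel. w \<in> ball z (1 / real (Suc n)) \<longrightarrow> Re (1 / Y z * f w) \<le> Re (a z / Y z) + d / 2"
        using E(2)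
      proof eventually_elim
        case (elim w)
        show ?case
        proof
          assume w: "w \<in> ball z (1 / real (Suc n))"
          have zK1: "z \<in> ?K1" using z KK1 by blast
          have "dist p w < s + (R - s) / 2"
            using w z small(3)[OF n] dist_triangle[of p w z] unfolding mem_ball mem_cball by linarith
          then have wK1: "w \<in> ?K1" by (simp add: field_simps)
          then have wW: "w \<in> ?W" using K1W by blast
          have dw: "dist w z < d1" "dist w z < d2"
            using w small[OF n] by (auto simp: dist_commute)
          have 1: "Re (f w / Y w) \<le> Re (a w / Y w)"
            using elim wW c by (auto simp: diff_divide_distrib split: if_splits)
          have "norm (a w / Y w - a z / Y z) < d / 4" using d12(3)[OF zK1 wK1 dw(1)] by (simp add: dist_norm)
          then have 2: "Re (a w / Y w) \<le> Re (a z / Y z) + d / 4"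
            using complex_Re_le_cmod[of "a w / Y w - a z / Y z"] by (simp del: Re_divide_of_real)
          have "norm (1 / Y w - 1 / Y z) \<le> d / (4 * (B + 1))"
            using d12(4)[OF zK1 wK1 dw(2)] by (simp add: dist_norm)
          then have "norm ((1 / Y z - 1 / Y w) * f w) \<le> d / (4 * (B + 1)) * B"
            unfolding norm_mult using f(2) d B0 by (intro mult_mono) (auto simp: norm_minus_commute)
          moreover have "d / (4 * (B + 1)) * B \<le> d / 4" using d B0 by (simp add: field_simps)
          ultimately have 3: "Re ((1 / Y z - 1 / Y w) * f w) \<le> d / 4"
            using complex_Re_le_cmod[of "(1 / Y z - 1 / Y w) * f w"] by linarith
          have "1 / Y z * f w = f w / Y w + (1 / Y z - 1 / Y w) * f w" by (simp add: algebra_simps)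
          then have "Re (1 / Y z * f w) = Re (f w / Y w) + Re ((1 / Y z - 1 / Y w) * f w)" by (metis plus_complex.sel(1))
          then show "Re (1 / Y z * f w) \<le> Re (a z / Y z) + d / 2" using 1 2 3 by linarith
        qed
      qed
      then have "Re (1 / Y z * mf n z) \<le> Re (a z / Y z) + d / 2"
        unfolding mf_def by (intro mollify_halfplane[OF _ f(1)]) auto
      moreover have "Q (mf n) z = a z / Y z - 1 / Y z * mf n z"
        using z by (simp add: Q_def aK_def iY_def diff_divide_distrib)
      ultimately show ?thesis by (simp only: minus_complex.sel)
    qed
    have nonneg: "0 \<le> Re (\<integral>z. G z * Ln (Q (mf n) z + of_real d) \<partial>lborel)" if n: "N \<le> n" for n
    proof -
      define e where "e = 1 / real (Suc n)"
      have e: "0 < e" by (simp add: e_def)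
      obtain D where D: "\<And>z. (mf n has_derivative D z) (at z)" "\<And>v. continuous_on UNIV (\<lambda>z. D z v)"
          "\<And>z. wbar (D z) = distr_dzbar f (bump z e) / of_real (\<integral>w. bump 0 e w \<partial>lborel)"
        using mollify_derivative[OF e f(1)] unfolding mf_def e_def by blast
      define q where "q z = (a z - mf n z) / Y z" for z
      have qQ: "Q (mf n) z = q z" if "z \<in> ?K" for z using that by (simp add: Q_def q_def aK_def iY_def)
      have Req: "0 < Re (q z + of_real d)" if "z \<in> ?K" for z using ReQ[OF n that] qQ[OF that] d by simp
      have cmf: "continuous_on ?K (mf n)"
        using D(1) has_derivative_continuous continuous_at_imp_continuous_on by blast
      define a' where "a' = deriv a"
      define Y' where "Y' = deriv Y"
      have der: "(a has_field_derivative a' z) (at z)" "(Y has_field_derivative Y' z) (at z)" if "z \<in> ?W" for z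
        using hol(1,2) that by (auto simp: a'_def Y'_def holomorphic_derivI)
      have ca': "continuous_on ?K a'" "continuous_on ?K Y'"
        unfolding a'_def Y'_def using hol(1,2) KW
        by (meson continuous_on_subset holomorphic_deriv holomorphic_on_imp_continuous_on open_ball)+
      have cq: "continuous_on ?K q"
        unfolding q_def using continuous_on_subset[OF ca(1) KW] continuous_on_subset[OF ca(2) KW] cmf hol(3) KW
        by (intro continuous_intros) auto
      define L where "L z = Ln (q z + of_real d)" for z
      have cL: "continuous_on ?K L"
      proof -
        have "q z + of_real d \<notin> \<real>\<^sub>\<le>\<^sub>0" if "z \<in> ?K" for z
          using Req[OF that] by (auto simp: complex_nonpos_Reals_iff)
        then show ?thesis unfolding L_def using cq by (intro continuous_intros) auto
      qed
      \<comment> \<open>The integral of \<open>wbar (h' z)\<close> over \<open>?K\<close> vanishes,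
        so the integral of \<open>G\<close> times the logarithm equals that of
        \<open>\<psi> z * wbar (D z) / (q z + of_real d)\<close>. There \<open>\<psi>\<close> and
        \<open>wbar (D z)\<close> are nonnegative reals and the denominator has positive real
        part.\<close>
      define h where "h z = of_real (\<psi> z) * Y z * L z" for z
      define h' where "h' z v = of_real (\<psi>' z v) * Y z * L z + of_real (\<psi> z) * (Y' z * v) * L z
          + of_real (\<psi> z) * (((a' z * v - D z v) - q z * (Y' z * v)) / (q z + of_real d))" for z v
      have hder: "(h has_derivative h' z) (at z)" if z: "z \<in> ?K" for z
      proof -
        have zW: "z \<in> ?W" using z KW by blast
        have da: "(a has_derivative (\<lambda>v. a' z * v)) (at z)" and dY: "(Y has_derivative (\<lambda>v. Y' z * v)) (at z)"
          using der[OF zW] by (auto simp: has_field_derivative_def)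
        have dq: "(q has_derivative (\<lambda>v. ((a' z * v - D z v) - q z * (Y' z * v)) / Y z)) (at z)"
        proof -
          have "((\<lambda>z. (a z - mf n z) / Y z) has_derivative
            (\<lambda>v. - (a z - mf n z) * (inverse (Y z) * (Y' z * v) * inverse (Y z)) + (a' z * v - D z v) / Y z)) (at z)"
            by (rule has_derivative_divide[OF has_derivative_diff[OF da D(1)] dY hol(3)[OF zW]])
          then show ?thesis
            unfolding q_def[abs_def]
            by (rule has_derivative_eq_rhs) (use hol(3)[OF zW] in \<open>auto simp: field_simps\<close>)
        qed
        have "((\<lambda>z. q z + of_real d) has_derivative (\<lambda>v. ((a' z * v - D z v) - q z * (Y' z * v)) / Y z)) (at z)"
          using has_derivative_add[OF dq has_derivative_const[of "of_real d"]] by simp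
        moreover have "(Ln has_derivative (\<lambda>v. inverse (q z + of_real d) * v)) (at (q z + of_real d))"
          using Req[OF z] has_field_derivative_Ln[of "q z + of_real d"]
          by (auto simp: has_field_derivative_def complex_nonpos_Reals_iff)
        ultimately have dL: "(L has_derivative (\<lambda>v. inverse (q z + of_real d) * (((a' z * v - D z v) - q z * (Y' z * v)) / Y z))) (at z)"
          unfolding L_def[abs_def] by (rule has_derivative_compose)
        have "((\<lambda>z. complex_of_real (\<psi> z)) has_derivative (\<lambda>v. of_real (\<psi>' z v))) (at z)"
          by (rule has_derivative_of_real[OF \<psi>(2)[OF z]])
        from has_derivative_mult[OF has_derivative_mult[OF this dY] dL] show ?thesis
          unfolding h_def[abs_def]
          by (rule has_derivative_eq_rhs)
             (use hol(3)[OF zW] in \<open>auto simp: h'_def fun_eq_iff divide_simps, auto simp: algebra_simps\<close>)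
      qed
      have c\<psi>: "continuous_on ?K \<psi>"
        using \<psi>(2) by (meson continuous_at_imp_continuous_on has_derivative_continuous)
      have ne: "q z + of_real d \<noteq> 0" if "z \<in> ?K" for z
        using Req[OF that] by (metis less_irrefl zero_complex.sel(1))
      have h'c: "continuous_on ?K (\<lambda>z. h' z v)" for v
        unfolding h'_def
        using \<psi>(4)[of v] c\<psi> cL cq ca' continuous_on_subset[OF ca(2) KW] continuous_on_subset[OF D(2)[of v], of ?K] ne
        by (intro continuous_intros) auto
      have h0: "h z = 0" if "z \<in> ?W - ?K" for z using \<psi>(3)[OF that] by (simp add: h_def)
      note I = integral_directional_derivative_eq_0[OF open_ball compact_cball KW hder h0 h'c]
      have Iw: "integrable lborel (\<lambda>z. indicator ?K z *\<^sub>R wbar (h' z))"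
          "(\<integral>z. indicator ?K z *\<^sub>R wbar (h' z) \<partial>lborel) = 0"
      proof -
        have eq: "(\<lambda>z. indicator ?K z *\<^sub>R wbar (h' z)) =
          (\<lambda>z. (indicator ?K z *\<^sub>R h' z 1 + \<i> * (indicator ?K z *\<^sub>R h' z \<i>)) / 2)"
          by (auto simp: wbar_def fun_eq_iff indicator_def)
        show "integrable lborel (\<lambda>z. indicator ?K z *\<^sub>R wbar (h' z))"
          unfolding eq using I(1)[of 1] I(1)[of \<i>]
          by (intro integrable_divide_zero Bochner_Integration.integrable_add integrable_mult_right) auto
        show "(\<integral>z. indicator ?K z *\<^sub>R wbar (h' z) \<partial>lborel) = 0"
          unfolding eq using I[of 1] I[of \<i>]
          by (simp only: integral_divide_zero Bochner_Integration.integral_add integral_mult_right_zero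
              integrable_mult_right) simp
      qed
      have wh: "wbar (h' z) = Y z * wbar (\<lambda>h. of_real (\<psi>' z h)) * L z
          - of_real (\<psi> z) * wbar (D z) * (1 / (q z + of_real d))" for z
        unfolding h'_def by (rule wbar_product_rule)
      have gint: "integrable lborel (\<lambda>z. G z * Ln (Q (mf n) z + of_real d))"
      proof -
        have "continuous_on ?K (\<lambda>z. Y z * wbar (\<lambda>h. of_real (\<psi>' z h)) * L z)"
          by (rule continuous_on_mult[OF cG cL])
        from bnd[OF this] obtain T where
          T: "\<And>z. norm (indicator ?K z *\<^sub>R (Y z * wbar (\<lambda>h. of_real (\<psi>' z h)) * L z)) \<le> T" by blast
        have "(\<lambda>z. indicator ?K z *\<^sub>R (Y z * wbar (\<lambda>h. of_real (\<psi>' z h)) * L z)) \<in> borel_measurable borel"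
          using \<open>continuous_on ?K (\<lambda>z. Y z * wbar (\<lambda>h. of_real (\<psi>' z h)) * L z)\<close>
          by (intro borel_measurable_continuous_on_indicator) auto
        then have "integrable lborel (\<lambda>z. indicator ?K z *\<^sub>R (Y z * wbar (\<lambda>h. of_real (\<psi>' z h)) * L z))"
          by (rule integrable_bounded_support[OF _ compact_cball[of p s], where C=T]) (rule T, simp)
        also have "(\<lambda>z. indicator ?K z *\<^sub>R (Y z * wbar (\<lambda>h. of_real (\<psi>' z h)) * L z))
            = (\<lambda>z. G z * Ln (Q (mf n) z + of_real d))"
          by (auto simp: fun_eq_iff G_def L_def qQ indicator_def)
        finally show ?thesis .
      qed
      have "Re (\<integral>z. G z * Ln (Q (mf n) z + of_real d) \<partial>lborel)
          = Re (\<integral>z. G z * Ln (Q (mf n) z + of_real d) - indicator ?K z *\<^sub>R wbar (h' z) \<partial>lborel)"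
        using gint Iw by simp
      also have "\<dots> = (\<integral>z. Re (G z * Ln (Q (mf n) z + of_real d) - indicator ?K z *\<^sub>R wbar (h' z)) \<partial>lborel)"
        using gint Iw by (intro integral_Re[symmetric] Bochner_Integration.integrable_diff)
      also have "0 \<le> \<dots>"
      proof (intro integral_nonneg_AE AE_I2)
        fix z
        show "0 \<le> Re (G z * Ln (Q (mf n) z + of_real d) - indicator ?K z *\<^sub>R wbar (h' z))"
        proof (cases "z \<in> ?K")
          case True
          have "cball z e \<subseteq> ?W"
          proof
            fix w assume "w \<in> cball z e"
            then have "dist p w < s + (R - s) / 2"
              using True small(3)[OF n] dist_triangle[of p w z] unfolding mem_ball mem_cball e_def by linarith
            then show "w \<in> ?W" using s by (simp add: field_simps)
          qed
          from pos[OF e this] have mu: "wbar (D z) = of_real (Re (distr_dzbar f (bump z e)) / (\<integral>w. bump 0 e w \<partial>lborel))"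
              "0 \<le> Re (distr_dzbar f (bump z e)) / (\<integral>w. bump 0 e w \<partial>lborel)"
            using D(3)[of z] bump_integral_pos(2)[OF e, of 0]
            by (auto simp: complex_eq_iff)
          have "G z * Ln (Q (mf n) z + of_real d) - indicator ?K z *\<^sub>R wbar (h' z)
              = of_real (\<psi> z * (Re (distr_dzbar f (bump z e)) / (\<integral>w. bump 0 e w \<partial>lborel))) * (1 / (q z + of_real d))"
            using True by (simp add: G_def wh qQ L_def mu(1))
          moreover have "0 \<le> \<psi> z * (Re (distr_dzbar f (bump z e)) / (\<integral>w. bump 0 e w \<partial>lborel)) * Re (1 / (q z + of_real d))"
            using Re_inverse_nonneg[of "q z + of_real d"] Req[OF True] mu(2) \<psi>(1)[of z]
            by (intro mult_nonneg_nonneg) auto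
          ultimately show ?thesis
            by (simp only: Re_complex_of_real times_complex.sel Im_complex_of_real mult_zero_left diff_zero)
        qed (simp add: G_def)
      qed
      finally show ?thesis .
    qed
    \<comment> \<open>Bound for the logarithm of a number with modulus between d/2 and MQ + d. The
      sequence is started at \<open>N\<close> because the lower bound is available only from there
      on.\<close>
    define T where "T = \<bar>ln (d / 2)\<bar> + \<bar>ln (MQ + d)\<bar> + pi"
    have "(\<lambda>n. \<integral>z. G z * Ln (Q (mf (n + N)) z + of_real d) \<partial>lborel)
        \<longlonglongrightarrow> (\<integral>z. G z * Ln (Q f z + of_real d) \<partial>lborel)"
    proof (rule integral_dominated_convergence[where w="\<lambda>z. indicator ?K z *\<^sub>R (MG * T)"])
      have mfm [measurable]: "mf n \<in> borel_measurable borel" for n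
      proof -
        obtain D where "\<And>z. (mf n has_derivative D z) (at z)"
          using mollify_derivative[OF _ f(1), of "1 / real (Suc n)"] unfolding mf_def by auto
        then have "continuous_on UNIV (mf n)"
          using has_derivative_continuous continuous_at_imp_continuous_on by blast
        then show ?thesis by (rule borel_measurable_continuous_onI)
      qed
      show "(\<lambda>z. G z * Ln (Q f z + of_real d)) \<in> borel_measurable lborel"
        unfolding Q_def by measurable
      show "(\<lambda>z. G z * Ln (Q (mf (n + N)) z + of_real d)) \<in> borel_measurable lborel" for n
        unfolding Q_def by measurable
      show "AE z in lborel. norm (G z * Ln (Q (mf (n + N)) z + of_real d)) \<le> indicator ?K z *\<^sub>R (MG * T)" for n
      proof (intro AE_I2)
        fix z
        show "norm (G z * Ln (Q (mf (n + N)) z + of_real d)) \<le> indicator ?K z *\<^sub>R (MG * T)"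
        proof (cases "z \<in> ?K")
          case True
          have "d / 2 \<le> Re (Q (mf (n + N)) z + of_real d)" using ReQ[of "n + N" z] True by simp
          then have "d / 2 \<le> norm (Q (mf (n + N)) z + of_real d)" using complex_Re_le_cmod order_trans by blast
          moreover have "norm (Q (mf (n + N)) z + of_real d) \<le> MQ + d"
            using norm_triangle_ineq[of "Q (mf (n + N)) z" "of_real d"] QB[of "mf (n + N)" z, OF mfB] d by (simp add: MQ_def)
          ultimately have "norm (Ln (Q (mf (n + N)) z + of_real d)) \<le> T"
            unfolding T_def using d by (intro norm_Ln_le) auto
          then show ?thesis using True M by (simp add: norm_mult mult_mono)
        qed (simp add: G0)
      qed
      show "AE z in lborel. (\<lambda>n. G z * Ln (Q (mf (n + N)) z + of_real d)) \<longlonglongrightarrow> G z * Ln (Q f z + of_real d)"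
        using cf E(2)
      proof eventually_elim
        case (elim z)
        show ?case
        proof (cases "z \<in> ?K")
          case True
          then have zW: "z \<in> ?W" using KW by blast
          have "0 \<le> Re (Q f z)" using elim(2) zW c True by (auto simp: Q_def aK_def iY_def split: if_splits)
          then have nz: "Q f z + of_real d \<notin> \<real>\<^sub>\<le>\<^sub>0" using d by (auto simp: complex_nonpos_Reals_iff)
          have "(\<lambda>n. mf n z) \<longlonglongrightarrow> f z"
            unfolding mf_def using elim(1) zW by (intro mollify_tendsto[OF f(1)]) auto
          then have "(\<lambda>n. mf (n + N) z) \<longlonglongrightarrow> f z" by (rule LIMSEQ_ignore_initial_segment)
          then show ?thesis unfolding Q_def using nz[unfolded Q_def] by (intro tendsto_intros) auto
        qed (simp add: G0)
      qed
    qed (rule domint)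
    then have "(\<lambda>n. Re (\<integral>z. G z * Ln (Q (mf (n + N)) z + of_real d) \<partial>lborel))
        \<longlonglongrightarrow> Re (\<integral>z. G z * Ln (Q f z + of_real d) \<partial>lborel)" by (rule tendsto_Re)
    then show ?thesis by (rule LIMSEQ_le_const) (use nonneg in auto)
  qed
  \<comment> \<open>The offset 2 gives ln (1 / dk k) >= ln 2 already for k = 0, so the quotient
    below is defined and uniformly dominated.\<close>
  define dk where "dk k = 1 / real (k + 2)" for k :: nat
  have dk: "0 < dk k" "dk k \<le> 1" "0 < ln (1 / dk k)" "ln 2 \<le> ln (1 / dk k)" for k by (auto simp: dk_def)
  define T where "T = \<bar>ln c\<bar> + \<bar>ln (MQ + 1)\<bar> + pi"
  have T0: "0 \<le> T" by (simp add: T_def add_nonneg_nonneg)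
  \<comment> \<open>On \<open>E\<close> the quantity \<open>Q f z\<close> is 0 and the quotient is
    exactly -1; off \<open>E\<close> its real part is at least \<open>c\<close>, so the logarithm
    stays bounded and the quotient tends to 0.\<close>
  have "(\<lambda>k. \<integral>z. G z * (Ln (Q f z + of_real (dk k)) / of_real (ln (1 / dk k))) \<partial>lborel)
      \<longlonglongrightarrow> (\<integral>z. G z * (- indicator E z) \<partial>lborel)"
  proof (rule integral_dominated_convergence[where w="\<lambda>z. indicator ?K z *\<^sub>R (MG * (T / ln 2 + 1))"])
    show "(\<lambda>z. G z * (- indicator E z)) \<in> borel_measurable lborel" using E(1) by measurable
    show "(\<lambda>z. G z * (Ln (Q f z + of_real (dk k)) / of_real (ln (1 / dk k)))) \<in> borel_measurable lborel" for k
      unfolding Q_def by measurable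
    have key: "Q f z = 0" if "z \<in> ?K" "z \<in> E" "z \<in> ?W \<longrightarrow> (if z \<in> E then f z = a z else c \<le> Re ((a z - f z) / Y z))" for z
      using that KW by (auto simp: Q_def aK_def)
    have key': "c \<le> Re (Q f z)" if "z \<in> ?K" "z \<notin> E" "z \<in> ?W \<longrightarrow> (if z \<in> E then f z = a z else c \<le> Re ((a z - f z) / Y z))" for z
    proof -
      have "z \<in> ?W" using that KW by blast
      then show ?thesis using that by (simp add: Q_def aK_def iY_def)
    qed
    show "AE z in lborel. norm (G z * (Ln (Q f z + of_real (dk k)) / of_real (ln (1 / dk k))))
        \<le> indicator ?K z *\<^sub>R (MG * (T / ln 2 + 1))" for k
      using E(2)
    proof eventually_elim
      case (elim z)
      show ?case
      proof (cases "z \<in> ?K")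
        case True
        have "norm (Ln (Q f z + of_real (dk k)) / of_real (ln (1 / dk k))) \<le> T / ln 2 + 1"
        proof (cases "z \<in> E")
          case True': True
          have "Ln (Q f z + of_real (dk k)) = of_real (ln (dk k))"
            using key[OF True True' elim] dk(1)[of k] by (simp add: Ln_of_real)
          moreover have "ln (1 / dk k) = - ln (dk k)" using dk(1)[of k] by (simp add: ln_div)
          ultimately show ?thesis using dk(3)[of k] T0 by (simp add: norm_divide)
        next
          case False
          have "c \<le> Re (Q f z + of_real (dk k))" using key'[OF True False elim] dk(1)[of k] by simp
          then have "c \<le> norm (Q f z + of_real (dk k))" using complex_Re_le_cmod order_trans by blast
          moreover have "norm (Q f z + of_real (dk k)) \<le> MQ + 1"
            using norm_triangle_ineq[of "Q f z" "of_real (dk k)"] QB[of f z, OF f(2)] dk(1,2)[of k] by (simp add: MQ_def)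
          ultimately have "norm (Ln (Q f z + of_real (dk k))) \<le> T"
            unfolding T_def using c by (intro norm_Ln_le)
          then have "norm (Ln (Q f z + of_real (dk k))) / ln (1 / dk k) \<le> T / ln 2"
            using dk(3,4)[of k] T0 by (intro frac_le) auto
          then show ?thesis using dk(3)[of k] by (simp add: norm_divide)
        qed
        then have "norm (G z) * norm (Ln (Q f z + of_real (dk k)) / of_real (ln (1 / dk k))) \<le> MG * (T / ln 2 + 1)"
          using M by (intro mult_mono) auto
        then show ?thesis using True by (simp add: norm_mult norm_divide)
      qed (simp add: G0)
    qed
    have lnlim: "filterlim (\<lambda>k. ln (1 / dk k)) at_top sequentially"
    proof -
      have "filterlim (\<lambda>k. real (k + 2)) at_top sequentially"
        using filterlim_tendsto_add_at_top[OF tendsto_const[of 2] filterlim_real_sequentially] by simp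
      then show ?thesis unfolding dk_def by (simp add: filterlim_compose[OF ln_at_top])
    qed
    show "AE z in lborel. (\<lambda>k. G z * (Ln (Q f z + of_real (dk k)) / of_real (ln (1 / dk k)))) \<longlonglongrightarrow> G z * (- indicator E z)"
      using E(2)
    proof eventually_elim
      case (elim z)
      show ?case
      proof (cases "z \<in> ?K")
        case True
        have "(\<lambda>k. Ln (Q f z + of_real (dk k)) / of_real (ln (1 / dk k))) \<longlonglongrightarrow> - indicator E z"
        proof (cases "z \<in> E")
          case True': True
          have "Ln (Q f z + of_real (dk k)) / of_real (ln (1 / dk k)) = -1" for k
          proof -
            have "Ln (Q f z + of_real (dk k)) = of_real (ln (dk k))"
              using key[OF True True' elim] dk(1)[of k] by (simp add: Ln_of_real)
            moreover have "ln (1 / dk k) = - ln (dk k)" using dk(1)[of k] by (simp add: ln_div)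
            ultimately show ?thesis using dk(3)[of k] by simp
          qed
          then show ?thesis using True' by simp
        next
          case False
          have nz: "Q f z \<notin> \<real>\<^sub>\<le>\<^sub>0" using key'[OF True False elim] c by (auto simp: complex_nonpos_Reals_iff)
          have "dk \<longlonglongrightarrow> 0" unfolding dk_def[abs_def]
            using LIMSEQ_ignore_initial_segment[OF lim_1_over_n, of 2] by simp
          then have "(\<lambda>k. Q f z + of_real (dk k)) \<longlonglongrightarrow> Q f z + of_real 0"
            by (intro tendsto_intros)
          then have 1: "(\<lambda>k. Ln (Q f z + of_real (dk k))) \<longlonglongrightarrow> Ln (Q f z)"
            using nz by (intro tendsto_Ln) auto
          have 2: "(\<lambda>k. inverse (complex_of_real (ln (1 / dk k)))) \<longlonglongrightarrow> 0"
            using tendsto_of_real[OF tendsto_inverse_0_at_top[OF lnlim], where 'a=complex] by simp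
          show ?thesis using tendsto_mult[OF 1 2] False by (simp add: divide_inverse)
        qed
        then show ?thesis by (intro tendsto_intros)
      qed (simp add: G0)
    qed
  qed (rule domint)
  then have "(\<lambda>k. Re (\<integral>z. G z * (Ln (Q f z + of_real (dk k)) / of_real (ln (1 / dk k))) \<partial>lborel))
      \<longlonglongrightarrow> Re (\<integral>z. G z * (- indicator E z) \<partial>lborel)" by (rule tendsto_Re)
  moreover have "0 \<le> Re (\<integral>z. G z * (Ln (Q f z + of_real (dk k)) / of_real (ln (1 / dk k))) \<partial>lborel)" for k
  proof -
    have "(\<integral>z. G z * (Ln (Q f z + of_real (dk k)) / of_real (ln (1 / dk k))) \<partial>lborel)
        = (\<integral>z. G z * Ln (Q f z + of_real (dk k)) \<partial>lborel) / of_real (ln (1 / dk k))"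
      by (simp only: times_divide_eq_right integral_divide_zero)
    then show ?thesis using limit[OF dk(1)[of k]] dk(3)[of k] by (simp only: Re_divide_of_real) simp
  qed
  ultimately have "0 \<le> Re (\<integral>z. G z * (- indicator E z) \<partial>lborel)"
    by (intro LIMSEQ_le_const[where X="\<lambda>k. Re (\<integral>z. G z * (Ln (Q f z + of_real (dk k)) / of_real (ln (1 / dk k))) \<partial>lborel)"]) auto
  then have n: "Re (\<integral>z. G z * indicator E z \<partial>lborel) \<le> 0" by simp
  have eq: "(\<lambda>z. G z * indicator E z) = (\<lambda>z. indicator (E \<inter> ?K) z *\<^sub>R (Y z * wbar (\<lambda>h. of_real (\<psi>' z h))))"
    by (auto simp: G_def indicator_def)
  show ?thesis using n unfolding eq .
qed

section \<open>Propagation along holomorphic coordinate segments\<close>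

text \<open>Continuously differentiable across 0, which is all that the cutoff below requires of its
  building blocks.\<close>

definition ramp2 :: "real \<Rightarrow> real" where "ramp2 x = (max 0 x)\<^sup>2"

lemma ramp2_has_derivative: "(ramp2 has_real_derivative 2 * max 0 x) (at x)"
proof -
  consider "x < 0" | "x = 0" | "x > 0" by linarith
  then show ?thesis
  proof cases
    case 1
    have "((\<lambda>x. 0) has_real_derivative 0) (at x)" by simp
    then have "(ramp2 has_real_derivative 0) (at x)"
      by (rule has_field_derivative_transform_within_open[where S="{..<0}"]) (use 1 in \<open>auto simp: ramp2_def\<close>)
    then show ?thesis using 1 by simp
  next
    case 2
    have "((\<lambda>h. ramp2 h / h) \<longlongrightarrow> 0) (at 0)"
    proof (rule Lim_null_comparison)
      show "((\<lambda>h::real. \<bar>h\<bar>) \<longlongrightarrow> 0) (at 0)" by (auto intro!: tendsto_eq_intros)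
      show "\<forall>\<^sub>F h in at 0. norm (ramp2 h / h) \<le> \<bar>h\<bar>"
        by (intro always_eventually allI) (auto simp: ramp2_def max_def power2_eq_square)
    qed
    then show ?thesis using 2 by (simp add: DERIV_def ramp2_def)
  next
    case 3
    have "((\<lambda>x. x\<^sup>2) has_real_derivative 2 * x) (at x)" by (auto intro!: derivative_eq_intros)
    then have "(ramp2 has_real_derivative 2 * x) (at x)"
      by (rule has_field_derivative_transform_within_open[where S="{0<..}"]) (use 3 in \<open>auto simp: ramp2_def\<close>)
    then show ?thesis using 3 by simp
  qed
qed

text \<open>\<open>tent\<close> is the hat of height \<eta> on [-\<eta>, \<eta>] and
  \<open>sstep\<close> its primitive, climbing from 0 to \<eta>^2. Both are second differences, of
  the positive part and of half of \<open>ramp2\<close>, so that one is the derivative of the other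
  term by term.\<close>

definition tent :: "real \<Rightarrow> real \<Rightarrow> real" where "tent \<eta> s = max 0 (s + \<eta>) - 2 * max 0 s + max 0 (s - \<eta>)"
definition sstep :: "real \<Rightarrow> real \<Rightarrow> real" where "sstep \<eta> s = (ramp2 (s + \<eta>) - 2 * ramp2 s + ramp2 (s - \<eta>)) / 2"

lemma tent_props:
  assumes "0 < \<eta>"
  shows "0 \<le> tent \<eta> s" "\<bar>s\<bar> < \<eta> \<Longrightarrow> 0 < tent \<eta> s" "\<eta> \<le> \<bar>s\<bar> \<Longrightarrow> tent \<eta> s = 0" "continuous_on UNIV (tent \<eta>)"
proof -
  show "continuous_on UNIV (tent \<eta>)" unfolding tent_def[abs_def] by (intro continuous_intros)
qed (use assms in \<open>auto simp: tent_def max_def\<close>)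

lemma sstep_has_derivative: "(sstep \<eta> has_real_derivative tent \<eta> s) (at s)"
proof -
  have "((\<lambda>s. ramp2 (s + c)) has_real_derivative 2 * max 0 (s + c)) (at s)" for c
    using ramp2_has_derivative[of "s + c"] unfolding DERIV_shift .
  from this[of \<eta>] this[of 0] this[of "- \<eta>"] show ?thesis
    unfolding sstep_def[abs_def] tent_def by (auto intro!: derivative_eq_intros simp: field_simps)
qed

lemma sstep_mono:
  assumes "0 < \<eta>" "x \<le> y" shows "sstep \<eta> x \<le> sstep \<eta> y"
proof (rule DERIV_nonneg_imp_nondecreasing[OF assms(2)])
  show "\<exists>d. (sstep \<eta> has_real_derivative d) (at t) \<and> 0 \<le> d" for t
    by (intro exI conjI, rule sstep_has_derivative, rule tent_props(1)[OF assms(1)])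
qed

lemma sstep_low: "0 < \<eta> \<Longrightarrow> s \<le> - \<eta> \<Longrightarrow> sstep \<eta> s = 0"
  by (simp add: sstep_def ramp2_def max_def)

lemma sstep_high: "0 < \<eta> \<Longrightarrow> \<eta> \<le> s \<Longrightarrow> sstep \<eta> s = \<eta>\<^sup>2"
  by (simp add: sstep_def ramp2_def max_def power2_eq_square algebra_simps)

text \<open>The cutoff \<open>g (Re (\<sigma> z)) * b (Im (\<sigma> z))\<close> lives on a thin box
  around [0, 1] in the coordinate \<sigma>, with g' a hat at 0 minus a hat at 1. Tested against it,
  the real part integrates to 0 over the ball and to at most 0 over \<open>E\<close>, hence to at
  least 0 over the complement of \<open>E\<close>. There the hat at 0 contributes nothing, because
  its box lies in \<open>E\<close>, and the hat at 1 contributes a nonpositive integrand. So the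
  complement of \<open>E\<close> is null near \<open>z1\<close>.\<close>

lemma interior_propagates:
  fixes f a Y \<sigma> :: "complex \<Rightarrow> complex"
  assumes s: "0 < s" "s < R"
    and f: "integrable lborel f" "\<And>z. norm (f z) \<le> B"
    and pos: "\<And>z e. 0 < e \<Longrightarrow> cball z e \<subseteq> ball p R \<Longrightarrow>
        Im (distr_dzbar f (bump z e)) = 0 \<and> 0 \<le> Re (distr_dzbar f (bump z e))"
    and cf: "AE z in lborel. z \<in> ball p R \<longrightarrow> isCont f z"
    and hol: "a holomorphic_on ball p R" "Y holomorphic_on ball p R" "\<And>z. z \<in> ball p R \<Longrightarrow> Y z \<noteq> 0"
    and \<sigma>: "\<And>z. z \<in> ball p R \<Longrightarrow> (\<sigma> has_field_derivative Y z) (at z)"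
    and inj: "0 < m" "\<And>z w. z \<in> ball p R \<Longrightarrow> w \<in> ball p R \<Longrightarrow> m * norm (z - w) \<le> norm (\<sigma> z - \<sigma> w)"
    and supp: "\<And>z. z \<in> ball p R \<Longrightarrow> norm (\<sigma> z) \<le> 2 \<Longrightarrow> z \<in> cball p s"
    and z01: "z0 \<in> ball p R" "z1 \<in> ball p R" "\<sigma> z0 = 0" "\<sigma> z1 = 1" "z0 \<in> interior E"
    and c: "0 < c"
    and E: "E \<in> sets borel"
       "AE z in lborel. z \<in> ball p R \<longrightarrow> (if z \<in> E then f z = a z else c \<le> Re ((a z - f z) / Y z))"
  shows "z1 \<in> closure E"
proof (rule ccontr)
  assume z1E: "z1 \<notin> closure E"
  let ?W = "ball p R" and ?K = "cball p s"
  have KW: "?K \<subseteq> ?W" using s by (auto simp: subset_iff)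
  obtain \<rho> where \<rho>: "0 < \<rho>" "ball z0 \<rho> \<subseteq> E" using z01(5) by (meson mem_interior)
  \<comment> \<open>The box |Re \<sigma>|, |Im \<sigma>| <= \<eta> has |\<sigma>| <= 2 \<eta> < m
    \<rho> and so lies in \<open>ball z0 \<rho>\<close>; the 3 makes this strict. The bound 1/2
    keeps the support of the cutoff in |\<sigma>| <= 2.\<close>
  define \<eta> where "\<eta> = min (1/2) (m * \<rho> / 3)"
  have \<eta>: "0 < \<eta>" "\<eta> \<le> 1/2" "2 * \<eta> < m * \<rho>" using \<rho> inj(1) by (auto simp: \<eta>_def min_def field_simps)
  have nearE: "z \<in> E" if "z \<in> ?W" "\<bar>Re (\<sigma> z)\<bar> \<le> \<eta>" "\<bar>Im (\<sigma> z)\<bar> \<le> \<eta>" for z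
  proof -
    have "norm (\<sigma> z) \<le> 2 * \<eta>" using that cmod_le[of "\<sigma> z"] by linarith
    then have "m * norm (z - z0) < m * \<rho>" using inj(2)[OF that(1) z01(1)] z01(3) \<eta> by simp
    then show ?thesis using \<rho> inj(1) by (auto simp: dist_norm norm_minus_commute)
  qed
  define g where "g t = sstep \<eta> t - sstep \<eta> (t - 1)" for t
  define g' where "g' t = tent \<eta> t - tent \<eta> (t - 1)" for t
  define b where "b t = ramp2 (\<eta>\<^sup>2 - t\<^sup>2)" for t
  define b' where "b' t = 2 * max 0 (\<eta>\<^sup>2 - t\<^sup>2) * (- 2 * t)" for t
  have dg: "(g has_real_derivative g' t) (at t)" for t
  proof -
    have "((\<lambda>t. sstep \<eta> (t - 1)) has_real_derivative tent \<eta> (t - 1)) (at t)"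
      using sstep_has_derivative[of \<eta> "t + - 1"] unfolding DERIV_shift by simp
    then show ?thesis unfolding g_def[abs_def] g'_def by (intro DERIV_diff sstep_has_derivative)
  qed
  have db: "(b has_real_derivative b' t) (at t)" for t
    unfolding b_def[abs_def] b'_def
    by (rule DERIV_chain2[OF ramp2_has_derivative]) (auto intro!: derivative_eq_intros)
  have cg': "continuous_on UNIV g'"
    unfolding g'_def by (intro continuous_intros continuous_on_compose2[OF tent_props(4)[OF \<eta>(1)]]) auto
  have cb': "continuous_on UNIV b'" unfolding b'_def by (intro continuous_intros)
  have cg: "continuous_on UNIV g" and cb: "continuous_on UNIV b"
    using dg db DERIV_isCont continuous_at_imp_continuous_on by blast+
  have g0: "0 \<le> g t" for t unfolding g_def using sstep_mono[OF \<eta>(1), of "t - 1" t] by simp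
  have b0: "0 \<le> b t" for t by (simp add: b_def ramp2_def)
  have bz: "b t = 0 \<longleftrightarrow> \<eta> \<le> \<bar>t\<bar>" for t
  proof -
    have "\<eta>\<^sup>2 \<le> t\<^sup>2 \<longleftrightarrow> \<eta> \<le> \<bar>t\<bar>" using \<eta>(1) by (metis abs_le_square_iff abs_of_pos)
    then show ?thesis by (auto simp: b_def ramp2_def max_def)
  qed
  have gz: "g t = 0" if "t \<le> - \<eta> \<or> 1 + \<eta> \<le> t" for t
    using that \<eta> sstep_low[OF \<eta>(1)] sstep_high[OF \<eta>(1)] unfolding g_def by auto
  define \<psi> where "\<psi> z = g (Re (\<sigma> z)) * b (Im (\<sigma> z))" for z
  define \<psi>' where "\<psi>' z v = g' (Re (\<sigma> z)) * Re (Y z * v) * b (Im (\<sigma> z)) + g (Re (\<sigma> z)) * (b' (Im (\<sigma> z)) * Im (Y z * v))" for z v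
  have c\<sigma>: "continuous_on ?W \<sigma>"
    using \<sigma> DERIV_isCont continuous_at_imp_continuous_on by blast
  have cY: "continuous_on ?W Y" using hol(2) by (rule holomorphic_on_imp_continuous_on)
  have d\<psi>: "(\<psi> has_derivative \<psi>' z) (at z)" if "z \<in> ?W" for z
  proof -
    have d: "(\<sigma> has_derivative (\<lambda>v. Y z * v)) (at z)" using \<sigma>[OF that] by (simp add: has_field_derivative_def)
    have "((\<lambda>z. g (Re (\<sigma> z))) has_derivative (\<lambda>v. g' (Re (\<sigma> z)) * Re (Y z * v))) (at z)"
      using has_derivative_compose[OF has_derivative_Re[OF d] dg[unfolded has_field_derivative_def]] .
    moreover have "((\<lambda>z. b (Im (\<sigma> z))) has_derivative (\<lambda>v. b' (Im (\<sigma> z)) * Im (Y z * v))) (at z)"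
      using has_derivative_compose[OF has_derivative_Im[OF d] db[unfolded has_field_derivative_def]] .
    ultimately show ?thesis unfolding \<psi>_def[abs_def]
      by (rule has_derivative_eq_rhs[OF has_derivative_mult]) (auto simp: \<psi>'_def fun_eq_iff)
  qed
  have c\<psi>': "continuous_on ?W (\<lambda>z. \<psi>' z v)" for v
    unfolding \<psi>'_def
    by (intro continuous_intros continuous_on_compose2[OF cg'] continuous_on_compose2[OF cg]
        continuous_on_compose2[OF cb] continuous_on_compose2[OF cb'] c\<sigma> cY) auto
  have \<psi>0: "\<psi> z = 0" if "z \<in> ?W - ?K" for z
  proof (rule ccontr)
    assume "\<psi> z \<noteq> 0"
    then have "- \<eta> < Re (\<sigma> z)" "Re (\<sigma> z) < 1 + \<eta>" "\<bar>Im (\<sigma> z)\<bar> < \<eta>"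
      using gz[of "Re (\<sigma> z)"] bz[of "Im (\<sigma> z)"] unfolding \<psi>_def by fastforce+
    then have "norm (\<sigma> z) \<le> 2" using cmod_le[of "\<sigma> z"] \<eta> by linarith
    then show False using supp that by blast
  qed
  \<comment> \<open>For u composed with \<sigma>, the zbar-derivative picks up the factor
    \<open>cnj (Y z)\<close>, and Y times its conjugate is |Y|^2. The transverse derivative
    \<open>b'\<close> lands in the imaginary part, which is discarded; so \<open>b\<close> may be
    any C^1 profile positive exactly on |t| < \<eta>.\<close>
  have w\<psi>: "Y z * wbar (\<lambda>h. of_real (\<psi>' z h)) = of_real ((norm (Y z))\<^sup>2 / 2) *
      Complex (g' (Re (\<sigma> z)) * b (Im (\<sigma> z))) (g (Re (\<sigma> z)) * b' (Im (\<sigma> z)))" for z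
    unfolding cmod_power2
    by (simp add: wbar_def \<psi>'_def complex_eq_iff power2_eq_square) (simp add: field_simps)
  have Reineq: "Re (\<integral>z. indicator (E \<inter> ?K) z *\<^sub>R (Y z * wbar (\<lambda>h. of_real (\<psi>' z h))) \<partial>lborel) \<le> 0"
  proof (rule log_test_inequality[OF s f pos cf hol c E])
    show "0 \<le> \<psi> z" for z using g0 b0 by (simp add: \<psi>_def)
    show "(\<psi> has_derivative \<psi>' z) (at z)" if "z \<in> ?K" for z using d\<psi> that KW by blast
    show "\<psi> z = 0" if "z \<in> ?W - ?K" for z by (rule \<psi>0[OF that])
    show "continuous_on ?K (\<lambda>z. \<psi>' z v)" for v using c\<psi>' KW continuous_on_subset by blast
  qed
  \<comment> \<open>Integration by parts is applied to \<psi> Y instead of \<psi>: the holomorphic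
    factor is invisible to \<open>wbar\<close>, so \<open>wbar (h' z)\<close> is the integrand
    carrying \<open>Y\<close>.\<close>
  define h where "h z = of_real (\<psi> z) * Y z" for z
  define h' where "h' z v = of_real (\<psi> z) * (deriv Y z * v) + of_real (\<psi>' z v) * Y z" for z v
  have hder: "(h has_derivative h' z) (at z)" if z: "z \<in> ?K" for z
  proof -
    have zW: "z \<in> ?W" using z KW by blast
    have "(Y has_derivative (\<lambda>v. deriv Y z * v)) (at z)"
      using holomorphic_derivI[OF hol(2) open_ball zW] by (simp add: has_field_derivative_def)
    from has_derivative_mult[OF has_derivative_of_real[OF d\<psi>[OF zW]] this] show ?thesis
      unfolding h_def[abs_def] h'_def[abs_def] .
  qed
  have h0: "h z = 0" if "z \<in> ?W - ?K" for z using \<psi>0[OF that] by (simp add: h_def)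
  have c\<psi>: "continuous_on ?W \<psi>" using d\<psi> has_derivative_continuous continuous_at_imp_continuous_on by blast
  have cdY: "continuous_on ?W (deriv Y)"
    using hol(2) by (intro holomorphic_on_imp_continuous_on holomorphic_deriv) auto
  have h'c: "continuous_on ?K (\<lambda>z. h' z v)" for v
    by (rule continuous_on_subset[OF _ KW])
       (unfold h'_def, intro continuous_intros c\<psi> cdY c\<psi>' cY)
  note I = integral_directional_derivative_eq_0[OF open_ball compact_cball KW hder h0 h'c]
  define F where "F z = indicator ?K z *\<^sub>R (Y z * wbar (\<lambda>h. of_real (\<psi>' z h)))" for z
  have F: "integrable lborel F" "(\<integral>z. F z \<partial>lborel) = 0"
  proof -
    have eq: "F = (\<lambda>z. (indicator ?K z *\<^sub>R h' z 1 + \<i> * (indicator ?K z *\<^sub>R h' z \<i>)) / 2)"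
      by (auto simp: wbar_def fun_eq_iff indicator_def F_def h'_def algebra_simps)
    show "integrable lborel F"
      unfolding eq using I(1)[of 1] I(1)[of \<i>]
      by (intro integrable_divide_zero Bochner_Integration.integrable_add integrable_mult_right) auto
    show "(\<integral>z. F z \<partial>lborel) = 0"
      unfolding eq using I[of 1] I[of \<i>]
      by (simp only: integral_divide_zero Bochner_Integration.integral_add integral_mult_right_zero
          integrable_mult_right) simp
  qed
  have FE: "integrable lborel (\<lambda>z. indicator E z *\<^sub>R F z)"
    using F(1) E(1) by (intro integrable_mult_indicator) auto
  have FEeq: "(\<lambda>z. indicator E z *\<^sub>R F z) = (\<lambda>z. indicator (E \<inter> ?K) z *\<^sub>R (Y z * wbar (\<lambda>h. of_real (\<psi>' z h))))"
    by (auto simp: F_def indicator_def)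
  \<comment> \<open>This is 0 on \<open>E\<close> and -Re F off \<open>E\<close>: the inequality on
    \<open>E\<close> is traded for one on its complement.\<close>
  define J where "J z = Re (indicator E z *\<^sub>R F z - F z)" for z
  have Jint: "integrable lborel J"
    unfolding J_def[abs_def] using FE F(1) by (intro integrable_Re Bochner_Integration.integrable_diff)
  have "(\<integral>z. J z \<partial>lborel) = Re (\<integral>z. indicator E z *\<^sub>R F z - F z \<partial>lborel)"
    unfolding J_def[abs_def] using FE F(1) by (intro integral_Re Bochner_Integration.integrable_diff)
  also have "\<dots> = Re (\<integral>z. indicator E z *\<^sub>R F z \<partial>lborel)"
    using FE F by simp
  finally have Jle: "(\<integral>z. J z \<partial>lborel) \<le> 0" using Reineq unfolding FEeq by simp
  have Jeq: "J z = (norm (Y z))\<^sup>2 / 2 * (tent \<eta> (Re (\<sigma> z) - 1) * b (Im (\<sigma> z)))" if "z \<in> ?K" "z \<notin> E" for z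
  proof -
    have "tent \<eta> (Re (\<sigma> z)) * b (Im (\<sigma> z)) = 0"
    proof (rule ccontr)
      assume "tent \<eta> (Re (\<sigma> z)) * b (Im (\<sigma> z)) \<noteq> 0"
      then have "\<bar>Re (\<sigma> z)\<bar> < \<eta>" "\<bar>Im (\<sigma> z)\<bar> < \<eta>" using tent_props(3)[OF \<eta>(1)] bz by fastforce+
      then show False using nearE[of z] that KW by auto
    qed
    then have "g' (Re (\<sigma> z)) * b (Im (\<sigma> z)) = - (tent \<eta> (Re (\<sigma> z) - 1) * b (Im (\<sigma> z)))"
      by (simp add: g'_def algebra_simps)
    then show ?thesis using that by (simp add: J_def F_def w\<psi> del: of_real_divide)
  qed
  have Jz: "J z = 0" if "z \<in> E \<or> z \<notin> ?K" for z using that by (auto simp: J_def F_def)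
  have Jnn: "0 \<le> J z" for z
    using Jeq[of z] Jz[of z] tent_props(1)[OF \<eta>(1)] b0 by (metis mult_nonneg_nonneg zero_le_divide_iff zero_le_numeral zero_le_power2 order_refl)
  have "(\<integral>z. J z \<partial>lborel) = 0" using Jle integral_nonneg_AE[of J lborel] Jnn by (simp add: order_antisym)
  then have AEJ: "AE z in lborel. J z = 0"
    using Jint Jnn by (subst (asm) integral_nonneg_eq_0_iff_AE) auto
  define O' where "O' = {z \<in> ?W. \<sigma> z \<in> {w. \<bar>Re w - 1\<bar> < \<eta> \<and> \<bar>Im w\<bar> < \<eta>}} \<inter> - closure E"
  have "open {w. \<bar>Re w - 1\<bar> < \<eta> \<and> \<bar>Im w\<bar> < \<eta>}"
    by (intro open_Collect_conj open_Collect_less continuous_intros)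
  then have "open (?W \<inter> \<sigma> -` {w. \<bar>Re w - 1\<bar> < \<eta> \<and> \<bar>Im w\<bar> < \<eta>})"
    by (rule continuous_open_preimage[OF c\<sigma> open_ball])
  moreover have "O' = (?W \<inter> \<sigma> -` {w. \<bar>Re w - 1\<bar> < \<eta> \<and> \<bar>Im w\<bar> < \<eta>}) \<inter> - closure E"
    by (auto simp: O'_def)
  ultimately have oO: "open O'" by (metis closed_closure open_Compl open_Int)
  have z1O: "z1 \<in> O'" using z01 \<eta> z1E by (simp add: O'_def)
  have "J z \<noteq> 0" if "z \<in> O'" for z
  proof -
    have zW: "z \<in> ?W" and st: "\<bar>Re (\<sigma> z) - 1\<bar> < \<eta>" "\<bar>Im (\<sigma> z)\<bar> < \<eta>" and zE: "z \<notin> E"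
      using that closure_subset by (auto simp: O'_def)
    have "norm (\<sigma> z) \<le> 2" using cmod_le[of "\<sigma> z"] \<eta> st by linarith
    then have zK: "z \<in> ?K" using supp zW by blast
    have "b (Im (\<sigma> z)) \<noteq> 0" using bz st by simp
    then show ?thesis unfolding Jeq[OF zK zE]
      using hol(3)[OF zW] tent_props(2)[OF \<eta>(1) st(1)] by simp
  qed
  then have "AE z in lborel. z \<notin> O'" using AEJ by (auto elim!: eventually_mono)
  then have "O' \<in> null_sets lborel" using oO by (simp add: AE_iff_null_sets)
  then have "negligible O'" by (simp add: negligible_iff_null_sets null_sets_completionI)
  then show False using open_not_negligible[OF oO] z1O by blast
qed

section \<open>The weak derivative of a maximum of harmonic functions\<close>

text \<open>A primitive gives every admissible path the same integral, which makes the definite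
  description unique; connectedness provides at least one path.\<close>

lemma path_int_eq_primitive:
  assumes U: "open U" "connected U" and pz: "p \<in> U" "z \<in> U"
    and F: "\<And>w. w \<in> U \<Longrightarrow> (F has_field_derivative A w) (at w)"
  shows "path_int U A p z = F z - F p"
  unfolding path_int_def
proof (rule the_equality)
  have prim: "(A has_contour_integral (F (pathfinish g) - F (pathstart g))) g"
    if "valid_path g" "path_image g \<subseteq> U" for g
    using that by (intro contour_integral_primitive[where S=U]) (auto intro: has_field_derivative_at_within F)
  obtain g where g: "polynomial_function g" "path_image g \<subseteq> U" "pathstart g = p" "pathfinish g = z"
    using connected_open_polynomial_connected[OF U pz] by blast
  then show "\<exists>g. valid_path g \<and> path_image g \<subseteq> U \<and> pathstart g = p \<and> pathfinish g = z \<and>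
      (A has_contour_integral F z - F p) g"
    using prim[of g] valid_path_polynomial_function by (intro exI[of _ g]) auto
  show "I = F z - F p" if "\<exists>g. valid_path g \<and> path_image g \<subseteq> U \<and> pathstart g = p \<and> pathfinish g = z \<and>
      (A has_contour_integral I) g" for I
    using that prim has_contour_integral_unique by metis
qed

lemma smooth_fun_derivative:
  assumes "smooth_fun \<psi>"
  shows "(\<psi> has_derivative frechet_derivative \<psi> (at z)) (at z)"
    and "continuous_on UNIV (\<lambda>z. frechet_derivative \<psi> (at z) v)"
proof -
  have d: "\<psi> differentiable_on UNIV"
    using assms unfolding smooth_fun_def by (metis empty_set empty_subsetI partials.simps(1))
  then show D: "(\<psi> has_derivative frechet_derivative \<psi> (at z)) (at z)" for z
    by (simp add: differentiable_on_def frechet_derivative_works)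
  have c: "continuous_on UNIV (\<lambda>z. frechet_derivative \<psi> (at z) v)" if "v = 1 \<or> v = \<i>" for v
  proof -
    have "partials [v] \<psi> differentiable_on UNIV"
      using assms that unfolding smooth_fun_def by (metis empty_set insert_subset list.simps(15) empty_subsetI insertCI)
    then show ?thesis using differentiable_imp_continuous_on by fastforce
  qed
  have "frechet_derivative \<psi> (at z) v = Re v * frechet_derivative \<psi> (at z) 1 + Im v * frechet_derivative \<psi> (at z) \<i>" for z
  proof -
    have "v = Re v *\<^sub>R 1 + Im v *\<^sub>R \<i>" by (simp add: complex_eq_iff)
    then have "frechet_derivative \<psi> (at z) v = frechet_derivative \<psi> (at z) (Re v *\<^sub>R 1 + Im v *\<^sub>R \<i>)" by simp
    also have "\<dots> = Re v *\<^sub>R frechet_derivative \<psi> (at z) 1 + Im v *\<^sub>R frechet_derivative \<psi> (at z) \<i>"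
      using has_derivative_linear[OF D[of z]] by (simp only: linear_add linear_scale)
    finally show ?thesis by simp
  qed
  then show "continuous_on UNIV (\<lambda>z. frechet_derivative \<psi> (at z) v)"
    using c by (simp only:) (intro continuous_intros; simp)
qed

text \<open>The maximum is approximated by the smooth functions \<open>log (\<Sum>\<^sub>j exp (n H\<^sub>j)) / n\<close>.\<close>
lemma weak_derivative_max:
  fixes F A :: "nat \<Rightarrow> complex \<Rightarrow> complex" and I :: "nat set"
  assumes N: "open N" and I: "finite I" "I \<noteq> {}"
    and F: "\<And>i z. i \<in> I \<Longrightarrow> z \<in> N \<Longrightarrow> (F i has_field_derivative A i z) (at z)"
    and A: "\<And>i. i \<in> I \<Longrightarrow> continuous_on N (A i)"
    and \<Phi>: "\<And>K. compact K \<Longrightarrow> K \<subseteq> N \<Longrightarrow> set_integrable lborel K \<Phi>"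
    and ae: "AE z in lborel. z \<in> N \<longrightarrow> (\<exists>i\<in>I. \<Phi> z = A i z \<and> (\<forall>j\<in>I. j \<noteq> i \<longrightarrow> Re (F j z) < Re (F i z)))"
    and \<phi>: "\<And>z. z \<in> N \<Longrightarrow> \<phi> z = Max ((\<lambda>i. Re (F i z)) ` I)"
    and \<psi>: "test_fun N \<psi>"
  shows "(\<integral>z. \<Phi> z * complex_of_real (\<psi> z) \<partial>lborel) = 2 * distr_dz (\<lambda>z. complex_of_real (\<phi> z)) \<psi>"
proof -
  define K where "K = tsupport \<psi>"
  have K: "compact K" "K \<subseteq> N" "smooth_fun \<psi>" using \<psi> by (auto simp: test_fun_def K_def)
  have \<psi>0: "\<psi> z = 0" if "z \<notin> K" for z
    using that closure_subset[of "{z. \<psi> z \<noteq> 0}"] by (auto simp: K_def tsupport_def)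
  define \<psi>' where "\<psi>' z = frechet_derivative \<psi> (at z)" for z
  have d\<psi>: "(\<psi> has_derivative \<psi>' z) (at z)" for z unfolding \<psi>'_def by (rule smooth_fun_derivative(1)[OF K(3)])
  have c\<psi>': "continuous_on UNIV (\<lambda>z. \<psi>' z v)" for v unfolding \<psi>'_def by (rule smooth_fun_derivative(2)[OF K(3)])
  have dz0: "dz \<psi> z = 0" if "z \<notin> K" for z
  proof -
    have "(\<psi> has_derivative (\<lambda>h. 0)) (at z)"
    proof (rule has_derivative_transform_within_open[OF has_derivative_const[of 0]])
      show "open (- K)" using K(1) by (simp add: compact_imp_closed open_Compl)
    qed (use that \<psi>0 in auto)
    then have "frechet_derivative \<psi> (at z) = (\<lambda>h. 0)" by (metis frechet_derivative_at)
    then show ?thesis by (simp add: dz_def)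
  qed
  define H where "H i z = Re (F i z)" for i z
  define S where "S n z = (\<Sum>j\<in>I. exp (real (Suc n) * H j z))" for n z
  \<comment> \<open>\<open>p n j\<close> are the softmax weights. The average \<open>G n\<close> of
    the \<open>A j\<close> is twice the z-derivative of \<open>\<phi>n n\<close>, whence the factor
    2 in the claim.\<close>
  define p where "p n j z = exp (real (Suc n) * H j z) / S n z" for n j z
  define \<phi>n where "\<phi>n n z = ln (S n z) / real (Suc n)" for n z
  define G where "G n z = (\<Sum>j\<in>I. of_real (p n j z) * A j z)" for n z
  have S0: "0 < S n z" for n z unfolding S_def using I by (intro sum_pos) auto
  have p0: "0 \<le> p n j z" for n j z using S0[of n z] by (simp add: p_def)
  have p1: "(\<Sum>j\<in>I. p n j z) = 1" for n z
    using S0[of n z] by (simp add: p_def S_def flip: sum_divide_distrib)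
  have cH: "continuous_on K (H j)" if "j \<in> I" for j
  proof -
    have "continuous_on N (F j)" using F[OF that] DERIV_isCont continuous_at_imp_continuous_on by blast
    then show ?thesis unfolding H_def using K(2) by (intro continuous_intros) (auto intro: continuous_on_subset)
  qed
  have cS: "continuous_on K (S n)" for n unfolding S_def by (intro continuous_intros cH)
  have cp: "continuous_on K (p n j)" if "j \<in> I" for n j
    unfolding p_def using S0 by (intro continuous_intros cH cS that) (simp add: less_imp_neq[symmetric])
  have c\<phi>: "continuous_on K (\<phi>n n)" for n
    unfolding \<phi>n_def using S0 by (intro continuous_intros cS) (auto simp: less_imp_neq[symmetric])
  have cA: "continuous_on K (A j)" if "j \<in> I" for j using A[OF that] K(2) continuous_on_subset by blast
  have cG: "continuous_on K (G n)" for n unfolding G_def by (intro continuous_intros cp cA)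
  have c\<psi>: "continuous_on K \<psi>"
    using d\<psi> by (meson continuous_at_imp_continuous_on has_derivative_continuous)
  have cdz: "continuous_on K (dz \<psi>)"
    unfolding dz_def[abs_def] using c\<psi>'[unfolded \<psi>'_def]
    by (intro continuous_intros) (auto intro: continuous_on_subset)
  have dH: "(H j has_derivative (\<lambda>v. Re (A j z * v))) (at z)" if "j \<in> I" "z \<in> N" for j z
    unfolding H_def[abs_def] using F[OF that] by (intro has_derivative_Re) (simp add: has_field_derivative_def)
  have d\<phi>: "(\<phi>n n has_derivative (\<lambda>v. Re (G n z * v))) (at z)" if "z \<in> N" for n z
  proof -
    have e: "((\<lambda>z. exp (real (Suc n) * H j z)) has_derivative (\<lambda>v. exp (real (Suc n) * H j z) * (real (Suc n) * Re (A j z * v)))) (at z)"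
      if j: "j \<in> I" for j
      by (rule has_derivative_eq_rhs[OF has_derivative_exp[OF has_derivative_mult_right[OF dH[OF j \<open>z \<in> N\<close>]]]])
         (simp add: fun_eq_iff mult.commute)
    have "(S n has_derivative (\<lambda>v. \<Sum>j\<in>I. exp (real (Suc n) * H j z) * (real (Suc n) * Re (A j z * v)))) (at z)"
      unfolding S_def[abs_def] by (rule has_derivative_sum) (rule e)
    from has_derivative_compose[OF this DERIV_ln[OF S0[of n z], unfolded has_field_derivative_def]]
    have "((\<lambda>z. ln (S n z)) has_derivative (\<lambda>v. inverse (S n z) * (\<Sum>j\<in>I. exp (real (Suc n) * H j z) * (real (Suc n) * Re (A j z * v))))) (at z)"
      .
    from has_derivative_mult_left[OF this, of "inverse (real (Suc n))"]
    have "((\<lambda>z. ln (S n z) / real (Suc n)) has_derivative (\<lambda>v. (\<Sum>j\<in>I. exp (real (Suc n) * H j z) * (real (Suc n) * Re (A j z * v))) * inverse (S n z) / real (Suc n))) (at z)"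
      by (simp only: divide_inverse mult.commute[of "inverse (S n z)"])
    moreover have "(\<Sum>j\<in>I. exp (real (Suc n) * H j z) * (real (Suc n) * Re (A j z * v))) * inverse (S n z) / real (Suc n) = Re (G n z * v)" for v
    proof -
      have "Re (G n z * v) = (\<Sum>j\<in>I. p n j z * Re (A j z * v))"
        unfolding G_def sum_distrib_right Re_sum by (intro sum.cong) (auto simp: algebra_simps)
      also have "\<dots> = (\<Sum>j\<in>I. exp (real (Suc n) * H j z) * (real (Suc n) * Re (A j z * v)) * inverse (S n z) / real (Suc n))"
        by (intro sum.cong) (auto simp: p_def divide_inverse)
      finally show ?thesis by (simp only: sum_distrib_right sum_divide_distrib)
    qed
    ultimately show ?thesis unfolding \<phi>n_def[abs_def] by simp
  qed
  obtain CH CA where C: "0 \<le> CH" "\<And>j z. j \<in> I \<Longrightarrow> z \<in> K \<Longrightarrow> \<bar>H j z\<bar> \<le> CH"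
      "0 \<le> CA" "\<And>j z. j \<in> I \<Longrightarrow> z \<in> K \<Longrightarrow> norm (A j z) \<le> CA"
  proof -
    have b: "\<exists>C\<ge>0. \<forall>z\<in>K. norm (g z) \<le> C" if "continuous_on K g" for g :: "complex \<Rightarrow> 'b::real_normed_vector"
      using compact_imp_bounded[OF compact_continuous_image[OF that K(1)]] unfolding bounded_pos by (metis imageI less_imp_le)
    obtain c1 where c1: "\<And>j. j \<in> I \<Longrightarrow> 0 \<le> c1 j \<and> (\<forall>z\<in>K. norm (H j z) \<le> c1 j)" using b[OF cH] by metis
    obtain c2 where c2: "\<And>j. j \<in> I \<Longrightarrow> 0 \<le> c2 j \<and> (\<forall>z\<in>K. norm (A j z) \<le> c2 j)"
      using compact_imp_bounded[OF compact_continuous_image[OF cA K(1)]] unfolding bounded_pos by (metis imageI less_imp_le)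
    have "c1 j \<le> sum c1 I" "c2 j \<le> sum c2 I" if "j \<in> I" for j
      using that I c1 c2 by (auto intro!: member_le_sum)
    then show ?thesis using c1 c2 by (intro that[of "sum c1 I" "sum c2 I"]) (fastforce intro: sum_nonneg)+
  qed
  have Gb: "norm (G n z) \<le> CA" if "z \<in> K" for n z
  proof -
    have "norm (G n z) \<le> (\<Sum>j\<in>I. norm (of_real (p n j z) * A j z))" unfolding G_def by (rule norm_sum)
    also have "\<dots> \<le> (\<Sum>j\<in>I. p n j z * CA)"
      using p0 C(4) that by (intro sum_mono) (simp add: norm_mult mult_left_mono)
    also have "\<dots> = CA" using p1 by (simp flip: sum_distrib_right)
    finally show ?thesis .
  qed
  have sandwich: "Max ((\<lambda>i. H i z) ` I) \<le> \<phi>n n z" "\<phi>n n z \<le> Max ((\<lambda>i. H i z) ` I) + ln (real (card I)) / real (Suc n)" for n z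
  proof -
    let ?M = "Max ((\<lambda>i. H i z) ` I)"
    have "?M \<in> (\<lambda>i. H i z) ` I" using I by (intro Max_in) auto
    then obtain i where i: "i \<in> I" "?M = H i z" by blast
    have "exp (real (Suc n) * ?M) \<le> S n z"
      unfolding i(2) S_def by (rule member_le_sum[OF i(1)]) (use I in auto)
    then have "real (Suc n) * ?M \<le> ln (S n z)" using S0[of n z] by (metis ln_exp ln_le_cancel_iff exp_gt_zero)
    then show "?M \<le> \<phi>n n z" by (simp add: \<phi>n_def field_simps)
    have "S n z \<le> (\<Sum>j\<in>I. exp (real (Suc n) * ?M))"
      unfolding S_def using I by (intro sum_mono) (auto intro!: mult_left_mono Max_ge)
    then have "S n z \<le> real (card I) * exp (real (Suc n) * ?M)" by simp
    then have "ln (S n z) \<le> ln (real (card I) * exp (real (Suc n) * ?M))"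
      using S0[of n z] by (metis ln_le_cancel_iff order_less_le_trans)
    also have "\<dots> = ln (real (card I)) + real (Suc n) * ?M"
      using I by (subst ln_mult_pos) (auto simp: card_gt_0_iff)
    finally have "ln (S n z) / real (Suc n) \<le> (ln (real (card I)) + real (Suc n) * ?M) / real (Suc n)"
      by (rule divide_right_mono) simp
    then show "\<phi>n n z \<le> ?M + ln (real (card I)) / real (Suc n)"
      unfolding \<phi>n_def add_divide_distrib by simp
  qed
  have lnc: "0 \<le> ln (real (card I))" using I by (simp add: Suc_le_eq card_gt_0_iff)
  have \<phi>lim: "(\<lambda>n. \<phi>n n z) \<longlonglongrightarrow> \<phi> z" if "z \<in> N" for z
  proof (rule tendsto_sandwich[of "\<lambda>n. \<phi> z" _ _ "\<lambda>n. \<phi> z + ln (real (card I)) / real (Suc n)"])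
    have eq: "\<phi> z = Max ((\<lambda>i. H i z) ` I)" using \<phi>[OF that] by (simp add: H_def)
    show "\<forall>\<^sub>F n in sequentially. \<phi> z \<le> \<phi>n n z" "\<forall>\<^sub>F n in sequentially. \<phi>n n z \<le> \<phi> z + ln (real (card I)) / real (Suc n)"
      unfolding eq using sandwich by auto
    have "(\<lambda>n. \<phi> z + ln (real (card I)) * inverse (real (Suc n))) \<longlonglongrightarrow> \<phi> z + ln (real (card I)) * 0"
      by (intro tendsto_intros LIMSEQ_inverse_real_of_nat)
    then show "(\<lambda>n. \<phi> z + ln (real (card I)) / real (Suc n)) \<longlonglongrightarrow> \<phi> z" by (simp add: divide_inverse)
  qed simp
  have \<phi>b: "\<bar>\<phi>n n z\<bar> \<le> CH + ln (real (card I))" if "z \<in> K" for n z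
  proof -
    let ?M = "Max ((\<lambda>i. H i z) ` I)"
    have "?M \<in> (\<lambda>i. H i z) ` I" using I by (intro Max_in) auto
    then have "\<bar>?M\<bar> \<le> CH" using C(2) that by auto
    moreover have "ln (real (card I)) / real (Suc n) \<le> ln (real (card I))" using lnc by (simp add: divide_le_eq mult_le_cancel_left1)
    ultimately show ?thesis using sandwich[where n=n and z=z] lnc by linarith
  qed
  \<comment> \<open>Weights of indices strictly below the maximum decay geometrically, so only
    \<open>A i\<close> survives; at a tie the weights would be shared, which is why
    \<open>ae\<close> asks for a strict maximum.\<close>
  have Glim: "(\<lambda>n. G n z) \<longlonglongrightarrow> A i z" if i: "i \<in> I" "\<And>j. j \<in> I \<Longrightarrow> j \<noteq> i \<Longrightarrow> H j z < H i z" for i z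
  proof -
    have pl: "(\<lambda>n. p n j z) \<longlonglongrightarrow> 0" if j: "j \<in> I" "j \<noteq> i" for j
    proof (rule tendsto_sandwich[of "\<lambda>n. 0" _ _ "\<lambda>n. exp (H j z - H i z) ^ Suc n"])
      show "\<forall>\<^sub>F n in sequentially. 0 \<le> p n j z" using p0 by simp
      have "p n j z \<le> exp (H j z - H i z) ^ Suc n" for n
      proof -
        have "exp (real (Suc n) * H i z) \<le> S n z"
          unfolding S_def by (rule member_le_sum[OF i(1)]) (use I in auto)
        then have "p n j z \<le> exp (real (Suc n) * H j z) / exp (real (Suc n) * H i z)"
          unfolding p_def by (intro divide_left_mono mult_pos_pos S0) auto
        also have "\<dots> = exp (real (Suc n) * (H j z - H i z))" by (simp add: right_diff_distrib exp_diff)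
        also have "\<dots> = exp (H j z - H i z) ^ Suc n" by (rule exp_of_nat_mult)
        finally show ?thesis .
      qed
      then show "\<forall>\<^sub>F n in sequentially. p n j z \<le> exp (H j z - H i z) ^ Suc n" by simp
      have "(\<lambda>n. exp (H j z - H i z) ^ n) \<longlonglongrightarrow> 0" using i(2)[OF j] by (intro LIMSEQ_power_zero) simp
      then show "(\<lambda>n. exp (H j z - H i z) ^ Suc n) \<longlonglongrightarrow> 0" by (rule LIMSEQ_Suc)
    qed simp
    have Geq: "G n z = A i z + (\<Sum>j\<in>I. of_real (p n j z) * (A j z - A i z))" for n
    proof -
      have "(\<Sum>j\<in>I. of_real (p n j z) * (A j z - A i z)) = G n z - (\<Sum>j\<in>I. of_real (p n j z)) * A i z"
        by (simp add: G_def right_diff_distrib sum_subtractf sum_distrib_right)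
      also have "(\<Sum>j\<in>I. complex_of_real (p n j z)) = 1" using p1[of n z] by (metis of_real_1 of_real_sum)
      finally show ?thesis by simp
    qed
    have "(\<lambda>n. A i z + (\<Sum>j\<in>I. of_real (p n j z) * (A j z - A i z))) \<longlonglongrightarrow> A i z + (\<Sum>j\<in>I. 0)"
    proof (intro tendsto_add tendsto_const tendsto_sum)
      fix j assume "j \<in> I"
      show "(\<lambda>n. of_real (p n j z) * (A j z - A i z)) \<longlonglongrightarrow> 0"
      proof (cases "j = i")
        case False
        have "(\<lambda>n. complex_of_real (p n j z) * (A j z - A i z)) \<longlonglongrightarrow> of_real 0 * (A j z - A i z)"
          by (intro tendsto_intros pl \<open>j \<in> I\<close> False)
        then show ?thesis by simp
      qed simp
    qed
    then show ?thesis by (simp add: Geq)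
  qed
  have cint: "integrable lborel (\<lambda>z. indicator K z *\<^sub>R g z)" "(\<lambda>z. indicator K z *\<^sub>R g z) \<in> borel_measurable borel"
    if g: "continuous_on K g" for g :: "complex \<Rightarrow> complex"
  proof -
    show m: "(\<lambda>z. indicator K z *\<^sub>R g z) \<in> borel_measurable borel"
      using g K(1) by (intro borel_measurable_continuous_on_indicator) (auto simp: borel_compact)
    obtain C where "\<And>z. z \<in> K \<Longrightarrow> norm (g z) \<le> C"
      using compact_imp_bounded[OF compact_continuous_image[OF g K(1)]] unfolding bounded_iff by (metis imageI)
    then show "integrable lborel (\<lambda>z. indicator K z *\<^sub>R g z)"
      by (intro integrable_bounded_support[OF m K(1), where C=C]) auto
  qed
  define L where "L n z = indicator K z *\<^sub>R (of_real (\<phi>n n z) * dz \<psi> z)" for n z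
  define P where "P n z = indicator K z *\<^sub>R (G n z * of_real (\<psi> z))" for n z
  have Lint: "integrable lborel (L n)" "L n \<in> borel_measurable borel" for n
    unfolding L_def[abs_def] by (rule cint, intro continuous_intros c\<phi> cdz)+
  have Pint: "integrable lborel (P n)" "P n \<in> borel_measurable borel" for n
    unfolding P_def[abs_def] by (rule cint, intro continuous_intros cG c\<psi>)+
  have LP: "(\<integral>z. L n z \<partial>lborel) = - (\<integral>z. P n z \<partial>lborel) / 2" for n
  proof -
    define h where "h z = complex_of_real (\<psi> z * \<phi>n n z)" for z
    define h' where "h' z v = complex_of_real (\<psi> z * Re (G n z * v) + \<psi>' z v * \<phi>n n z)" for z v
    have hd: "(h has_derivative h' z) (at z)" if "z \<in> K" for z
      unfolding h_def[abs_def] h'_def[abs_def]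
      using has_derivative_of_real[OF has_derivative_mult[OF d\<psi>[of z] d\<phi>[of z n]]] that K(2) by auto
    have h0: "h z = 0" if "z \<in> N - K" for z using \<psi>0 that by (simp add: h_def)
    have hc: "continuous_on K (\<lambda>z. h' z v)" for v
      unfolding h'_def by (intro continuous_intros c\<psi> cG c\<phi> continuous_on_subset[OF c\<psi>']) auto
    note J = integral_directional_derivative_eq_0[OF N K(1,2) hd h0 hc]
    have "(h' z 1 - \<i> * h' z \<i>) / 2 = of_real (\<phi>n n z) * dz \<psi> z + G n z * of_real (\<psi> z) / 2" for z
      by (simp add: h'_def dz_def \<psi>'_def complex_eq_iff field_simps)
    then have "(\<lambda>z. L n z + P n z / 2) = (\<lambda>z. (indicator K z *\<^sub>R h' z 1 - \<i> * (indicator K z *\<^sub>R h' z \<i>)) / 2)"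
      by (auto simp: L_def P_def fun_eq_iff indicator_def)
    then have "(\<integral>z. L n z + P n z / 2 \<partial>lborel) = (\<integral>z. (indicator K z *\<^sub>R h' z 1 - \<i> * (indicator K z *\<^sub>R h' z \<i>)) / 2 \<partial>lborel)"
      by simp
    also have "\<dots> = 0"
      using J[of 1] J[of \<i>]
      by (simp only: integral_divide_zero Bochner_Integration.integral_diff integral_mult_right_zero
          integrable_mult_right) simp
    finally show ?thesis using Lint(1)[of n] Pint(1)[of n] by (simp add: eq_neg_iff_add_eq_0)
  qed
  have dom: "integrable lborel (\<lambda>z. indicator K z *\<^sub>R (T * norm (g z)))" if "continuous_on K g" for T and g :: "complex \<Rightarrow> complex"
  proof -
    have int: "integrable lborel (\<lambda>z. T * norm (indicator K z *\<^sub>R g z))"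
      by (intro integrable_mult_right integrable_norm cint that)
    have eq: "(\<lambda>z. T * norm (indicator K z *\<^sub>R g z)) = (\<lambda>z. indicator K z *\<^sub>R (T * norm (g z)))"
      by (auto simp: indicator_def)
    show ?thesis using int unfolding eq .
  qed
  have Llim: "(\<lambda>n. \<integral>z. L n z \<partial>lborel) \<longlonglongrightarrow> (\<integral>z. of_real (\<phi> z) * dz \<psi> z \<partial>lborel)"
  proof (rule integral_dominated_convergence[where w="\<lambda>z. indicator K z *\<^sub>R ((CH + ln (real (card I))) * norm (dz \<psi> z))"])
    have lim: "(\<lambda>n. L n z) \<longlonglongrightarrow> of_real (\<phi> z) * dz \<psi> z" for z
    proof (cases "z \<in> K")
      case True
      then show ?thesis using K(2) unfolding L_def by (auto intro!: tendsto_intros \<phi>lim)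
    qed (simp add: L_def dz0)
    then show "AE z in lborel. (\<lambda>n. L n z) \<longlonglongrightarrow> of_real (\<phi> z) * dz \<psi> z" by simp
    show "(\<lambda>z. of_real (\<phi> z) * dz \<psi> z) \<in> borel_measurable lborel"
      by (rule borel_measurable_LIMSEQ_metric[OF _ lim]) (use Lint in auto)
    show "AE z in lborel. norm (L n z) \<le> indicator K z *\<^sub>R ((CH + ln (real (card I))) * norm (dz \<psi> z))" for n
      using \<phi>b by (intro AE_I2) (auto simp: L_def indicator_def norm_mult mult_right_mono)
    show "L n \<in> borel_measurable lborel" for n using Lint by auto
  qed (rule dom[OF cdz])
  have Plim: "(\<lambda>n. \<integral>z. P n z \<partial>lborel) \<longlonglongrightarrow> (\<integral>z. \<Phi> z * of_real (\<psi> z) \<partial>lborel)"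
  proof (rule integral_dominated_convergence[where w="\<lambda>z. indicator K z *\<^sub>R (CA * norm (complex_of_real (\<psi> z)))"])
    have "(\<lambda>z. (indicator K z *\<^sub>R \<Phi> z) * (indicator K z *\<^sub>R complex_of_real (\<psi> z))) \<in> borel_measurable lborel"
      using \<Phi>[OF K(1,2)] cint(2)[OF continuous_on_of_real[OF c\<psi>]]
      by (intro borel_measurable_times) (auto simp: set_integrable_def)
    also have "(\<lambda>z. (indicator K z *\<^sub>R \<Phi> z) * (indicator K z *\<^sub>R complex_of_real (\<psi> z))) = (\<lambda>z. \<Phi> z * of_real (\<psi> z))"
      using \<psi>0 by (auto simp: indicator_def fun_eq_iff)
    finally show "(\<lambda>z. \<Phi> z * of_real (\<psi> z)) \<in> borel_measurable lborel" .
    show "AE z in lborel. (\<lambda>n. P n z) \<longlonglongrightarrow> \<Phi> z * of_real (\<psi> z)"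
      using ae
    proof eventually_elim
      case (elim z)
      show ?case
      proof (cases "z \<in> K")
        case True
        then obtain i where "i \<in> I" "\<Phi> z = A i z" "\<And>j. j \<in> I \<Longrightarrow> j \<noteq> i \<Longrightarrow> H j z < H i z"
          using elim K(2) unfolding H_def by blast
        then show ?thesis using True Glim[of i z] by (auto simp: P_def intro!: tendsto_intros)
      qed (simp add: P_def \<psi>0)
    qed
    show "AE z in lborel. norm (P n z) \<le> indicator K z *\<^sub>R (CA * norm (complex_of_real (\<psi> z)))" for n
      using Gb by (intro AE_I2) (auto simp: P_def indicator_def norm_mult mult_right_mono)
    show "P n \<in> borel_measurable lborel" for n using Pint by auto
  qed (rule dom, intro continuous_intros c\<psi>)
  have "(\<lambda>n. - (\<integral>z. P n z \<partial>lborel) / 2) \<longlonglongrightarrow> - (\<integral>z. \<Phi> z * of_real (\<psi> z) \<partial>lborel) / 2"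
    by (intro tendsto_intros Plim) auto
  then have "(\<integral>z. of_real (\<phi> z) * dz \<psi> z \<partial>lborel) = - (\<integral>z. \<Phi> z * of_real (\<psi> z) \<partial>lborel) / 2"
    using Llim unfolding LP using LIMSEQ_unique by blast
  then show ?thesis by (simp add: distr_dz_def)
qed

section \<open>The dominant phase near the point\<close>

text \<open>Mean value inequality for \<open>F z - a * z\<close>, whose derivative has modulus at
  most \<kappa> on the convex ball.\<close>

lemma primitive_linearization:
  fixes F A :: "complex \<Rightarrow> complex"
  assumes "\<And>z. z \<in> ball p R \<Longrightarrow> (F has_field_derivative A z) (at z)"
    and "\<And>z. z \<in> ball p R \<Longrightarrow> norm (A z - a) \<le> \<kappa>"
    and "z \<in> ball p R" "w \<in> ball p R"
  shows "norm (F z - F w - a * (z - w)) \<le> \<kappa> * norm (z - w)"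
proof -
  have "norm ((F z - a * z) - (F w - a * w)) \<le> \<kappa> * norm (z - w)"
  proof (rule field_differentiable_bound[OF convex_ball[of p R] _ _ assms(3,4)])
    show "((\<lambda>z. F z - a * z) has_field_derivative A z - a) (at z within ball p R)" if "z \<in> ball p R" for z
      using DERIV_diff[OF assms(1)[OF that] DERIV_cmult_Id[of a]] by (rule has_field_derivative_at_within)
  qed (use assms(2) in auto)
  then show ?thesis by (simp add: algebra_simps)
qed

text \<open>Write d_j = A_i(p) - A_j(p) and \<zeta> = z1 - p. By the choice of \<open>c\<close>, two
  of the numbers Re (d_j \<zeta>) cannot both be below c |\<zeta>| in absolute value. The
  inequalities at \<open>z1\<close> put all of them above -c |\<zeta>|, so all except the smallest
  are at least c |\<zeta>|; the index of the smallest supplies the coordinate. The bounds m, B, c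
  and \<kappa> do not involve \<open>z1\<close>, so one neighbourhood serves every point.\<close>

lemma dominant_in_closure:
  fixes A F :: "nat \<Rightarrow> complex \<Rightarrow> complex" and M :: "nat \<Rightarrow> complex set"
  assumes I: "finite I" "i \<in> I" "I - {i} \<noteq> {}"
    and R: "0 < R"
    and F: "\<And>j z. j \<in> I \<Longrightarrow> z \<in> ball p R \<Longrightarrow> (F j has_field_derivative A j z) (at z)" "\<And>j. j \<in> I \<Longrightarrow> F j p = 0"
    and A: "\<And>j. j \<in> I \<Longrightarrow> A j holomorphic_on ball p R"
    and close: "\<And>j z. j \<in> I \<Longrightarrow> z \<in> ball p R \<Longrightarrow> norm (A j z - A j p) \<le> \<kappa>"
    and m: "0 < m" "\<And>j. j \<in> I - {i} \<Longrightarrow> m \<le> norm (A i p - A j p)"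
    and B: "0 < B" "\<And>j. j \<in> I - {i} \<Longrightarrow> norm (A i p - A j p) \<le> B"
    and c: "0 < c" "\<And>j k \<zeta>. j \<in> I - {i} \<Longrightarrow> k \<in> I - {i} \<Longrightarrow> j \<noteq> k \<Longrightarrow>
        c * norm \<zeta> \<le> max \<bar>Re ((A i p - A j p) * \<zeta>)\<bar> \<bar>Re ((A i p - A k p) * \<zeta>)\<bar>"
    and \<kappa>: "0 < \<kappa>" "4 * \<kappa> \<le> m" "2 * \<kappa> \<le> c" "2 * \<kappa> \<le> B" "40 * B * \<kappa> \<le> c * m"
    and f: "integrable lborel f" "\<And>z. norm (f z) \<le> C"
    and pos: "\<And>z e. 0 < e \<Longrightarrow> cball z e \<subseteq> ball p R \<Longrightarrow>
        Im (distr_dzbar f (bump z e)) = 0 \<and> 0 \<le> Re (distr_dzbar f (bump z e))"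
    and cf: "AE z in lborel. z \<in> ball p R \<longrightarrow> isCont f z"
    and Mo: "open (M i)" "p \<in> closure (M i)"
    and ae: "AE z in lborel. z \<in> ball p R \<longrightarrow> (\<exists>j\<in>I. z \<in> M j \<and> f z = A j z)"
    and Mi: "\<And>z. z \<in> M i \<Longrightarrow> z \<in> ball p R \<Longrightarrow> f z = A i z"
    and z1: "z1 \<in> ball p (m * R / (40 * B))"
       "\<And>j. j \<in> I - {i} \<Longrightarrow> Re (F j z1) < Re (F i z1)"
  shows "z1 \<in> closure (M i)"
proof -
  let ?J = "I - {i}"
  \<comment> \<open>The 40 comes from the support condition: \<open>norm (w z0)\<close> and
    \<open>norm (w z1)\<close> are at most 2 B R1, so |\<sigma> z| <= 2 forces |w z| <= 5 (2 B R1) =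
    m R / 4, and the lower Lipschitz constant m/2 of \<open>w\<close> gives |z - p| <= R/2.\<close>
  define R1 where "R1 = m * R / (40 * B)"
  have mB: "m \<le> B" using m(2) B(2) I(3) order_trans by blast
  have R1: "0 < R1" "R1 \<le> R" "40 * B * R1 = m * R"
  proof -
    show "0 < R1" "40 * B * R1 = m * R" using m(1) B(1) R by (auto simp: R1_def)
    have "m * R \<le> 40 * B * R" using mB R B(1) by (intro mult_right_mono) auto
    then show "R1 \<le> R" using B(1) by (simp add: R1_def field_simps)
  qed
  have z1W: "z1 \<in> ball p R" and z1R1: "norm (z1 - p) < R1"
    using z1(1) R1(2) unfolding R1_def[symmetric] by (auto simp: dist_norm norm_minus_commute)
  have pW: "p \<in> ball p R" using R by simp
  define \<zeta> where "\<zeta> = z1 - p"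
  define d where "d j = A i p - A j p" for j
  define D where "D j z = A i z - A j z" for j z
  have Dd: "norm (D j z - d j) \<le> 2 * \<kappa>" if "j \<in> I" "z \<in> ball p R" for j z
  proof -
    have "D j z - d j = (A i z - A i p) - (A j z - A j p)" by (simp add: D_def d_def)
    then show ?thesis
      using norm_triangle_ineq4[of "A i z - A i p" "A j z - A j p"] close[OF I(2) that(2)] close[OF that] by simp
  qed
  have est: "norm ((F i z - F j z) - (F i w - F j w) - d j * (z - w)) \<le> 2 * \<kappa> * norm (z - w)"
    if "j \<in> I" "z \<in> ball p R" "w \<in> ball p R" for j z w
  proof -
    have 1: "norm (F i z - F i w - A i p * (z - w)) \<le> \<kappa> * norm (z - w)"
      by (rule primitive_linearization[OF F(1)[OF I(2)] close[OF I(2)] that(2,3)])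
    have 2: "norm (F j z - F j w - A j p * (z - w)) \<le> \<kappa> * norm (z - w)"
      by (rule primitive_linearization[OF F(1)[OF that(1)] close[OF that(1)] that(2,3)])
    have eq: "(F i z - F j z) - (F i w - F j w) - d j * (z - w)
        = (F i z - F i w - A i p * (z - w)) - (F j z - F j w - A j p * (z - w))"
      by (simp add: d_def algebra_simps)
    show ?thesis unfolding eq
      using 1 2 norm_triangle_ineq4[of "F i z - F i w - A i p * (z - w)" "F j z - F j w - A j p * (z - w)"]
      by linarith
  qed
  have \<zeta>0: "0 < norm \<zeta>"
  proof -
    obtain j where "j \<in> ?J" using I(3) by blast
    then have "z1 \<noteq> p" using z1(2)[of j] F(2) I(2) by auto
    then show ?thesis by (simp add: \<zeta>_def)
  qed
  have low: "- (c * norm \<zeta>) < Re (d j * \<zeta>)" if "j \<in> ?J" for j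
  proof -
    have e: "norm ((F i z1 - F j z1) - d j * \<zeta>) \<le> 2 * \<kappa> * norm \<zeta>"
      using est[of j z1 p] that z1W pW F(2) I(2) by (simp add: \<zeta>_def)
    have "Re ((F i z1 - F j z1) - d j * \<zeta>) \<le> 2 * \<kappa> * norm \<zeta>"
      using complex_Re_le_cmod e order_trans by blast
    moreover have "Re ((F i z1 - F j z1) - d j * \<zeta>) = (Re (F i z1) - Re (F j z1)) - Re (d j * \<zeta>)"
      by (simp only: minus_complex.sel)
    moreover have "2 * \<kappa> * norm \<zeta> \<le> c * norm \<zeta>" using \<kappa>(3) by (intro mult_right_mono) auto
    ultimately show ?thesis using z1(2)[OF that] by linarith
  qed
  have "Min ((\<lambda>j. Re (d j * \<zeta>)) ` ?J) \<in> (\<lambda>j. Re (d j * \<zeta>)) ` ?J"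
    using I by (intro Min_in) auto
  then obtain k where k0: "k \<in> ?J" "Min ((\<lambda>j. Re (d j * \<zeta>)) ` ?J) = Re (d k * \<zeta>)" by blast
  have k: "k \<in> ?J" "\<And>j. j \<in> ?J \<Longrightarrow> Re (d k * \<zeta>) \<le> Re (d j * \<zeta>)"
    unfolding k0(2)[symmetric] using k0(1) I(1) by (auto intro!: Min_le simp del: times_complex.sel)
  have high: "c * norm \<zeta> \<le> Re (d j * \<zeta>)" if "j \<in> ?J" "j \<noteq> k" for j
  proof (rule ccontr)
    assume "\<not> c * norm \<zeta> \<le> Re (d j * \<zeta>)"
    then have "\<bar>Re (d j * \<zeta>)\<bar> < c * norm \<zeta>" "\<bar>Re (d k * \<zeta>)\<bar> < c * norm \<zeta>"
      using low[OF that(1)] low[OF k(1)] k(2)[OF that(1)] by linarith+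
    then show False using c(2)[OF that(1) k(1) that(2), of \<zeta>] unfolding d_def by linarith
  qed
  have kI: "k \<in> I" "k \<noteq> i" using k by auto
  define w where "w z = F i z - F k z" for z
  have wp: "w p = 0" using F(2) I(2) kI by (simp add: w_def)
  have west: "norm (w z - w z' - d k * (z - z')) \<le> 2 * \<kappa> * norm (z - z')"
    if "z \<in> ball p R" "z' \<in> ball p R" for z z'
    using est[OF kI(1) that] by (simp add: w_def)
  have dk: "m \<le> norm (d k)" "norm (d k) \<le> B" using m(2)[OF k(1)] B(2)[OF k(1)] by (auto simp: d_def)
  have wlow: "m / 2 * norm (z - z') \<le> norm (w z - w z')" if "z \<in> ball p R" "z' \<in> ball p R" for z z'
  proof -
    have "m * norm (z - z') \<le> norm (d k * (z - z'))" using dk(1) by (simp add: norm_mult mult_right_mono)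
    moreover have "2 * \<kappa> * norm (z - z') \<le> m / 2 * norm (z - z')" using \<kappa>(2) by (intro mult_right_mono) auto
    moreover have "norm (d k * (z - z')) \<le> norm (w z - w z') + norm (w z - w z' - d k * (z - z'))"
      using norm_triangle_ineq4[of "w z - w z'" "w z - w z' - d k * (z - z')"] by simp
    ultimately show ?thesis using west[OF that] by (simp add: field_simps)
  qed
  have wup: "norm (w z) \<le> 2 * B * norm (z - p)" if "z \<in> ball p R" for z
  proof -
    have "norm (d k * (z - p)) \<le> B * norm (z - p)" using dk(2) by (simp add: norm_mult mult_right_mono)
    moreover have "2 * \<kappa> * norm (z - p) \<le> B * norm (z - p)" using \<kappa>(4) by (intro mult_right_mono) auto
    moreover have "norm (w z) \<le> norm (w z - d k * (z - p)) + norm (d k * (z - p))"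
      using norm_triangle_ineq[of "w z - d k * (z - p)" "d k * (z - p)"] by simp
    ultimately show ?thesis using west[OF that pW] wp by simp
  qed
  have Rew1: "0 < Re (w z1)" using z1(2)[OF k(1)] by (simp add: w_def)
  \<comment> \<open>Three demands on the starting point: it lies within \<open>R1\<close> of p,
    \<open>norm (w z0)\<close> is at most \<kappa> |\<zeta>| so that v stays close to
    \<open>d k * \<zeta>\<close>, and \<open>norm (w z0)\<close> is below \<open>Re (w z1)\<close>
    so that Re v > 0.\<close>
  define e where "e = min R1 (min (\<kappa> * norm \<zeta> / (2 * B)) (Re (w z1) / (2 * B)))"
  have "0 < e" using R1 \<kappa>(1) \<zeta>0 B(1) Rew1 by (simp add: e_def)
  then obtain z0 where z0: "z0 \<in> M i" "norm (z0 - p) < e"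
    using Mo(2) by (auto simp: closure_approachable dist_norm)
  have z0R1: "norm (z0 - p) < R1" using z0(2) by (simp add: e_def)
  have z0W: "z0 \<in> ball p R" using z0R1 R1(2) by (simp add: dist_norm norm_minus_commute)
  have wz0: "norm (w z0) \<le> \<kappa> * norm \<zeta>" "norm (w z0) < Re (w z1)"
  proof -
    have "norm (z0 - p) \<le> \<kappa> * norm \<zeta> / (2 * B)" "norm (z0 - p) < Re (w z1) / (2 * B)"
      using z0(2) by (auto simp: e_def)
    then have "2 * B * norm (z0 - p) \<le> \<kappa> * norm \<zeta>" "2 * B * norm (z0 - p) < Re (w z1)"
      using B(1) by (auto simp: field_simps)
    then show "norm (w z0) \<le> \<kappa> * norm \<zeta>" "norm (w z0) < Re (w z1)" using wup[OF z0W] by linarith+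
  qed
  define v where "v = w z1 - w z0"
  have Rev: "0 < Re v" using wz0(2) complex_Re_le_cmod[of "w z0"] by (simp add: v_def)
  then have v0: "v \<noteq> 0" by auto
  have vest: "norm (v - d k * \<zeta>) \<le> 3 * \<kappa> * norm \<zeta>"
  proof -
    have 1: "norm (w z1 - d k * \<zeta>) \<le> 2 * \<kappa> * norm \<zeta>" using west[OF z1W pW] wp by (simp add: \<zeta>_def)
    have eq: "v - d k * \<zeta> = (w z1 - d k * \<zeta>) - w z0" by (simp add: v_def)
    show ?thesis unfolding eq using 1 norm_triangle_ineq4[of "w z1 - d k * \<zeta>" "w z0"] wz0(1) by linarith
  qed
  have Dlow: "m / 2 \<le> norm (D k z)" if "z \<in> ball p R" for z
    using Dd[OF kI(1) that] dk(1) \<kappa>(2) norm_triangle_ineq4[of "D k z" "D k z - d k"] by simp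
  have D0: "D k z \<noteq> 0" if "z \<in> ball p R" for z using Dlow[OF that] m(1) by auto
  define \<sigma> where "\<sigma> z = (w z - w z0) / v" for z
  define Y where "Y z = D k z / v" for z
  \<comment> \<open>For \<open>k\<close> the ratio D_k/Y is v itself; for the other indices half of
    the gap c |\<zeta>| survives.\<close>
  define c0 where "c0 = min (Re v) (c / 2 * norm \<zeta>)"
  have ratio: "c0 \<le> Re (D j z / Y z)" if j: "j \<in> ?J" and z: "z \<in> ball p R" for j z
  proof (cases "j = k")
    case True
    then show ?thesis using D0[OF z] v0 by (simp add: Y_def c0_def)
  next
    case False
    have jI: "j \<in> I" using j by auto
    define X where "X = D j z * v / D k z"
    have dj: "norm (d j) \<le> B" using B(2)[OF j] by (simp add: d_def)
    have Dj: "norm (D j z) \<le> 2 * B"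
      using Dd[OF jI z] dj \<kappa>(4) norm_triangle_ineq[of "D j z - d j" "d j"] by simp
    \<comment> \<open>The three errors come from replacing v by \<open>d k * \<zeta>\<close>, D_j by
      d_j and D_k by d_k, and add up to (6 + 2 + 2) B \<kappa> |\<zeta>|. Division by |D_k| >= m/2
      gives 20 B \<kappa> |\<zeta>| / m, which the last condition on \<kappa> bounds by half of the
      gap.\<close>
    have 1: "norm (D j z * (v - d k * \<zeta>)) \<le> 2 * B * (3 * \<kappa> * norm \<zeta>)"
      unfolding norm_mult using Dj vest B(1) by (intro mult_mono) auto
    have 2: "norm ((D j z - d j) * (d k * \<zeta>)) \<le> 2 * \<kappa> * (B * norm \<zeta>)"
      unfolding norm_mult using Dd[OF jI z] dk(2) \<kappa>(1) B(1) by (intro mult_mono) auto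
    have 3: "norm (d j * ((D k z - d k) * \<zeta>)) \<le> B * (2 * \<kappa> * norm \<zeta>)"
      unfolding norm_mult using Dd[OF kI(1) z] dj \<kappa>(1) B(1) by (intro mult_mono) auto
    have "D j z * v - D k z * (d j * \<zeta>) = D j z * (v - d k * \<zeta>) + (D j z - d j) * (d k * \<zeta>) - d j * ((D k z - d k) * \<zeta>)"
      by (simp add: algebra_simps)
    then have 4: "norm (D j z * v - D k z * (d j * \<zeta>)) \<le> 10 * B * \<kappa> * norm \<zeta>"
      using 1 2 3 norm_triangle_ineq4[of "D j z * (v - d k * \<zeta>) + (D j z - d j) * (d k * \<zeta>)" "d j * ((D k z - d k) * \<zeta>)"]
        norm_triangle_ineq[of "D j z * (v - d k * \<zeta>)" "(D j z - d j) * (d k * \<zeta>)"]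
      by (simp add: algebra_simps)
    have "X - d j * \<zeta> = (D j z * v - D k z * (d j * \<zeta>)) / D k z"
      using D0[OF z] by (simp add: X_def field_simps)
    then have "norm (X - d j * \<zeta>) = norm (D j z * v - D k z * (d j * \<zeta>)) / norm (D k z)" by (simp add: norm_divide)
    also have "\<dots> \<le> (10 * B * \<kappa> * norm \<zeta>) / (m / 2)"
      using 4 Dlow[OF z] m(1) B(1) \<kappa>(1) by (intro frac_le) auto
    also have "\<dots> \<le> c / 2 * norm \<zeta>"
    proof -
      have "40 * B * \<kappa> * norm \<zeta> \<le> c * m * norm \<zeta>" using \<kappa>(5) by (intro mult_right_mono) auto
      then show ?thesis using m(1) by (simp add: field_simps)
    qed
    finally have "\<bar>Re (X - d j * \<zeta>)\<bar> \<le> c / 2 * norm \<zeta>" using abs_Re_le_cmod order_trans by blast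
    then have "c / 2 * norm \<zeta> \<le> Re X" using high[OF j False] unfolding minus_complex.sel by linarith
    moreover have "D j z / Y z = X" using v0 by (simp add: X_def Y_def)
    ultimately show ?thesis by (simp add: c0_def)
  qed
  show ?thesis
  proof (rule interior_propagates[where s="R / 2" and R=R and f=f and B=C and p=p and a="A i" and Y=Y and \<sigma>=\<sigma>
        and m="m / 2 / norm v" and ?z0.0=z0 and ?z1.0=z1 and c=c0])
    show "0 < R / 2" "R / 2 < R" using R by auto
    show "integrable lborel f" "\<And>z. norm (f z) \<le> C" by (fact f)+
    show "\<And>z e. 0 < e \<Longrightarrow> cball z e \<subseteq> ball p R \<Longrightarrow>
        Im (distr_dzbar f (bump z e)) = 0 \<and> 0 \<le> Re (distr_dzbar f (bump z e))" by (fact pos)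
    show "AE z in lborel. z \<in> ball p R \<longrightarrow> isCont f z" by (fact cf)
    show "A i holomorphic_on ball p R" by (rule A[OF I(2)])
    show "Y holomorphic_on ball p R" unfolding Y_def D_def using v0 A[OF I(2)] A[OF kI(1)] by (intro holomorphic_intros) auto
    show "Y z \<noteq> 0" if "z \<in> ball p R" for z using D0[OF that] v0 by (simp add: Y_def)
    show "(\<sigma> has_field_derivative Y z) (at z)" if "z \<in> ball p R" for z
      unfolding \<sigma>_def[abs_def] w_def Y_def D_def using F(1)[OF I(2) that] F(1)[OF kI(1) that] v0
      by (auto intro!: derivative_eq_intros)
    show "0 < m / 2 / norm v" using m(1) v0 by simp
    show "m / 2 / norm v * norm (z - z') \<le> norm (\<sigma> z - \<sigma> z')" if "z \<in> ball p R" "z' \<in> ball p R" for z z'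
    proof -
      have "\<sigma> z - \<sigma> z' = (w z - w z') / v" by (simp add: \<sigma>_def diff_divide_distrib)
      then have "norm (\<sigma> z - \<sigma> z') = norm (w z - w z') / norm v" by (simp add: norm_divide)
      moreover have "m / 2 * norm (z - z') / norm v \<le> norm (w z - w z') / norm v"
        using wlow[OF that] by (intro divide_right_mono) auto
      ultimately show ?thesis by simp
    qed
    show "z \<in> cball p (R / 2)" if z: "z \<in> ball p R" and \<sigma>2: "norm (\<sigma> z) \<le> 2" for z
    proof -
      have "norm (w z - w z0) \<le> 2 * norm v" using \<sigma>2 v0 by (simp add: \<sigma>_def norm_divide divide_le_eq)
      moreover have "norm v \<le> norm (w z1) + norm (w z0)" unfolding v_def by (rule norm_triangle_ineq4)
      moreover have "norm (w z) \<le> norm (w z - w z0) + norm (w z0)" using norm_triangle_ineq[of "w z - w z0" "w z0"] by simp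
      moreover have "norm (w z1) \<le> 2 * B * R1"
        using wup[OF z1W] mult_left_mono[OF less_imp_le[OF z1R1], of "2 * B"] B(1) by linarith
      moreover have "norm (w z0) \<le> 2 * B * R1"
        using wup[OF z0W] mult_left_mono[OF less_imp_le[OF z0R1], of "2 * B"] B(1) by linarith
      ultimately have "norm (w z) \<le> 10 * (B * R1)" by linarith
      also have "\<dots> = m / 2 * (R / 2)" using R1(3) by simp
      finally have "m / 2 * norm (z - p) \<le> m / 2 * (R / 2)" using wlow[OF z pW] wp by simp
      then show ?thesis using m(1) by (simp add: dist_norm norm_minus_commute)
    qed
    show "z0 \<in> ball p R" "z1 \<in> ball p R" "z0 \<in> interior (M i)"
      using z0W z1W z0(1) Mo(1) by (auto simp: interior_open)
    show "\<sigma> z0 = 0" "\<sigma> z1 = 1" using v0 by (auto simp: \<sigma>_def v_def)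
    show "0 < c0" using Rev c(1) \<zeta>0 by (simp add: c0_def)
    show "M i \<in> sets borel" using Mo(1) by simp
    show "AE z in lborel. z \<in> ball p R \<longrightarrow> (if z \<in> M i then f z = A i z else c0 \<le> Re ((A i z - f z) / Y z))"
      using ae
    proof eventually_elim
      case (elim z)
      show ?case
      proof
        assume z: "z \<in> ball p R"
        show "if z \<in> M i then f z = A i z else c0 \<le> Re ((A i z - f z) / Y z)"
        proof (cases "z \<in> M i")
          case True
          then show ?thesis using Mi z by simp
        next
          case False
          then obtain j where "j \<in> ?J" "f z = A j z" using elim z by blast
          then show ?thesis using ratio[OF _ z, of j] False by (simp add: D_def)
        qed
      qed
    qed
  qed
qed

text \<open>The lower bound makes \<open>w\<close> injective with Lipschitz inverse, so the level
  set is a Lipschitz image of a part of the imaginary axis.\<close>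

lemma negligible_level_set:
  fixes w :: "complex \<Rightarrow> complex"
  assumes m: "0 < m" and low: "\<And>z z'. z \<in> W \<Longrightarrow> z' \<in> W \<Longrightarrow> m * norm (z - z') \<le> norm (w z - w z')"
  shows "negligible {z \<in> W. Re (w z) = 0}"
proof -
  let ?T = "{z \<in> W. Re (w z) = 0}"
  have inj: "inj_on w W"
  proof (rule inj_onI)
    fix z z' assume "z \<in> W" "z' \<in> W" "w z = w z'"
    then have "m * norm (z - z') \<le> 0" using low[of z z'] by simp
    then show "z = z'" using m by (simp add: mult_le_0_iff)
  qed
  have "negligible {x::complex. 1 \<bullet> x = 0}" by (rule negligible_hyperplane) simp
  then have "negligible (w ` ?T)" by (rule negligible_subset) (auto simp: inner_complex_def)
  then have "negligible (inv_into W w ` (w ` ?T))"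
  proof (rule negligible_locally_Lipschitz_image[OF order_refl])
    fix x assume "x \<in> w ` ?T"
    then obtain z where z: "z \<in> W" "x = w z" by blast
    have "norm (inv_into W w y - inv_into W w x) \<le> 1 / m * norm (y - x)" if y: "y \<in> w ` ?T" for y
    proof -
      obtain z' where z': "z' \<in> W" "y = w z'" using y by blast
      have "m * norm (z' - z) \<le> norm (y - x)" using low[OF z'(1) z(1)] z z' by simp
      then show ?thesis using z z' inj m by (simp add: inv_into_f_f field_simps)
    qed
    then show "\<exists>T B. open T \<and> x \<in> T \<and> (\<forall>y\<in>w ` ?T \<inter> T. norm (inv_into W w y - inv_into W w x) \<le> B * norm (y - x))"
      by (intro exI[of _ UNIV] exI[of _ "1 / m"]) auto
  qed
  moreover have "inv_into W w ` (w ` ?T) = ?T" by (rule inv_into_image_cancel[OF inj]) auto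
  ultimately show ?thesis by simp
qed

lemma finite_positive_lower_bound:
  fixes g :: "'a \<Rightarrow> real"
  assumes "finite S" "\<And>x. x \<in> S \<Longrightarrow> 0 < g x"
  shows "\<exists>c>0. \<forall>x\<in>S. c \<le> g x"
  using assms
proof (induction S rule: finite_induct)
  case empty
  then show ?case by (intro exI[of _ 1]) simp
next
  case (insert x S)
  then obtain c where "0 < c" "\<forall>x\<in>S. c \<le> g x" by auto
  then show ?case using insert.prems[of x] by (intro exI[of _ "min c (g x)"]) auto
qed

text \<open>\<open>Im (\<alpha> * cnj \<beta>)\<close> is the signed area spanned by \<alpha> and
  \<beta>, nonzero by independence over the reals. Cramer's rule, the identity \<open>id\<close> in
  the proof, recovers \<zeta> from the two real parts, and taking norms gives the bound.\<close>

lemma max_Re_lower_bound: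
  fixes \<alpha> \<beta> :: complex
  assumes "\<And>t::real. \<alpha> \<noteq> of_real t * \<beta>" "\<beta> \<noteq> 0"
  shows "0 < \<bar>Im (\<alpha> * cnj \<beta>)\<bar> / (norm \<alpha> + norm \<beta>)"
    and "\<bar>Im (\<alpha> * cnj \<beta>)\<bar> / (norm \<alpha> + norm \<beta>) * norm \<zeta> \<le> max \<bar>Re (\<alpha> * \<zeta>)\<bar> \<bar>Re (\<beta> * \<zeta>)\<bar>"
proof -
  have s: "0 < norm \<alpha> + norm \<beta>" using assms(2) by (simp add: add_nonneg_pos)
  have "Im (\<alpha> * cnj \<beta>) \<noteq> 0"
  proof
    assume "Im (\<alpha> * cnj \<beta>) = 0"
    then have "\<alpha> * cnj \<beta> = of_real (Re (\<alpha> * cnj \<beta>))" by (simp add: complex_eq_iff)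
    then have "\<alpha> * (\<beta> * cnj \<beta>) = of_real (Re (\<alpha> * cnj \<beta>)) * \<beta>" by (metis mult.assoc mult.commute)
    moreover have "\<beta> * cnj \<beta> = of_real ((norm \<beta>)\<^sup>2)" by (rule complex_norm_square[symmetric])
    ultimately have "\<alpha> = of_real (Re (\<alpha> * cnj \<beta>) / (norm \<beta>)\<^sup>2) * \<beta>" using assms(2) by (simp add: field_simps)
    then show False using assms(1) by blast
  qed
  then show "0 < \<bar>Im (\<alpha> * cnj \<beta>)\<bar> / (norm \<alpha> + norm \<beta>)" using s by simp
  have id: "\<i> * of_real (Im (\<alpha> * cnj \<beta>)) * \<zeta> = of_real (Re (\<alpha> * \<zeta>)) * cnj \<beta> - of_real (Re (\<beta> * \<zeta>)) * cnj \<alpha>"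
    by (simp add: complex_eq_iff algebra_simps)
  have "\<bar>Im (\<alpha> * cnj \<beta>)\<bar> * norm \<zeta> = norm (\<i> * of_real (Im (\<alpha> * cnj \<beta>)) * \<zeta>)"
    by (simp only: norm_mult norm_ii norm_of_real mult_1)
  also have "\<dots> \<le> norm (of_real (Re (\<alpha> * \<zeta>)) * cnj \<beta>) + norm (of_real (Re (\<beta> * \<zeta>)) * cnj \<alpha>)"
    unfolding id by (rule norm_triangle_ineq4)
  also have "\<dots> = \<bar>Re (\<alpha> * \<zeta>)\<bar> * norm \<beta> + \<bar>Re (\<beta> * \<zeta>)\<bar> * norm \<alpha>" by (simp only: norm_mult norm_of_real complex_mod_cnj)
  also have "\<dots> \<le> max \<bar>Re (\<alpha> * \<zeta>)\<bar> \<bar>Re (\<beta> * \<zeta>)\<bar> * norm \<beta> + max \<bar>Re (\<alpha> * \<zeta>)\<bar> \<bar>Re (\<beta> * \<zeta>)\<bar> * norm \<alpha>"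
    by (intro add_mono mult_right_mono) auto
  finally show "\<bar>Im (\<alpha> * cnj \<beta>)\<bar> / (norm \<alpha> + norm \<beta>) * norm \<zeta> \<le> max \<bar>Re (\<alpha> * \<zeta>)\<bar> \<bar>Re (\<beta> * \<zeta>)\<bar>"
    using s by (simp add: field_simps)
qed

section \<open>Constants and radius at p, and identification of the phases near p\<close>

theorem theorem1:
  fixes U :: "complex set" and \<Phi> :: "complex \<Rightarrow> complex" and r :: nat
    and M :: "nat \<Rightarrow> complex set" and A :: "nat \<Rightarrow> complex \<Rightarrow> complex" and p :: complex
  assumes U: "open U" "connected U" "simply_connected U"
    and Sigma: "Sigma_class U \<Phi>"
    and pw: "piecewise_analytic U \<Phi> r M A"
    and pU: "p \<in> U"
    and i: "\<forall>i\<in>{1..r}. p \<in> closure (M i)"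
    and ii: "\<forall>i\<in>{1..r}. \<forall>j\<in>{1..r}. \<forall>k\<in>{1..r}. i \<noteq> j \<and> j \<noteq> k \<and> i \<noteq> k \<longrightarrow>
               (\<forall>t::real. A i p - A k p \<noteq> of_real t * (A j p - A k p))"
    and iii: "\<forall>i\<in>{1..r}. \<forall>k\<in>{1..r}. i \<noteq> k \<longrightarrow> A i p \<noteq> A k p"
  shows "\<exists>N. open N \<and> p \<in> N \<and> N \<subseteq> U \<and>
           (\<forall>\<psi>. test_fun N \<psi> \<longrightarrow>
              (\<integral>z. \<Phi> z * complex_of_real (\<psi> z) \<partial>lborel)
                = 2 * distr_dz (\<lambda>z. complex_of_real (Max ((\<lambda>i. Hfun U (A i) p z) ` {1..r}))) \<psi>)"
proof -
  define I where "I = {1..r}"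
  have I: "finite I" by (simp add: I_def)
  have loc: "\<And>K. compact K \<Longrightarrow> K \<subseteq> U \<Longrightarrow> set_integrable lborel K \<Phi>"
    and Mo: "\<And>j. j \<in> I \<Longrightarrow> open (M j)"
    and disj: "\<And>j k. j \<in> I \<Longrightarrow> k \<in> I \<Longrightarrow> j \<noteq> k \<Longrightarrow> M j \<inter> M k = {}"
    and null: "U - (\<Union>j\<in>I. M j) \<in> null_sets lborel"
    and an: "\<And>j. j \<in> I \<Longrightarrow> A j holomorphic_on U"
    and \<Phi>ae: "AE z in lborel. z \<in> U \<longrightarrow> \<Phi> z = (\<Sum>j\<in>I. if z \<in> M j then A j z else 0)"
    using pw unfolding piecewise_analytic_def loc_integrable_def I_def[symmetric]
    by (auto intro: analytic_imp_holomorphic)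
  \<comment> \<open>Without any phase, the nonempty open set \<open>U\<close> would be null.\<close>
  have ne: "I \<noteq> {}"
  proof
    assume "I = {}"
    then have "U \<in> null_sets lborel" using null by simp
    then have "negligible U" by (simp add: negligible_iff_null_sets null_sets_completionI)
    then show False using open_not_negligible[OF U(1)] pU by blast
  qed
  have cover: "AE z in lborel. z \<in> U \<longrightarrow> (\<exists>j\<in>I. z \<in> M j)"
    using AE_not_in[OF null] by (rule eventually_mono) auto
  have sumM: "(\<Sum>k\<in>I. if z \<in> M k then A k z else 0) = A j z" if "j \<in> I" "z \<in> M j" for z j
  proof -
    have "(\<Sum>k\<in>I. if z \<in> M k then A k z else 0) = (\<Sum>k\<in>I. if k = j then A k z else 0)"
      by (rule sum.cong) (use that disj[OF _ that(1)] in auto)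
    then show ?thesis using that I by simp
  qed
  \<comment> \<open>Simple connectedness enters here, through global primitives; normalised to
    vanish at p, they have real part \<open>Hfun\<close>.\<close>
  have "\<forall>j\<in>I. \<exists>h. \<forall>z\<in>U. (h has_field_derivative A j z) (at z)"
    using U(3) an unfolding simply_connected_eq_global_primitive[OF U(1)] by blast
  then obtain F0 where F0: "\<And>j z. j \<in> I \<Longrightarrow> z \<in> U \<Longrightarrow> (F0 j has_field_derivative A j z) (at z)" by metis
  define F where "F j z = F0 j z - F0 j p" for j z
  have F: "(F j has_field_derivative A j z) (at z)" if "j \<in> I" "z \<in> U" for j z
    unfolding F_def[abs_def] using F0[OF that] by (auto intro!: derivative_eq_intros)
  have Fp: "F j p = 0" for j by (simp add: F_def)
  have HF: "Hfun U (A j) p z = Re (F j z)" if "j \<in> I" "z \<in> U" for j z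
    using path_int_eq_primitive[OF U(1,2) pU that(2) F[OF that(1)]] by (simp add: Hfun_def Fp)
  have ne_a: "A j p \<noteq> A k p" if "j \<in> I" "k \<in> I" "j \<noteq> k" for j k
    using iii that unfolding I_def by blast
  obtain m where m: "0 < m" "\<And>j k. j \<in> I \<Longrightarrow> k \<in> I \<Longrightarrow> j \<noteq> k \<Longrightarrow> m \<le> norm (A j p - A k p)"
  proof -
    have "\<exists>c>0. \<forall>x\<in>{x \<in> I \<times> I. fst x \<noteq> snd x}. c \<le> norm (A (fst x) p - A (snd x) p)"
      using I ne_a by (intro finite_positive_lower_bound) auto
    then show ?thesis using that by fastforce
  qed
  \<comment> \<open>The summand 1 keeps \<open>B\<close> positive even if all A_j(p) vanish, as may
    happen for a single phase.\<close>
  define B where "B = 1 + 2 * (\<Sum>j\<in>I. norm (A j p))"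
  have B1: "1 \<le> B" by (simp add: B_def sum_nonneg)
  have Ab: "norm (A j p) \<le> (\<Sum>j\<in>I. norm (A j p))" if "j \<in> I" for j
    using I that by (intro member_le_sum) auto
  have B: "norm (A j p - A k p) \<le> B" if "j \<in> I" "k \<in> I" for j k
    using Ab[OF that(1)] Ab[OF that(2)] norm_triangle_ineq4[of "A j p" "A k p"] by (simp add: B_def)
  define q where "q = (\<lambda>(i, j, k). \<bar>Im ((A i p - A j p) * cnj (A i p - A k p))\<bar> / (norm (A i p - A j p) + norm (A i p - A k p)))"
  have indep: "A i p - A j p \<noteq> of_real t * (A i p - A k p)"
    if "i \<in> I" "j \<in> I" "k \<in> I" "i \<noteq> j" "j \<noteq> k" "i \<noteq> k" for i j k and t :: real
  proof
    assume "A i p - A j p = of_real t * (A i p - A k p)"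
    \<comment> \<open>The base index stands third in \<open>ii\<close> and first here; both
      differences are negated to match.\<close>
    then have "A j p - A i p = of_real t * (A k p - A i p)" by (simp add: algebra_simps)
    then show False using ii[folded I_def, rule_format, of j k i t] that by auto
  qed
  obtain c where c: "0 < c" "\<And>i j k. i \<in> I \<Longrightarrow> j \<in> I \<Longrightarrow> k \<in> I \<Longrightarrow> i \<noteq> j \<Longrightarrow> j \<noteq> k \<Longrightarrow> i \<noteq> k \<Longrightarrow> c \<le> q (i, j, k)"
  proof -
    \<comment> \<open>With fewer than three indices the set of triples is empty, and any positive
      constant serves.\<close>
    have "\<exists>c>0. \<forall>x\<in>{x \<in> I \<times> I \<times> I. fst x \<noteq> fst (snd x) \<and> fst (snd x) \<noteq> snd (snd x) \<and> fst x \<noteq> snd (snd x)}. c \<le> q x"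
    proof (rule finite_positive_lower_bound)
      fix x assume x: "x \<in> {x \<in> I \<times> I \<times> I. fst x \<noteq> fst (snd x) \<and> fst (snd x) \<noteq> snd (snd x) \<and> fst x \<noteq> snd (snd x)}"
      obtain i j k where xe: "x = (i, j, k)" by (cases x) auto
      show "0 < q x"
        unfolding xe q_def prod.case
        by (rule max_Re_lower_bound(1)) (use x xe indep ne_a in auto)
    qed (use I in auto)
    then show ?thesis using that by fastforce
  qed
  have cmax: "c * norm \<zeta> \<le> max \<bar>Re ((A i p - A j p) * \<zeta>)\<bar> \<bar>Re ((A i p - A k p) * \<zeta>)\<bar>"
    if h: "i \<in> I" "j \<in> I - {i}" "k \<in> I - {i}" "j \<noteq> k" for i j k \<zeta>
  proof -
    have "c * norm \<zeta> \<le> q (i, j, k) * norm \<zeta>" using c(2)[of i j k] h by (intro mult_right_mono) auto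
    moreover have "q (i, j, k) * norm \<zeta> \<le> max \<bar>Re ((A i p - A j p) * \<zeta>)\<bar> \<bar>Re ((A i p - A k p) * \<zeta>)\<bar>"
      unfolding q_def prod.case by (rule max_Re_lower_bound(2)) (use h indep ne_a in auto)
    ultimately show ?thesis by linarith
  qed
  \<comment> \<open>One term for each inequality that \<open>dominant_in_closure\<close> requires; 4
    \<kappa> <= m is used once more for the null sets of ties.\<close>
  define \<kappa> where "\<kappa> = min (min (m / 4) (c / 2)) (min (B / 2) (c * m / (40 * B)))"
  have \<kappa>: "0 < \<kappa>" "4 * \<kappa> \<le> m" "2 * \<kappa> \<le> c" "2 * \<kappa> \<le> B" "40 * B * \<kappa> \<le> c * m"
  proof -
    show "0 < \<kappa>" using m(1) c(1) B1 by (simp add: \<kappa>_def)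
    have "\<kappa> \<le> m / 4" "\<kappa> \<le> c / 2" "\<kappa> \<le> B / 2" "\<kappa> \<le> c * m / (40 * B)" by (auto simp: \<kappa>_def)
    then show "4 * \<kappa> \<le> m" "2 * \<kappa> \<le> c" "2 * \<kappa> \<le> B" "40 * B * \<kappa> \<le> c * m" using B1 by (auto simp: field_simps)
  qed
  obtain R where R: "0 < R" "ball p R \<subseteq> U" "\<And>j z. j \<in> I \<Longrightarrow> z \<in> ball p R \<Longrightarrow> norm (A j z - A j p) \<le> \<kappa>"
  proof -
    have "\<forall>\<^sub>F z in nhds p. z \<in> U" using U(1) pU by (rule eventually_nhds_in_open)
    moreover have "\<forall>\<^sub>F z in nhds p. \<forall>j\<in>I. norm (A j z - A j p) \<le> \<kappa>"
    proof (rule eventually_ball_finite[OF I], rule ballI)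
      fix j assume "j \<in> I"
      then have "isCont (A j) p"
        using an U(1) pU holomorphic_on_imp_continuous_on continuous_on_eq_continuous_at by blast
      then have "(A j \<longlongrightarrow> A j p) (nhds p)" by (simp add: continuous_at tendsto_at_iff_tendsto_nhds)
      then have "\<forall>\<^sub>F z in nhds p. dist (A j z) (A j p) < \<kappa>" using \<kappa>(1) by (rule tendstoD)
      then show "\<forall>\<^sub>F z in nhds p. norm (A j z - A j p) \<le> \<kappa>" by (rule eventually_mono) (simp add: dist_norm)
    qed
    ultimately have "\<forall>\<^sub>F z in nhds p. z \<in> U \<and> (\<forall>j\<in>I. norm (A j z - A j p) \<le> \<kappa>)" by (rule eventually_conj)
    then obtain R where "0 < R" "\<And>z. dist z p < R \<Longrightarrow> z \<in> U \<and> (\<forall>j\<in>I. norm (A j z - A j p) \<le> \<kappa>)"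
      unfolding eventually_nhds_metric by blast
    then show ?thesis by (intro that[of R]) (auto simp: dist_commute)
  qed
  have anR: "A j holomorphic_on ball p R" if "j \<in> I" for j using an[OF that] R(2) holomorphic_on_subset by blast
  \<comment> \<open>A representative of \<Phi> on the ball, cut off to 0 elsewhere: it is bounded
    and globally integrable, hence can be mollified, and agrees with A_j at every point of M_j in
    the ball, hence is continuous there. \<Phi> itself satisfies this only almost
    everywhere.\<close>
  define f where "f z = (\<Sum>j\<in>I. indicator (M j \<inter> ball p R) z *\<^sub>R A j z)" for z
  have fM: "f z = A j z" if "j \<in> I" "z \<in> M j" "z \<in> ball p R" for j z
  proof -
    have "f z = (\<Sum>k\<in>I. if z \<in> M k then A k z else 0)"
      unfolding f_def by (rule sum.cong) (use that in auto)
    then show ?thesis using sumM[OF that(1,2)] by simp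
  qed
  have f0: "f z = 0" if "\<not> (\<exists>j\<in>I. z \<in> M j \<and> z \<in> ball p R)" for z
    unfolding f_def using that by (intro sum.neutral) auto
  define C where "C = (\<Sum>j\<in>I. norm (A j p)) + \<kappa>"
  have fC: "norm (f z) \<le> C" for z
  proof (cases "\<exists>j\<in>I. z \<in> M j \<and> z \<in> ball p R")
    case True
    then obtain j where j: "j \<in> I" "z \<in> M j" "z \<in> ball p R" by blast
    show ?thesis using fM[OF j] R(3)[OF j(1,3)] Ab[OF j(1)] norm_triangle_ineq[of "A j z - A j p" "A j p"]
      by (simp add: C_def)
  next
    case False
    then show ?thesis using f0 \<kappa>(1) by (simp add: C_def add_nonneg_nonneg sum_nonneg)
  qed
  have fm: "f \<in> borel_measurable borel"
    unfolding f_def[abs_def]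
  proof (rule borel_measurable_sum)
    fix j assume j: "j \<in> I"
    show "(\<lambda>z. indicator (M j \<inter> ball p R) z *\<^sub>R A j z) \<in> borel_measurable borel"
      using Mo[OF j] holomorphic_on_imp_continuous_on[OF anR[OF j]]
      by (intro borel_measurable_continuous_on_indicator) (auto intro: continuous_on_subset)
  qed
  have fint: "integrable lborel f"
    by (rule integrable_bounded_support[OF fm compact_cball[of p R], where C=C]) (use fC f0 in auto)
  have cf: "AE z in lborel. z \<in> ball p R \<longrightarrow> isCont f z"
    using cover
  proof eventually_elim
    case (elim z)
    show ?case
    proof
      assume z: "z \<in> ball p R"
      then obtain j where j: "j \<in> I" "z \<in> M j" using elim R(2) by blast
      have "open (M j \<inter> ball p R)" using Mo[OF j(1)] by auto
      moreover have "continuous_on (M j \<inter> ball p R) f"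
        by (rule continuous_on_eq[OF continuous_on_subset[OF holomorphic_on_imp_continuous_on[OF anR[OF j(1)]]]])
           (use fM[OF j(1)] in auto)
      ultimately show "isCont f z" using j z by (simp add: continuous_on_eq_continuous_at)
    qed
  qed
  have fae: "AE z in lborel. z \<in> ball p R \<longrightarrow> (\<exists>j\<in>I. z \<in> M j \<and> f z = A j z \<and> \<Phi> z = A j z)"
    using cover \<Phi>ae
  proof eventually_elim
    case (elim z)
    show ?case
    proof
      assume z: "z \<in> ball p R"
      then obtain j where j: "j \<in> I" "z \<in> M j" using elim R(2) by blast
      then show "\<exists>j\<in>I. z \<in> M j \<and> f z = A j z \<and> \<Phi> z = A j z"
        using elim(2) fM[OF j z] sumM[OF j] z R(2) by auto
    qed
  qed
  \<comment> \<open>\<open>f\<close> and \<Phi> agree almost everywhere on the ball, which contains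
    the support of the bump, so positivity is inherited. Since \<Phi> is known to be measurable only
    on compact subsets of \<open>U\<close>, the product is first cut off at that support.\<close>
  have pos: "Im (distr_dzbar f (bump z e)) = 0 \<and> 0 \<le> Re (distr_dzbar f (bump z e))"
    if e: "0 < e" and sub: "cball z e \<subseteq> ball p R" for z e
  proof -
    have tf: "test_fun U (bump z e)" using sub R(2) by (intro test_fun_bump e) auto
    have m1: "dzbar (bump z e) \<in> borel_measurable borel"
      unfolding dzbar_def[abs_def]
      by (intro borel_measurable_continuous_onI continuous_intros smooth_fun_derivative(2) smooth_fun_bump) auto
    have d0: "dzbar (bump z e) w = 0" if "w \<notin> cball z e" for w
    proof -
      have "(bump z e has_derivative (\<lambda>h. 0)) (at w)"
      proof (rule has_derivative_transform_within_open[OF has_derivative_const[of 0]])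
        show "open (- cball z e)" by (simp add: open_Compl)
        show "0 = bump z e w" if "w \<in> - cball z e" for w
          using that bump_pos_iff[OF e, of z w] by (metis ComplD ball_subset_cball subsetD)
      qed (use that in auto)
      then have "frechet_derivative (bump z e) (at w) = (\<lambda>h. 0)" by (metis frechet_derivative_at)
      then show ?thesis by (simp add: dzbar_def)
    qed
    have m2: "(\<lambda>w. \<Phi> w * dzbar (bump z e) w) \<in> borel_measurable lborel"
    proof -
      have "set_integrable lborel (cball z e) \<Phi>" using loc sub R(2) by auto
      then have "(\<lambda>w. (indicator (cball z e) w *\<^sub>R \<Phi> w) * dzbar (bump z e) w) \<in> borel_measurable lborel"
        using m1 by (intro borel_measurable_times) (auto simp: set_integrable_def)
      also have "(\<lambda>w. (indicator (cball z e) w *\<^sub>R \<Phi> w) * dzbar (bump z e) w) = (\<lambda>w. \<Phi> w * dzbar (bump z e) w)"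
        using d0 by (auto simp: fun_eq_iff indicator_def)
      finally show ?thesis .
    qed
    have "(\<integral>w. f w * dzbar (bump z e) w \<partial>lborel) = (\<integral>w. \<Phi> w * dzbar (bump z e) w \<partial>lborel)"
    proof (rule integral_cong_AE[OF _ m2])
      show "(\<lambda>w. f w * dzbar (bump z e) w) \<in> borel_measurable lborel" using fm m1 by auto
      show "AE w in lborel. f w * dzbar (bump z e) w = \<Phi> w * dzbar (bump z e) w"
        using fae
      proof eventually_elim
        case (elim w)
        then show ?case using d0[of w] sub by (cases "w \<in> cball z e") auto
      qed
    qed
    then have "distr_dzbar f (bump z e) = distr_dzbar \<Phi> (bump z e)" by (simp add: distr_dzbar_def)
    then show ?thesis using Sigma tf bump_nonneg unfolding Sigma_class_def by auto
  qed
  define R1 where "R1 = m * R / (40 * B)"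
  define N where "N = ball p (min R R1)"
  have R1: "0 < R1" using m(1) R(1) B1 by (simp add: R1_def)
  have N: "open N" "p \<in> N" "N \<subseteq> ball p R" "N \<subseteq> ball p R1" using R(1) R1 by (auto simp: N_def)
  have NU: "N \<subseteq> U" using N(3) R(2) by blast
  have ties: "AE z in lborel. z \<notin> {z \<in> ball p R. Re (F j z - F k z) = 0}" if jk: "j \<in> I" "k \<in> I" "j \<noteq> k" for j k
  proof -
    \<comment> \<open>\<open>F j - F k\<close> differs from the linear map of slope A_j(p) - A_k(p)
      by a function with Lipschitz constant 2 \<kappa> <= m/2, and the slope has modulus at least
      m.\<close>
    have low: "m / 2 * norm (z - w) \<le> norm ((F j z - F k z) - (F j w - F k w))"
      if zw: "z \<in> ball p R" "w \<in> ball p R" for z w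
    proof -
      have 1: "norm (F j z - F j w - A j p * (z - w)) \<le> \<kappa> * norm (z - w)"
        by (rule primitive_linearization[OF F[OF jk(1)] R(3)[OF jk(1)] zw]) (use R(2) in auto)
      have 2: "norm (F k z - F k w - A k p * (z - w)) \<le> \<kappa> * norm (z - w)"
        by (rule primitive_linearization[OF F[OF jk(2)] R(3)[OF jk(2)] zw]) (use R(2) in auto)
      have 3: "m * norm (z - w) \<le> norm ((A j p - A k p) * (z - w))"
        using m(2)[OF jk] by (simp add: norm_mult mult_right_mono)
      have eq: "(A j p - A k p) * (z - w) = ((F j z - F k z) - (F j w - F k w))
          - ((F j z - F j w - A j p * (z - w)) - (F k z - F k w - A k p * (z - w)))"
        by (simp add: algebra_simps)
      have "norm ((A j p - A k p) * (z - w)) \<le> norm ((F j z - F k z) - (F j w - F k w)) + 2 * (\<kappa> * norm (z - w))"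
        unfolding eq using 1 2 norm_triangle_ineq4[of "(F j z - F k z) - (F j w - F k w)" "(F j z - F j w - A j p * (z - w)) - (F k z - F k w - A k p * (z - w))"]
          norm_triangle_ineq4[of "F j z - F j w - A j p * (z - w)" "F k z - F k w - A k p * (z - w)"] by linarith
      moreover have "4 * \<kappa> * norm (z - w) \<le> m * norm (z - w)" using \<kappa>(2) by (intro mult_right_mono) auto
      ultimately show ?thesis using 3 by simp
    qed
    have neg: "negligible {z \<in> ball p R. Re (F j z - F k z) = 0}"
      by (rule negligible_level_set[OF _ low]) (use m(1) in auto)
    \<comment> \<open>Negligibility refers to the completed measure, so the tie set must also be
      shown to be Borel before it counts as a null set of \<open>lborel\<close>.\<close>
    have "continuous_on (ball p R) (F l)" if "l \<in> I" for l
      using F[OF that] R(2) by (intro continuous_at_imp_continuous_on ballI) (blast intro: DERIV_isCont)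
    then have "continuous_on (ball p R) (\<lambda>z. Re (F j z - F k z))"
      using jk by (intro continuous_intros)
    then have "(\<lambda>z. indicator (ball p R) z *\<^sub>R Re (F j z - F k z)) \<in> borel_measurable borel"
      by (intro borel_measurable_continuous_on_indicator) auto
    then have "{z \<in> space borel. indicator (ball p R) z *\<^sub>R Re (F j z - F k z) = 0} \<in> sets borel"
      by (rule borel_measurable_eq) simp
    then have "ball p R \<inter> {z. indicator (ball p R) z *\<^sub>R Re (F j z - F k z) = 0} \<in> sets borel" by auto
    moreover have "ball p R \<inter> {z. indicator (ball p R) z *\<^sub>R Re (F j z - F k z) = 0} = {z \<in> ball p R. Re (F j z - F k z) = 0}"
      by auto
    ultimately have "{z \<in> ball p R. Re (F j z - F k z) = 0} \<in> null_sets lborel"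
      using neg by (simp add: negligible_iff_null_sets null_sets_completion_iff)
    then show ?thesis by (rule AE_not_in)
  qed
  have ties_all: "AE z in lborel. \<forall>j\<in>I. \<forall>k\<in>I. j \<noteq> k \<longrightarrow> z \<notin> {z \<in> ball p R. Re (F j z - F k z) = 0}"
    using ties by (intro AE_finite_allI I) auto
  have ae: "AE z in lborel. z \<in> N \<longrightarrow> (\<exists>i\<in>I. \<Phi> z = A i z \<and> (\<forall>j\<in>I. j \<noteq> i \<longrightarrow> Re (F j z) < Re (F i z)))"
    using fae ties_all
  proof eventually_elim
    case (elim z)
    show ?case
    proof
      assume zN: "z \<in> N"
      then have zW: "z \<in> ball p R" using N by blast
      then obtain l where l: "l \<in> I" "z \<in> M l" "\<Phi> z = A l z" using elim(1) by blast
      have "Max ((\<lambda>j. Re (F j z)) ` I) \<in> (\<lambda>j. Re (F j z)) ` I" using I ne by (intro Max_in) auto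
      then obtain i where i0: "i \<in> I" "Max ((\<lambda>j. Re (F j z)) ` I) = Re (F i z)" by blast
      have i': "i \<in> I" "\<And>j. j \<in> I \<Longrightarrow> Re (F j z) \<le> Re (F i z)"
        unfolding i0(2)[symmetric] using i0(1) I by (auto intro!: Max_ge)
      have strict: "Re (F j z) < Re (F i z)" if "j \<in> I" "j \<noteq> i" for j
        using i'(2)[OF that(1)] elim(2) that i'(1) zW by (fastforce simp: less_le)
      \<comment> \<open>Membership in the closure suffices: if another phase \<open>l\<close> held
        at z, the open set M_l would contain a point of the closure of M_i and so meet M_i, contrary
        to disjointness. The assumption that l and i differ also makes \<open>I - {i}\<close>
        nonempty, so a single phase needs no separate treatment.\<close>
      have "l = i"
      proof (rule ccontr)
        assume li: "l \<noteq> i"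
        have "z \<in> closure (M i)"
        proof (rule dominant_in_closure[where I=I and A=A and F=F and R=R and p=p and \<kappa>=\<kappa> and m=m and B=B and c=c and f=f and C=C])
          show "I - {i} \<noteq> {}" using l(1) li by blast
          show "z \<in> ball p (m * R / (40 * B))" using zN N(4) by (auto simp: R1_def)
          show "AE z in lborel. z \<in> ball p R \<longrightarrow> (\<exists>j\<in>I. z \<in> M j \<and> f z = A j z)"
            using fae by (rule eventually_mono) blast
          show "p \<in> closure (M i)" using i i'(1) unfolding I_def by blast
          show "c * norm \<zeta> \<le> max \<bar>Re ((A i p - A j p) * \<zeta>)\<bar> \<bar>Re ((A i p - A k p) * \<zeta>)\<bar>"
            if "j \<in> I - {i}" "k \<in> I - {i}" "j \<noteq> k" for j k \<zeta>
            by (rule cmax[OF i'(1) that])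
          show "0 < B" using B1 by simp
        qed (use I i'(1) R F Fp anR m B c(1) \<kappa> fint fC pos cf Mo fM strict in auto)
        then have "M l \<inter> M i \<noteq> {}" using l(1,2) Mo[OF l(1)] open_Int_closure_eq_empty[of "M l" "M i"] by blast
        then show False using disj[OF l(1) i'(1) li] by simp
      qed
      then show "\<exists>i\<in>I. \<Phi> z = A i z \<and> (\<forall>j\<in>I. j \<noteq> i \<longrightarrow> Re (F j z) < Re (F i z))"
        using l strict by blast
    qed
  qed
  have "(\<integral>z. \<Phi> z * complex_of_real (\<psi> z) \<partial>lborel)
      = 2 * distr_dz (\<lambda>z. complex_of_real (Max ((\<lambda>i. Hfun U (A i) p z) ` {1..r}))) \<psi>"
    if "test_fun N \<psi>" for \<psi>
  proof (rule weak_derivative_max[where I=I and A=A and F=F, OF N(1) I ne _ _ _ ae _ that])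
    show "(F i has_field_derivative A i z) (at z)" if "i \<in> I" "z \<in> N" for i z using F that NU by blast
    show "continuous_on N (A i)" if "i \<in> I" for i
      using holomorphic_on_imp_continuous_on[OF an[OF that]] NU continuous_on_subset by blast
    show "set_integrable lborel K \<Phi>" if "compact K" "K \<subseteq> N" for K using loc that NU by blast
    show "Max ((\<lambda>i. Hfun U (A i) p z) ` {1..r}) = Max ((\<lambda>i. Re (F i z)) ` I)" if "z \<in> N" for z
      using HF that NU by (intro arg_cong[of _ _ Max]) (auto simp: I_def intro!: image_cong)
  qed
  then show ?thesis using N NU by blast
qed

end
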